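(* Fix $\tau>0$. For every $\ell\in\mathbb{N}_0$, the Hopf Hardy summand $H^2(Y)\cap(V_\ell\otimes V_\ell^* )$ and the Grauert Hardy summand $H^2(\partial M_\tau)\cap(V_\ell\otimes V_\ell^* )$ have the form $V_\ell\otimes\mathbb{C}u_\ell$ and $V_\ell\otimes\mathbb{C}w_\ell(\tau)$ for lines $\mathbb{C}u_\ell,\ \mathbb{C}w_\ell(\tau)\subset V_\ell^*$. Under the identification $V_\ell^*\simeq V_\ell\simeq\mathrm{Sym}^{2\ell}\mathbb{C}^2$ these lines are represented by $$u_\ell=z_0^{2\ell},\qquad w_\ell(\tau)=\bigl(z_0^2+z_1^2+2\coth\tau\,z_0z_1\bigr)^\ell .$$ Consequently $$H^2(Y)\simeq\widehat{\bigoplus_{\ell\ge0}}\,V_\ell\otimes\mathbb{C}u_\ell,\qquad H^2(\partial M_\tau)\simeq\widehat{\bigoplus_{\ell\ge0}}\,V_\ell\otimes\mathbb{C}w_\ell(\tau).$$ If the invariant inner product on $\mathrm{Sym}^{2\ell}\mathbb{C}^2$ is normalized by $\|z_0^{2\ell}\|=1$, then $$\bigl|\langle\widehat w_\ell(\tau),\widehat u_\ell\rangle\bigr|=\frac{\sqrt{\binom{2\ell}{\ell}}}{2^\ell}\,\frac{\sinh^\ell\tau}{\sqrt{\mathrm{P}_\ell(\cosh 2\tau)}},$$ where $\mathrm{P}_\ell$ is the $\ell$th Legendre polynomial and $\widehat v=v/\|v\|$.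
   Context: Let $e_1,e_2,e_3$ be the standard basis of $\mathbb{R}^3$ and let $E_1,E_2,E_3\in\mathfrak{so}(3)$ be the matrices of infinitesimal rotation with $E_1e_1=0,\ E_1e_2=e_3,\ E_1e_3=-e_2$; $E_2e_1=-e_3,\ E_2e_2=0,\ E_2e_3=e_1$; $E_3e_1=e_2,\ E_3e_2=-e_1,\ E_3e_3=0$. They satisfy $[E_1,E_2]=E_3$ and cyclic permutations. For $X\in\mathfrak{so}(3)$ put $(R_Xf)(g)=\frac{d}{dt}\big|_{t=0}f(g\exp(tX))$ and extend $X\mapsto R_X$ complex-linearly to $\mathfrak{so}(3)_{\mathbb{C}}$. $L^2(\mathrm{SO}(3))$ is taken with respect to normalized Haar measure. The Peter--Weyl decomposition is $L^2(\mathrm{SO}(3))\simeq\bigoplus_{\ell\ge0}V_\ell\otimes V_\ell^*$, where $V_\ell$ is the irreducible unitary $\mathrm{SO}(3)$ representation of dimension $2\ell+1$; the left regular action acts on the first factor and the right regular action acts on the second factor through the contragredient representation. Blocks are regarded as subspaces of $L^2(\mathrm{SO}(3))$. Line-bundle (Hopf) Hardy space: $Y$ is the unit circle bundle of $K_{\mathbb{CP}^1}\simeq\mathcal{O}(-2)$ over the round sphere $\mathbb{S}^2\simeq\mathbb{CP}^1$, identified with $\mathbb{S}^3/\{\pm1\}\simeq\mathrm{SO}(3)$. $H^2(Y)$ is the closed subspace of boundary values of holomorphic functions on the unit disk bundle. Under the identification with $\mathrm{SO}(3)$ its $(0,1)$ operator is $R_{E_1+iE_2}$, and $H^2(Y)$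 is the $L^2$-closure of the smooth functions $f$ on $\mathrm{SO}(3)$ with $R_{E_1+iE_2}f=0$. Grauert-tube Hardy space: let $Q^2=\{z\in\mathbb{C}^3: z\cdot z=1\}$ (complex bilinear dot product) be the complexification of $\mathbb{S}^2$. The radius-$\tau$ Grauert tube boundary $\partial M_\tau$ is identified with $\mathrm{SO}(3)$ by $\Phi_\tau(g)=g z_\tau$, $z_\tau=i\sinh\tau\,e_1+\cosh\tau\,e_3$. $\partial M_\tau=\Phi_\tau(\mathrm{SO}(3))\subset Q^2$ has the CR structure induced from the complex surface $Q^2$, and $H^2(\partial M_\tau)\subset L^2(\mathrm{SO}(3))$ is the $L^2$-closure of the pullbacks $F\circ\Phi_\tau$ of smooth CR functions $F$ on $\partial M_\tau$ (equivalently, the boundary values of holomorphic functions on the tube). Since $V_\ell$ is self-dual, fix an $\mathrm{SO}(3)$-equivariant unitary identification $V_\ell^*\simeq V_\ell$ and realize it as $\mathrm{Sym}^{2\ell}\mathbb{C}^2$, the space of homogeneous polynomials of degree $2\ell$ in $(z_0,z_1)$, with the complexified Lie algebra acting by $$E_1+iE_2\mapsto z_0\partial_{z_1},\quad -E_1+iE_2\mapsto z_1\partial_{z_0},\quad 2iE_3\mapsto z_0\partial_{z_0}-z_1\partial_{z_1}.$$ The invariant inner product normalized by $\|z_0^{2\ell}\|=1$ makes the monomials orthogonal with $\|z_0^{2\ell-k}z_1^k\|^2=\binom{2\ell}{k}^{-1}$. *)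

theory Defs
  imports "Jordan_Normal_Form.Matrix" "HOL-Analysis.Analysis"
begin

(* From here on, $ and \<bullet> are the component and inner product of HOL-Analysis; the
   vectors and matrices of Jordan_Normal_Form (sizes given by natural numbers, needed because
   dim V_l = 2l+1 varies with l) are accessed by vec_index, scalar_prod, etc. *)
no_notation vec_index (infixl \<open>$\<close> 100)
no_notation scalar_prod (infix \<open>\<bullet>\<close> 70)

definition SO3 :: "(real^3^3) set" where
  "SO3 = {g. rotation_matrix g}"

definition normalized_haar :: "(real^3^3) measure \<Rightarrow> bool" where
  "normalized_haar \<mu> \<longleftrightarrow>
     sets \<mu> = sets (restrict_space borel SO3) \<and>
     emeasure \<mu> SO3 = 1 \<and>
     (\<forall>g\<in>SO3. \<forall>A\<in>sets \<mu>. emeasure \<mu> ((\<lambda>h. g ** h) ` A) = emeasure \<mu> A)"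

definition E1 :: "real^3^3" where
  "E1 = vector [vector [0, 0, 0], vector [0, 0, -1], vector [0, 1, 0]]"

definition E2 :: "real^3^3" where
  "E2 = vector [vector [0, 0, 1], vector [0, 0, 0], vector [-1, 0, 0]]"

definition E3 :: "real^3^3" where
  "E3 = vector [vector [0, -1, 0], vector [1, 0, 0], vector [0, 0, 0]]"

lemma E_action:
  "E1 *v axis 1 1 = 0" "E1 *v axis 2 1 = axis 3 1" "E1 *v axis 3 1 = - axis 2 1"
  "E2 *v axis 1 1 = - axis 3 1" "E2 *v axis 2 1 = 0" "E2 *v axis 3 1 = axis 1 1"
  "E3 *v axis 1 1 = axis 2 1" "E3 *v axis 2 1 = - axis 1 1" "E3 *v axis 3 1 = 0"
  by (simp_all add: E1_def E2_def E3_def vec_eq_iff forall_3 sum_3 axis_def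
      matrix_vector_mult_def)

(* The type real^3^3 carries the componentwise multiplication, so the library's exp is not
   the matrix exponential. *)
definition matexp :: "real^3^3 \<Rightarrow> real^3^3" where
  "matexp X = (\<Sum>k. (1 / fact k) *\<^sub>R (((\<lambda>A. X ** A) ^^ k) (Finite_Cartesian_Product.mat 1)))"

definition lie_deriv :: "real^3^3 \<Rightarrow> (real^3^3 \<Rightarrow> complex) \<Rightarrow> real^3^3 \<Rightarrow> complex" where
  "lie_deriv X f g = vector_derivative (\<lambda>t. f (g ** matexp (t *\<^sub>R X))) (at 0)"

(* R_{X + iY}, the complex-linear extension of X \<mapsto> R_X. *)
definition lie_deriv_c :: "real^3^3 \<Rightarrow> real^3^3 \<Rightarrow> (real^3^3 \<Rightarrow> complex) \<Rightarrow> real^3^3 \<Rightarrow> complex" where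
  "lie_deriv_c X Y f g = lie_deriv X f g + \<i> * lie_deriv Y f g"

primrec Ck_on :: "nat \<Rightarrow> 'a::euclidean_space set \<Rightarrow> ('a \<Rightarrow> 'b::real_normed_vector) \<Rightarrow> bool" where
  "Ck_on 0 U f \<longleftrightarrow> continuous_on U f"
| "Ck_on (Suc k) U f \<longleftrightarrow>
     (\<forall>x\<in>U. f differentiable at x) \<and> (\<forall>v. Ck_on k U (\<lambda>x. frechet_derivative f (at x) v))"

(* Smoothness on an embedded submanifold M: local extendability to a smooth function on an
   open subset of the ambient space. Values off M are irrelevant. *)
definition smooth_on_mfd :: "'a::euclidean_space set \<Rightarrow> ('a \<Rightarrow> 'b::real_normed_vector) \<Rightarrow> bool" where
  "smooth_on_mfd M f \<longleftrightarrow>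
     (\<forall>p\<in>M. \<exists>U G. open U \<and> p \<in> U \<and> (\<forall>k. Ck_on k U G) \<and> (\<forall>x\<in>M \<inter> U. G x = f x))"

(* Elements of L2 are represented by square-integrable functions. A subspace of L2 is
   represented by the set of all representatives of its elements, that is, by a set of
   functions that is closed under equality almost everywhere. *)
definition L2 :: "'a measure \<Rightarrow> ('a \<Rightarrow> complex) set" where
  "L2 \<mu> = {f. f \<in> borel_measurable \<mu> \<and> integrable \<mu> (\<lambda>x. (cmod (f x))\<^sup>2)}"

definition l2_inner :: "'a measure \<Rightarrow> ('a \<Rightarrow> complex) \<Rightarrow> ('a \<Rightarrow> complex) \<Rightarrow> complex" where
  "l2_inner \<mu> f g = (\<integral>x. f x * cnj (g x) \<partial>\<mu>)"

definition l2_norm :: "'a measure \<Rightarrow> ('a \<Rightarrow> complex) \<Rightarrow> real" where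
  "l2_norm \<mu> f = sqrt (\<integral>x. (cmod (f x))\<^sup>2 \<partial>\<mu>)"

definition l2_closure :: "'a measure \<Rightarrow> ('a \<Rightarrow> complex) set \<Rightarrow> ('a \<Rightarrow> complex) set" where
  "l2_closure \<mu> A = {f \<in> L2 \<mu>. \<forall>\<epsilon>>0. \<exists>g\<in>A \<inter> L2 \<mu>. l2_norm \<mu> (\<lambda>x. f x - g x) < \<epsilon>}"

definition fun_span :: "('a \<Rightarrow> complex) set \<Rightarrow> ('a \<Rightarrow> complex) set" where
  "fun_span A = {F. \<exists>(n::nat) c f. (\<forall>i<n. f i \<in> A) \<and> F = (\<lambda>x. \<Sum>i<n. c i * f i x)}"

definition l2_closed_subspace :: "'a measure \<Rightarrow> ('a \<Rightarrow> complex) set \<Rightarrow> bool" where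
  "l2_closed_subspace \<mu> H \<longleftrightarrow> H = l2_closure \<mu> (fun_span H)"

definition l2_direct_sum ::
    "'a measure \<Rightarrow> ('a \<Rightarrow> complex) set \<Rightarrow> (nat \<Rightarrow> ('a \<Rightarrow> complex) set) \<Rightarrow> bool" where
  "l2_direct_sum \<mu> H W \<longleftrightarrow>
     (\<forall>l. l2_closed_subspace \<mu> (W l)) \<and>
     (\<forall>l m. l \<noteq> m \<longrightarrow> (\<forall>f\<in>W l. \<forall>g\<in>W m. l2_inner \<mu> f g = 0)) \<and>
     H = l2_closure \<mu> (fun_span (\<Union>l. W l))"

definition hopf_hardy :: "(real^3^3) measure \<Rightarrow> (real^3^3 \<Rightarrow> complex) set" where
  "hopf_hardy \<mu> =
     l2_closure \<mu> {f. smooth_on_mfd SO3 f \<and> (\<forall>g\<in>SO3. lie_deriv_c E1 E2 f g = 0)}"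

definition z_tau :: "real \<Rightarrow> complex^3" where
  "z_tau \<tau> = vector [\<i> * of_real (sinh \<tau>), 0, of_real (cosh \<tau>)]"

definition Phi :: "real \<Rightarrow> real^3^3 \<Rightarrow> complex^3" where
  "Phi \<tau> g = (\<chi> i j. complex_of_real (g $ i $ j)) *v z_tau \<tau>"

definition Q2 :: "(complex^3) set" where
  "Q2 = {z. (\<Sum>i\<in>UNIV. z $ i * z $ i) = 1}"

definition tube_boundary :: "real \<Rightarrow> (complex^3) set" where
  "tube_boundary \<tau> = Phi \<tau> ` SO3"

lemma tube_boundary_subset_Q2: "tube_boundary \<tau> \<subseteq> Q2"
proof -
  have "Phi \<tau> g \<in> Q2" if "g \<in> SO3" for g
  proof -
    let ?G = "(\<chi> i j. complex_of_real (g $ i $ j)) :: complex^3^3"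
    let ?z = "z_tau \<tau>"
    have "transpose g ** g = Finite_Cartesian_Product.mat 1"
      using that by (simp add: SO3_def rotation_matrix_def orthogonal_matrix)
    then have *: "(transpose g ** g) $ i $ j = (Finite_Cartesian_Product.mat 1 :: real^3^3) $ i $ j"
      for i j by simp
    have g: "(\<Sum>k\<in>UNIV. g $ k $ i * g $ k $ j) = (if i = j then 1 else 0)" for i j
      using *[of i j]
      by (simp add: matrix_matrix_mult_def Finite_Cartesian_Product.transpose_def
          Finite_Cartesian_Product.mat_def)
    have gc: "(\<Sum>k\<in>UNIV. complex_of_real (g $ k $ i) * complex_of_real (g $ k $ j))
        = (if i = j then 1 else 0)" for i j
      using arg_cong[OF g[of i j], of complex_of_real] by simp
    have "(\<Sum>k\<in>UNIV. Phi \<tau> g $ k * Phi \<tau> g $ k)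
        = (\<Sum>k\<in>UNIV. \<Sum>i\<in>UNIV. \<Sum>j\<in>UNIV. ?z $ i * ?z $ j *
            (complex_of_real (g $ k $ i) * complex_of_real (g $ k $ j)))"
      by (simp add: Phi_def matrix_vector_mult_def sum_product mult_ac)
    also have "\<dots> = (\<Sum>i\<in>UNIV. \<Sum>j\<in>UNIV. ?z $ i * ?z $ j *
            (\<Sum>k\<in>UNIV. complex_of_real (g $ k $ i) * complex_of_real (g $ k $ j)))"
      by (simp add: sum_distrib_left sum.swap[of _ UNIV UNIV] sum_3 algebra_simps)
    also have "\<dots> = (\<Sum>i\<in>UNIV. ?z $ i * ?z $ i)"
      by (simp add: gc if_distrib sum.delta cong: if_cong)
    also have "\<dots> = of_real ((cosh \<tau>)\<^sup>2 - (sinh \<tau>)\<^sup>2)"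
      by (simp add: z_tau_def sum_3 power2_eq_square algebra_simps)
    also have "\<dots> = 1"
      by (simp add: hyperbolic_pythagoras)
    finally show ?thesis by (simp add: Q2_def)
  qed
  then show ?thesis by (auto simp: tube_boundary_def)
qed

(* v is the velocity at 0 of the curve \<gamma> in M with \<gamma> 0 = p; the vectors v obtained from such
   curves form the tangent space T_pM of a submanifold M. *)
definition curve_at ::
    "'a::real_normed_vector set \<Rightarrow> 'a \<Rightarrow> (real \<Rightarrow> 'a) \<Rightarrow> 'a \<Rightarrow> bool" where
  "curve_at M p \<gamma> v \<longleftrightarrow>
     (\<forall>t. \<gamma> t \<in> M) \<and> \<gamma> 0 = p \<and> (\<gamma> has_vector_derivative v) (at 0)"

(* Smooth CR functions on a real submanifold M of a complex submanifold of C^3 (here Q2), whose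
   complex structure J is multiplication by i on tangent vectors. T^{0,1}_pM consists of the
   v + i \<otimes> Jv in the complexified tangent space with v and Jv in T_pM, so the tangential
   Cauchy-Riemann equations say dF_p(v) + i dF_p(Jv) = 0; dF_p is computed along curves in M. *)
definition cr_function :: "(complex^3) set \<Rightarrow> (complex^3 \<Rightarrow> complex) \<Rightarrow> bool" where
  "cr_function M F \<longleftrightarrow>
     smooth_on_mfd M F \<and>
     (\<forall>p\<in>M. \<forall>\<gamma> \<delta> v. curve_at M p \<gamma> v \<and> curve_at M p \<delta> (\<i> *s v) \<longrightarrow>
        vector_derivative (F \<circ> \<gamma>) (at 0) + \<i> * vector_derivative (F \<circ> \<delta>) (at 0) = 0)"

definition grauert_hardy :: "(real^3^3) measure \<Rightarrow> real \<Rightarrow> (real^3^3 \<Rightarrow> complex) set" where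
  "grauert_hardy \<mu> \<tau> = l2_closure \<mu> {F \<circ> Phi \<tau> | F. cr_function (tube_boundary \<tau>) F}"

definition vec_subspace :: "nat \<Rightarrow> complex Matrix.vec set \<Rightarrow> bool" where
  "vec_subspace n W \<longleftrightarrow>
     W \<subseteq> carrier_vec n \<and> 0\<^sub>v n \<in> W \<and>
     (\<forall>v\<in>W. \<forall>w\<in>W. v + w \<in> W) \<and> (\<forall>c. \<forall>v\<in>W. c \<cdot>\<^sub>v v \<in> W)"

(* Unitary representations on an n-dimensional Hilbert space, in an orthonormal basis. *)
definition unitary_rep :: "nat \<Rightarrow> (real^3^3 \<Rightarrow> complex Matrix.mat) \<Rightarrow> bool" where
  "unitary_rep n \<pi> \<longleftrightarrow>
     (\<forall>g\<in>SO3. \<pi> g \<in> carrier_mat n n) \<and>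
     \<pi> (Finite_Cartesian_Product.mat 1) = 1\<^sub>m n \<and>
     (\<forall>g\<in>SO3. \<forall>h\<in>SO3. \<pi> (g ** h) = \<pi> g * \<pi> h) \<and>
     (\<forall>g\<in>SO3. \<forall>v\<in>carrier_vec n. \<forall>w\<in>carrier_vec n.
        (\<pi> g *\<^sub>v v) \<bullet>c (\<pi> g *\<^sub>v w) = v \<bullet>c w) \<and>
     (\<forall>i<n. \<forall>j<n. continuous_on SO3 (\<lambda>g. \<pi> g $$ (i, j)))"

definition irreducible_unitary_rep :: "nat \<Rightarrow> (real^3^3 \<Rightarrow> complex Matrix.mat) \<Rightarrow> bool" where
  "irreducible_unitary_rep n \<pi> \<longleftrightarrow>
     unitary_rep n \<pi> \<and> n > 0 \<and>
     (\<forall>W. vec_subspace n W \<and> (\<forall>g\<in>SO3. \<forall>v\<in>W. \<pi> g *\<^sub>v v \<in> W) \<longrightarrow>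
        W = {0\<^sub>v n} \<or> W = carrier_vec n)"

(* Functionals on V are written in the dual basis: \<phi> is the functional v \<mapsto> scalar_prod \<phi> v, and
   g acts on V* by \<phi> \<mapsto> \<phi> \<circ> \<pi>(g^{-1}). *)
definition contragredient :: "(real^3^3 \<Rightarrow> complex Matrix.mat) \<Rightarrow> real^3^3 \<Rightarrow> complex Matrix.mat" where
  "contragredient \<pi> g = transpose_mat (\<pi> (matrix_inv g))"

(* v \<otimes> \<phi> as a function on SO(3). With this convention the left regular action
   f \<mapsto> f(h^{-1} \<cdot>) is \<pi>(h) on v, and the right regular action f \<mapsto> f(\<cdot> h) is the contragredient
   action of h on \<phi>. *)
definition tensor_fun ::
    "(real^3^3 \<Rightarrow> complex Matrix.mat) \<Rightarrow> complex Matrix.vec \<Rightarrow> complex Matrix.vec \<Rightarrow> real^3^3 \<Rightarrow> complex" where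
  "tensor_fun \<pi> v \<phi> g = scalar_prod \<phi> (\<pi> (matrix_inv g) *\<^sub>v v)"

(* V \<otimes> L as a subspace of L2, for a subspace L of V*. *)
definition tensor_space ::
    "(real^3^3) measure \<Rightarrow> nat \<Rightarrow> (real^3^3 \<Rightarrow> complex Matrix.mat) \<Rightarrow> complex Matrix.vec set \<Rightarrow>
     (real^3^3 \<Rightarrow> complex) set" where
  "tensor_space \<mu> n \<pi> L =
     {f \<in> L2 \<mu>. \<exists>F\<in>fun_span {tensor_fun \<pi> v \<phi> | v \<phi>. v \<in> carrier_vec n \<and> \<phi> \<in> L}.
        AE g in \<mu>. f g = F g}"

abbreviation peter_weyl_block ::
    "(real^3^3) measure \<Rightarrow> nat \<Rightarrow> (real^3^3 \<Rightarrow> complex Matrix.mat) \<Rightarrow> (real^3^3 \<Rightarrow> complex) set" where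
  "peter_weyl_block \<mu> n \<pi> \<equiv> tensor_space \<mu> n \<pi> (carrier_vec n)"

definition vec_line :: "nat \<Rightarrow> complex Matrix.vec set \<Rightarrow> bool" where
  "vec_line n L \<longleftrightarrow> (\<exists>v\<in>carrier_vec n. v \<noteq> 0\<^sub>v n \<and> L = {c \<cdot>\<^sub>v v | c. True})"

definition unitary_intertwiner ::
    "nat \<Rightarrow> (real^3^3 \<Rightarrow> complex Matrix.mat) \<Rightarrow> (real^3^3 \<Rightarrow> complex Matrix.mat) \<Rightarrow>
     (complex Matrix.vec \<Rightarrow> complex Matrix.vec) \<Rightarrow> bool" where
  "unitary_intertwiner n \<rho> \<sigma> K \<longleftrightarrow>
     bij_betw K (carrier_vec n) (carrier_vec n) \<and>
     (\<forall>v\<in>carrier_vec n. \<forall>w\<in>carrier_vec n. K (v + w) = K v + K w) \<and>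
     (\<forall>c. \<forall>v\<in>carrier_vec n. K (c \<cdot>\<^sub>v v) = c \<cdot>\<^sub>v K v) \<and>
     (\<forall>v\<in>carrier_vec n. \<forall>w\<in>carrier_vec n. K v \<bullet>c K w = v \<bullet>c w) \<and>
     (\<forall>g\<in>SO3. \<forall>v\<in>carrier_vec n. K (\<rho> g *\<^sub>v v) = \<sigma> g *\<^sub>v K v)"

definition rep_deriv ::
    "nat \<Rightarrow> (real^3^3 \<Rightarrow> complex Matrix.mat) \<Rightarrow> real^3^3 \<Rightarrow> complex Matrix.vec \<Rightarrow> complex Matrix.vec" where
  "rep_deriv n \<pi> X v =
     Matrix.vec n (\<lambda>i. vector_derivative (\<lambda>t. vec_index (\<pi> (matexp (t *\<^sub>R X)) *\<^sub>v v) i) (at 0))"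

(* The action of X + iY in the complexified Lie algebra. *)
definition rep_deriv_c ::
    "nat \<Rightarrow> (real^3^3 \<Rightarrow> complex Matrix.mat) \<Rightarrow> real^3^3 \<Rightarrow> real^3^3 \<Rightarrow>
     complex Matrix.vec \<Rightarrow> complex Matrix.vec" where
  "rep_deriv_c n \<pi> X Y v = rep_deriv n \<pi> X v + \<i> \<cdot>\<^sub>v rep_deriv n \<pi> Y v"

(* Over the infinite field of complex numbers, polynomials are identified with polynomial
   functions (z0, z1) \<mapsto> p z0 z1. *)
type_synonym bipoly = "complex \<Rightarrow> complex \<Rightarrow> complex"

definition Sym :: "nat \<Rightarrow> bipoly set" where
  "Sym n = {p. \<exists>a. p = (\<lambda>z0 z1. \<Sum>k\<le>n. a k * z0 ^ (n - k) * z1 ^ k)}"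

definition bi_add :: "bipoly \<Rightarrow> bipoly \<Rightarrow> bipoly" where
  "bi_add p q = (\<lambda>z0 z1. p z0 z1 + q z0 z1)"

definition bi_smult :: "complex \<Rightarrow> bipoly \<Rightarrow> bipoly" where
  "bi_smult c p = (\<lambda>z0 z1. c * p z0 z1)"

definition d0 :: "bipoly \<Rightarrow> bipoly" where
  "d0 p = (\<lambda>z0 z1. deriv (\<lambda>z. p z z1) z0)"

definition d1 :: "bipoly \<Rightarrow> bipoly" where
  "d1 p = (\<lambda>z0 z1. deriv (\<lambda>z. p z0 z) z1)"

definition sym_raise :: "bipoly \<Rightarrow> bipoly" where
  "sym_raise p = (\<lambda>z0 z1. z0 * d1 p z0 z1)"

definition sym_lower :: "bipoly \<Rightarrow> bipoly" where
  "sym_lower p = (\<lambda>z0 z1. z1 * d0 p z0 z1)"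

definition sym_weight :: "bipoly \<Rightarrow> bipoly" where
  "sym_weight p = (\<lambda>z0 z1. z0 * d0 p z0 z1 - z1 * d1 p z0 z1)"

(* Invariance: every X in so(3) acts skew-adjointly, so X + iY has adjoint -X + iY. Hence
   E1 + iE2 and -E1 + iE2 are adjoint to each other and 2iE3 is self-adjoint. *)
definition invariant_inner_product :: "nat \<Rightarrow> (bipoly \<Rightarrow> bipoly \<Rightarrow> complex) \<Rightarrow> bool" where
  "invariant_inner_product n B \<longleftrightarrow>
     (\<forall>p\<in>Sym n. \<forall>q\<in>Sym n. \<forall>r\<in>Sym n. B (bi_add p q) r = B p r + B q r) \<and>
     (\<forall>c. \<forall>p\<in>Sym n. \<forall>q\<in>Sym n. B (bi_smult c p) q = c * B p q) \<and>
     (\<forall>p\<in>Sym n. \<forall>q\<in>Sym n. B q p = cnj (B p q)) \<and>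
     (\<forall>p\<in>Sym n. p \<noteq> (\<lambda>z0 z1. 0) \<longrightarrow> Re (B p p) > 0) \<and>
     (\<forall>p\<in>Sym n. \<forall>q\<in>Sym n. B (sym_raise p) q = B p (sym_lower q)) \<and>
     (\<forall>p\<in>Sym n. \<forall>q\<in>Sym n. B (sym_weight p) q = B p (sym_weight q))"

(* E1 + iE2, -E1 + iE2 and 2iE3 span the complexified Lie algebra, so S intertwines the
   whole action. *)
definition sym_realization ::
    "nat \<Rightarrow> (real^3^3 \<Rightarrow> complex Matrix.mat) \<Rightarrow> (bipoly \<Rightarrow> bipoly \<Rightarrow> complex) \<Rightarrow>
     (complex Matrix.vec \<Rightarrow> bipoly) \<Rightarrow> bool" where
  "sym_realization l \<pi> B S \<longleftrightarrow>
     (let n = 2 * l + 1; V = carrier_vec n in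
       bij_betw S V (Sym (2 * l)) \<and>
       (\<forall>v\<in>V. \<forall>w\<in>V. S (v + w) = bi_add (S v) (S w)) \<and>
       (\<forall>c. \<forall>v\<in>V. S (c \<cdot>\<^sub>v v) = bi_smult c (S v)) \<and>
       (\<forall>v\<in>V. \<forall>w\<in>V. B (S v) (S w) = v \<bullet>c w) \<and>
       (\<forall>v\<in>V. S (rep_deriv_c n \<pi> E1 E2 v) = sym_raise (S v)) \<and>
       (\<forall>v\<in>V. S (rep_deriv_c n \<pi> (- E1) E2 v) = sym_lower (S v)) \<and>
       (\<forall>v\<in>V. S (rep_deriv_c n \<pi> 0 (2 *\<^sub>R E3) v) = sym_weight (S v)))"

definition bi_line :: "bipoly \<Rightarrow> bipoly set" where
  "bi_line p = {bi_smult c p | c. True}"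

definition bi_normalize :: "(bipoly \<Rightarrow> bipoly \<Rightarrow> complex) \<Rightarrow> bipoly \<Rightarrow> bipoly" where
  "bi_normalize B p = bi_smult (of_real (1 / sqrt (Re (B p p)))) p"

definition u_hopf :: "nat \<Rightarrow> bipoly" where
  "u_hopf l = (\<lambda>z0 z1. z0 ^ (2 * l))"

definition w_grauert :: "real \<Rightarrow> nat \<Rightarrow> bipoly" where
  "w_grauert \<tau> l =
     (\<lambda>z0 z1. (z0\<^sup>2 + z1\<^sup>2 + 2 * of_real (cosh \<tau> / sinh \<tau>) * z0 * z1) ^ l)"

(* Legendre polynomials, by Rodrigues' formula. *)
definition legendre :: "nat \<Rightarrow> real poly" where
  "legendre l = smult (1 / (2 ^ l * fact l)) ((pderiv ^^ l) ([:-1, 0, 1:] ^ l))"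

end

(* A double cover of SO(3) by 2x2 matrices makes SO(3) act on Sym^{2l} C^2, and the functions
   g |-> (g . p)(z0, z1) with p in Sym^{2l} span the l-th Peter-Weyl block. On such a function the right
   derivative R_x acts through the Lie algebra action of x on p. Both Hardy spaces are closures of the
   kernel of one R_x: x = E1 + i E2 for the circle bundle, and x = i sinh(tau) E1 + cosh(tau) E3, the
   generator of the (0,1) direction pulled back by Phi_tau, for the tube. Since R_x is skew with respect
   to Haar measure, a limit of killed functions is orthogonal to the range of R_y on each block, where y
   is minus the conjugate of x, so its block components are killed as well. The equation x p = 0 is a
   three-term recursion for the coefficients of p, with a one-dimensional solution space; z0^(2l) and
   w_l(tau) solve it. That the blocks are total follows from Stone-Weierstrass and the decomposition of
   polynomials into blocks. A rotation turns w_l(tau) into z0^l (2 z0 + (2 / sinh tau) z1)^l, whose norm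
   is an explicit sum over monomials that Rodrigues' formula identifies with P_l(cosh 2 tau). *)
theory Submission
  imports Defs "HOL-Probability.Probability_Measure" "Jordan_Normal_Form.Determinant"
begin

(* Determinant brings back the notation that Defs removes. *)
no_notation vec_index (infixl \<open>$\<close> 100)
no_notation scalar_prod (infix \<open>\<bullet>\<close> 70)

section \<open>The rotation group\<close>

text \<open>The lift of a rotation to a 2x2 matrix is chosen pointwise by \<open>SOME\<close>, and
  no continuity of the choice enters. Every monomial of even degree is a product of quadratic forms,
  on which a lift acts through the rotation itself; so the action is well defined, and its
  coefficients are polynomials in the entries of g, hence continuous and smooth. A form of degree n
  is determined by its values at the points (1, i), i \<le> n; this makes a block finitely
  generated, with evaluation at these points in the role of the first tensor factor. The abstract
  \<pi> is only continuous and S is specified only on the Lie algebra, so \<pi> must be shown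
  differentiable and S integrated to the group before \<pi> can be replaced by the concrete action.
  Haar measure is given as left invariant, whereas skewness of R_X needs right invariance, which a
  Fubini argument supplies. Subspaces of L2 are sets of representatives; pointwise identities are
  recovered because a continuous function that vanishes almost everywhere vanishes.\<close>

definition Egen :: "3 \<Rightarrow> real^3^3" where
  "Egen j = (if j = 1 then E1 else if j = 2 then E2 else E3)"

definition rot :: "3 \<Rightarrow> real \<Rightarrow> real^3^3" where
  "rot j t = matexp (t *\<^sub>R Egen j)"

text \<open>If X^3 = -X, the odd powers are X up to sign and the even positive ones are X^2 up to
  sign, so the exponential series splits into a sine and a cosine series (Rodrigues' rotation
  formula).\<close>

lemma matexp_of_cube:
  fixes X :: "real^3^3"
  assumes X: "X ** (X ** X) = - X"
  shows "matexp (t *\<^sub>R X) =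
    Finite_Cartesian_Product.mat 1 + sin t *\<^sub>R X + (1 - cos t) *\<^sub>R (X ** X)"
proof -
  let ?P = "\<lambda>k. ((\<lambda>A. (t *\<^sub>R X) ** A) ^^ k) (Finite_Cartesian_Product.mat 1)"
  \<comment> \<open>The term k = 0 is the identity, whereas - cos t X^2 contributes -X^2 there;
    \<open>?S\<close> repairs this one term.\<close>
  let ?S = "\<lambda>k. (if k = 0 then Finite_Cartesian_Product.mat 1 + X ** X else 0)"
  have main: "(1 / fact k) *\<^sub>R ?P k
      = (sin_coeff k *\<^sub>R t ^ k) *\<^sub>R X - (cos_coeff k *\<^sub>R t ^ k) *\<^sub>R (X ** X) + ?S k" for k
  proof -
    have XXX: "X ** (X ** (X ** X)) = - (X ** X)"
      by (simp add: X) (simp add: vec_eq_iff matrix_matrix_mult_def sum_negf)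
    have step: "(t *\<^sub>R X) ** (c *\<^sub>R Y) = (t * c) *\<^sub>R (X ** Y)" for c and Y :: "real^3^3"
      by (simp add: vec_eq_iff matrix_matrix_mult_def sum_distrib_left mult_ac)
    have neg: "X ** (- Y) = - (X ** Y)" for Y :: "real^3^3"
      by (simp add: vec_eq_iff matrix_matrix_mult_def sum_negf)
    have P: "?P (2 * m + 1) = ((-1) ^ m * t ^ (2 * m + 1)) *\<^sub>R X
        \<and> ?P (2 * m + 2) = ((-1) ^ m * t ^ (2 * m + 2)) *\<^sub>R (X ** X)" for m
    proof (induction m)
      case 0
      show ?case using step[of t X] by (simp add: power2_eq_square)
    next
      case (Suc m)
      have 1: "?P (2 * Suc m + 1) = (t *\<^sub>R X) ** ?P (2 * m + 2)"
        by simp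
      have 2: "?P (2 * Suc m + 2) = (t *\<^sub>R X) ** ((t *\<^sub>R X) ** ?P (2 * m + 2))"
        by simp
      have 3: "?P (2 * m + 2) = ((-1) ^ m * t ^ (2 * m + 2)) *\<^sub>R (X ** X)"
        using Suc by blast
      show ?case
        unfolding 1 2 3 step by (simp add: X XXX neg)
    qed
    have "k = 0 \<or> (\<exists>m. k = 2 * m + 1) \<or> (\<exists>m. k = 2 * m + 2)"
      by presburger
    then consider "k = 0" | m where "k = 2 * m + 1" | m where "k = 2 * m + 2"
      by blast
    then show ?thesis
    proof cases
      case 1
      then show ?thesis by simp
    next
      case (2 m)
      have "?P k = ((-1) ^ m * t ^ k) *\<^sub>R X"
        using P[of m] unfolding 2 by (rule conjunct1)
      then show ?thesis
        by (rule ssubst) (simp add: 2 sin_coeff_def cos_coeff_def del: funpow.simps)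
    next
      case (3 m)
      have "?P k = ((-1) ^ m * t ^ k) *\<^sub>R (X ** X)"
        using P[of m] unfolding 3 by (rule conjunct2)
      then show ?thesis
        by (rule ssubst) (simp add: 3 sin_coeff_def cos_coeff_def del: funpow.simps)
    qed
  qed
  have "(\<lambda>k. (1 / fact k) *\<^sub>R ?P k) sums
      (sin t *\<^sub>R X - cos t *\<^sub>R (X ** X) + (Finite_Cartesian_Product.mat 1 + X ** X))"
    unfolding main
    by (intro sums_add sums_diff sums_scaleR_left sin_converges cos_converges)
      (use sums_single[of 0 "\<lambda>_. Finite_Cartesian_Product.mat 1 + X ** X"] in \<open>simp cong: if_cong\<close>)
  then show ?thesis
    unfolding matexp_def by (simp add: sums_unique[symmetric] algebra_simps)
qed

lemma Egen_cube: "Egen j ** (Egen j ** Egen j) = - Egen j"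
  using exhaust_3[of j]
  by (auto simp: Egen_def E1_def E2_def E3_def vec_eq_iff forall_3 matrix_matrix_mult_def sum_3)

lemma rot_explicit:
  "rot 1 t = vector [vector [1, 0, 0], vector [0, cos t, - sin t], vector [0, sin t, cos t]]"
  "rot 2 t = vector [vector [cos t, 0, sin t], vector [0, 1, 0], vector [- sin t, 0, cos t]]"
  "rot 3 t = vector [vector [cos t, - sin t, 0], vector [sin t, cos t, 0], vector [0, 0, 1]]"
  unfolding rot_def matexp_of_cube[OF Egen_cube]
  by (simp_all add: Egen_def E1_def E2_def E3_def vec_eq_iff forall_3 matrix_matrix_mult_def sum_3
      Finite_Cartesian_Product.mat_def)

lemma rot_add: "rot j (s + t) = rot j s ** rot j t"
proof -
  have "\<forall>j. rot j (s + t) = rot j s ** rot j t"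
    unfolding forall_3 rot_explicit
    by (simp add: vec_eq_iff forall_3 matrix_matrix_mult_def sum_3 sin_add cos_add)
  then show ?thesis by blast
qed

lemma rot_0 [simp]: "rot j 0 = Finite_Cartesian_Product.mat 1"
proof -
  have "\<forall>j. rot j 0 = Finite_Cartesian_Product.mat 1"
    unfolding forall_3 rot_explicit
    by (simp add: vec_eq_iff forall_3 Finite_Cartesian_Product.mat_def)
  then show ?thesis by blast
qed

lemma SO3_iff: "g \<in> SO3 \<longleftrightarrow> transpose g ** g = Finite_Cartesian_Product.mat 1 \<and> Determinants.det g = 1"
  by (simp add: SO3_def rotation_matrix_def orthogonal_matrix)

lemma rot_in_SO3 [simp]: "rot j t \<in> SO3"
proof -
  have "\<forall>j. rot j t \<in> SO3"
    unfolding forall_3 rot_explicit SO3_iff det_3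
    by (simp add: vec_eq_iff forall_3 Finite_Cartesian_Product.mat_def matrix_matrix_mult_def sum_3
        Finite_Cartesian_Product.transpose_def flip: power2_eq_square)
  then show ?thesis by blast
qed

lemma SO3_one [simp]: "Finite_Cartesian_Product.mat 1 \<in> SO3"
  by (simp add: SO3_iff transpose_mat)

lemma SO3_mult [intro]: "g \<in> SO3 \<Longrightarrow> h \<in> SO3 \<Longrightarrow> g ** h \<in> SO3"
  by (simp add: SO3_def rotation_matrix_def orthogonal_matrix_mul Determinants.det_mul)

lemma SO3_inv_eq: "g \<in> SO3 \<Longrightarrow> matrix_inv g = transpose g"
proof -
  assume "g \<in> SO3"
  then have l: "transpose g ** g = Finite_Cartesian_Product.mat 1"
    and r: "g ** transpose g = Finite_Cartesian_Product.mat 1"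
    using matrix_left_right_inverse by (auto simp: SO3_iff)
  then have "g ** matrix_inv g = Finite_Cartesian_Product.mat 1"
    unfolding matrix_inv_def by (metis (mono_tags, lifting) someI_ex)
  then show ?thesis
    by (metis l matrix_mul_assoc matrix_mul_lid matrix_mul_rid)
qed

lemma SO3_inv [intro]: "g \<in> SO3 \<Longrightarrow> matrix_inv g \<in> SO3"
  by (simp add: SO3_inv_eq) (simp add: SO3_def rotation_matrix_def Determinants.det_transpose)

lemma SO3_right_inv: "g \<in> SO3 \<Longrightarrow> g ** matrix_inv g = Finite_Cartesian_Product.mat 1"
  by (metis SO3_iff SO3_inv_eq matrix_left_right_inverse)

lemma SO3_left_inv: "g \<in> SO3 \<Longrightarrow> matrix_inv g ** g = Finite_Cartesian_Product.mat 1"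
  by (simp add: SO3_iff SO3_inv_eq)

text \<open>Boundedness: the squared norm of g is the trace of g^T g, which is 3. Closedness: the
  defining equations are continuous.\<close>

lemma compact_SO3: "compact SO3"
proof -
  have "norm g \<le> sqrt 3" if "g \<in> SO3" for g
  proof -
    have *: "(transpose g ** g) $ i $ i = 1" for i
      using that by (simp add: SO3_iff Finite_Cartesian_Product.mat_def)
    have "(norm g)\<^sup>2 = (\<Sum>i\<in>UNIV. \<Sum>k\<in>UNIV. (g $ k $ i)\<^sup>2)"
      unfolding power2_norm_eq_inner inner_vec_def by (simp add: power2_eq_square) (rule sum.swap)
    also have "\<dots> = 3"
      using *[of 1] *[of 2] *[of 3]
      by (simp add: matrix_matrix_mult_def Finite_Cartesian_Product.transpose_def sum_3 power2_eq_square)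
    finally show ?thesis
      by (simp add: real_le_rsqrt)
  qed
  then have "bounded SO3"
    by (auto simp: bounded_iff)
  moreover have "closed SO3"
  proof -
    have 1: "continuous_on UNIV (\<lambda>g::real^3^3. Determinants.det g)"
      unfolding det_3 by (intro continuous_intros)
    have 2: "continuous_on UNIV (\<lambda>g::real^3^3. transpose g ** g)"
      unfolding matrix_matrix_mult_def Finite_Cartesian_Product.transpose_def
      by (intro continuous_intros)
    have eq: "SO3 = {g. transpose g ** g = Finite_Cartesian_Product.mat 1} \<inter> {g. Determinants.det g = 1}"
      by (auto simp: SO3_iff)
    show ?thesis
      unfolding eq by (intro closed_Int closed_Collect_eq 1 2 continuous_intros)
  qed
  ultimately show ?thesis
    by (simp add: compact_eq_bounded_closed)
qed

lemma rotation_about_axis_3: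
  assumes h: "h \<in> SO3" and fix3: "h *v axis 3 1 = axis 3 1"
  obtains t where "h = rot 3 t"
proof -
  have c: "h $ 1 $ 3 = 0" "h $ 2 $ 3 = 0" "h $ 3 $ 3 = 1"
    using fix3 by (auto simp: vec_eq_iff forall_3 matrix_vector_mult_def sum_3 axis_def)
  have o1: "transpose h ** h = Finite_Cartesian_Product.mat 1" and d: "Determinants.det h = 1"
    using h by (auto simp: SO3_iff)
  have o2: "h ** transpose h = Finite_Cartesian_Product.mat 1"
    using o1 matrix_left_right_inverse by blast
  have "(h ** transpose h) $ 3 $ 3 = 1"
    by (simp add: o2 Finite_Cartesian_Product.mat_def)
  then have "(h $ 3 $ 1)\<^sup>2 + (h $ 3 $ 2)\<^sup>2 = 0"
    by (simp add: matrix_matrix_mult_def Finite_Cartesian_Product.transpose_def sum_3 c power2_eq_square)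
  then have r: "h $ 3 $ 1 = 0" "h $ 3 $ 2 = 0"
    by (auto simp: sum_power2_eq_zero_iff)
  have "(transpose h ** h) $ 1 $ 1 = 1" "(transpose h ** h) $ 2 $ 2 = 1" "(transpose h ** h) $ 1 $ 2 = 0"
    by (simp_all add: o1 Finite_Cartesian_Product.mat_def)
  then have e: "(h $ 1 $ 1)\<^sup>2 + (h $ 2 $ 1)\<^sup>2 = 1" "(h $ 1 $ 2)\<^sup>2 + (h $ 2 $ 2)\<^sup>2 = 1"
      "h $ 1 $ 1 * h $ 1 $ 2 + h $ 2 $ 1 * h $ 2 $ 2 = 0"
    by (simp_all add: matrix_matrix_mult_def Finite_Cartesian_Product.transpose_def sum_3 r power2_eq_square)
  have dd: "h $ 1 $ 1 * h $ 2 $ 2 - h $ 1 $ 2 * h $ 2 $ 1 = 1"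
    using d by (simp add: det_3 c r)
  \<comment> \<open>Expanded, this is the sum of the squared lengths of the two columns minus twice
    the determinant of the block, that is 1 + 1 - 2.\<close>
  have "(h $ 1 $ 1 - h $ 2 $ 2)\<^sup>2 + (h $ 1 $ 2 + h $ 2 $ 1)\<^sup>2 = 0"
    using e dd by (simp add: power2_eq_square algebra_simps)
  then have eq: "h $ 2 $ 2 = h $ 1 $ 1" "h $ 1 $ 2 = - h $ 2 $ 1"
    by (auto simp: sum_power2_eq_zero_iff)
  obtain t where "h $ 1 $ 1 = cos t" "h $ 2 $ 1 = sin t"
    using sincos_total_2pi[OF e(1)] by metis
  then have "h = rot 3 t"
    by (simp add: rot_explicit vec_eq_iff forall_3 c r eq)
  then show ?thesis by (rule that)
qed

text \<open>Spherical coordinates of the image of e3 give r and s; undoing these two rotations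
  leaves one that fixes e3.\<close>

lemma euler_angles:
  assumes g: "g \<in> SO3"
  obtains r s t where "g = rot 3 r ** (rot 2 s ** rot 3 t)"
proof -
  have "(transpose g ** g) $ 3 $ 3 = 1"
    using g by (simp add: SO3_iff Finite_Cartesian_Product.mat_def)
  then have n: "(g $ 1 $ 3)\<^sup>2 + (g $ 2 $ 3)\<^sup>2 + (g $ 3 $ 3)\<^sup>2 = 1"
    by (simp add: matrix_matrix_mult_def Finite_Cartesian_Product.transpose_def sum_3 power2_eq_square)
  define \<rho> where "\<rho> = sqrt ((g $ 1 $ 3)\<^sup>2 + (g $ 2 $ 3)\<^sup>2)"
  have \<rho>2: "\<rho>\<^sup>2 = (g $ 1 $ 3)\<^sup>2 + (g $ 2 $ 3)\<^sup>2"
    by (simp add: \<rho>_def)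
  have "(g $ 3 $ 3)\<^sup>2 + \<rho>\<^sup>2 = 1"
    using n by (simp add: \<rho>2)
  then obtain s where s: "g $ 3 $ 3 = cos s" "\<rho> = sin s"
    using sincos_total_2pi by metis
  \<comment> \<open>If the image of e3 is a pole, \<rho> = 0 and any angle r will do.\<close>
  obtain r where r: "g $ 1 $ 3 = \<rho> * cos r" "g $ 2 $ 3 = \<rho> * sin r"
  proof (cases "\<rho> = 0")
    case True
    then have "g $ 1 $ 3 = 0" "g $ 2 $ 3 = 0"
      using \<rho>2 by (auto simp: sum_power2_eq_zero_iff)
    then show ?thesis using that[of 0] True by simp
  next
    case False
    then have "(g $ 1 $ 3 / \<rho>)\<^sup>2 + (g $ 2 $ 3 / \<rho>)\<^sup>2 = 1"
      using \<rho>2 False by (auto simp: power_divide simp flip: add_divide_distrib)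
    then obtain r where "g $ 1 $ 3 / \<rho> = cos r" "g $ 2 $ 3 / \<rho> = sin r"
      using sincos_total_2pi by metis
    then show ?thesis using that[of r] False by (simp add: field_simps)
  qed
  define h where "h = rot 2 (- s) ** (rot 3 (- r) ** g)"
  have "h \<in> SO3"
    unfolding h_def by (intro SO3_mult rot_in_SO3 g)
  moreover have "h *v axis 3 1 = axis 3 1"
  proof -
    have g3: "g *v axis 3 1 = vector [sin s * cos r, sin s * sin r, cos s]"
      by (simp add: vec_eq_iff forall_3 matrix_vector_mult_def sum_3 axis_def r s)
    have sr: "cos r * (sin s * cos r) + sin r * (sin s * sin r) = sin s"
    proof -
      have "cos r * (sin s * cos r) + sin r * (sin s * sin r) = sin s * ((sin r)\<^sup>2 + (cos r)\<^sup>2)"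
        by (simp only: power2_eq_square distrib_left mult_ac add_ac)
      then show ?thesis by simp
    qed
    have "rot 3 (- r) *v (g *v axis 3 1) = vector [sin s, 0, cos s]"
      unfolding g3 rot_explicit using sr
      by (simp add: vec_eq_iff forall_3 matrix_vector_mult_def sum_3)
    then have "rot 2 (- s) *v (rot 3 (- r) *v (g *v axis 3 1)) = axis 3 1"
      by (simp add: rot_explicit vec_eq_iff forall_3 matrix_vector_mult_def sum_3 axis_def mult.commute flip: power2_eq_square)
    then show ?thesis
      by (simp add: h_def matrix_vector_mul_assoc matrix_mul_assoc)
  qed
  ultimately obtain t where t: "h = rot 3 t"
    by (rule rotation_about_axis_3)
  have "rot 3 r ** (rot 2 s ** h) = (rot 3 r ** (rot 2 s ** rot 2 (- s)) ** rot 3 (- r)) ** g"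
    by (simp add: h_def matrix_mul_assoc)
  also have "\<dots> = g"
    by (simp flip: rot_add)
  finally show ?thesis
    using that t by metis
qed

section \<open>The action on binary forms\<close>

definition cmat :: "real^3^3 \<Rightarrow> complex^3^3" where
  "cmat g = (\<chi> i j. complex_of_real (g $ i $ j))"

lemma cmat_mult: "cmat (g ** h) = cmat g ** cmat h"
  by (simp add: cmat_def matrix_matrix_mult_def vec_eq_iff)

lemma cmat_one: "cmat (Finite_Cartesian_Product.mat 1) = Finite_Cartesian_Product.mat 1"
  by (simp add: cmat_def Finite_Cartesian_Product.mat_def vec_eq_iff)

(* The equivariant isomorphism from C^3 onto the binary quadratic forms. *)
definition quadr :: "complex^3 \<Rightarrow> bipoly" where
  "quadr x = (\<lambda>z0 z1. - \<i> * x $ 1 * (z0\<^sup>2 + z1\<^sup>2) + x $ 2 * (z1\<^sup>2 - z0\<^sup>2) + 2 * x $ 3 * (z0 * z1))"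

text \<open>The row vector (z0, z1) is multiplied by U from the right; this makes substitution a
  left action.\<close>

definition sub :: "complex^2^2 \<Rightarrow> bipoly \<Rightarrow> bipoly" where
  "sub U p = (\<lambda>z0 z1. p (z0 * U $ 1 $ 1 + z1 * U $ 2 $ 1) (z0 * U $ 1 $ 2 + z1 * U $ 2 $ 2))"

lemma sub_sub: "sub U (sub V p) = sub (U ** V) p"
  by (simp add: sub_def matrix_matrix_mult_def sum_2 algebra_simps)

lemma sub_one [simp]: "sub (Finite_Cartesian_Product.mat 1) p = p"
  by (simp add: sub_def Finite_Cartesian_Product.mat_def)

text \<open>The quadratic forms carry the adjoint representation of SL(2), so this relation is the
  double cover, stated without a choice between U and -U. The determinant condition is the source of
  the relation in \<open>umon_straighten\<close>.\<close>

definition lift :: "real^3^3 \<Rightarrow> complex^2^2 \<Rightarrow> bool" where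
  "lift g U \<longleftrightarrow> Determinants.det U = 1 \<and> (\<forall>x. sub U (quadr x) = quadr (cmat g *v x))"

lemma lift_mult: "lift g U \<Longrightarrow> lift h V \<Longrightarrow> lift (g ** h) (U ** V)"
  by (simp add: lift_def Determinants.det_mul cmat_mult flip: sub_sub matrix_vector_mul_assoc)

lemma lift_one: "lift (Finite_Cartesian_Product.mat 1) (Finite_Cartesian_Product.mat 1)"
  by (simp add: lift_def cmat_one)

text \<open>One-parameter subgroups of SU(2) at half the angle. The signs are forced by the
  prescribed action on forms: the derivative at 0 has to be \<open>dE j\<close>.\<close>

definition su_rot :: "3 \<Rightarrow> real \<Rightarrow> complex^2^2" where
  "su_rot j t = (let c = complex_of_real (cos (t / 2)); s = complex_of_real (sin (t / 2)) in
     if j = 1 then vector [vector [c, s], vector [- s, c]]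
     else if j = 2 then vector [vector [c, - \<i> * s], vector [- \<i> * s, c]]
     else vector [vector [c - \<i> * s, 0], vector [0, c + \<i> * s]])"

lemma lift_rot: "lift (rot j t) (su_rot j t)"
proof -
  define c s where "c = complex_of_real (cos (t / 2))" and "s = complex_of_real (sin (t / 2))"
  have cs: "c\<^sup>2 = 1 - s\<^sup>2"
    unfolding c_def s_def by (metis cos_squared_eq of_real_1 of_real_diff of_real_power)
  have ii: "\<i> * (\<i> * z) = - z" for z by (simp flip: mult.assoc)
  have t: "complex_of_real (cos t) = 1 - 2 * s\<^sup>2" "complex_of_real (sin t) = 2 * s * c"
  proof -
    have "cos t = 1 - 2 * (sin (t / 2))\<^sup>2" "sin t = 2 * sin (t / 2) * cos (t / 2)"
      using cos_double_sin[of "t / 2"] sin_double[of "t / 2"] by simp_all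
    then show "complex_of_real (cos t) = 1 - 2 * s\<^sup>2" "complex_of_real (sin t) = 2 * s * c"
      unfolding s_def c_def by simp_all
  qed
  have cs': "c\<^sup>2 + s\<^sup>2 = 1" "c\<^sup>2 - s\<^sup>2 = 1 - 2 * s\<^sup>2"
    by (simp_all add: cs)
  have alg1: "(z0 * c + z1 * - s)\<^sup>2 + (z0 * s + z1 * c)\<^sup>2 = (c\<^sup>2 + s\<^sup>2) * (z0\<^sup>2 + z1\<^sup>2)"
      "(z0 * s + z1 * c)\<^sup>2 - (z0 * c + z1 * - s)\<^sup>2 = (c\<^sup>2 - s\<^sup>2) * (z1\<^sup>2 - z0\<^sup>2) + 4 * s * c * (z0 * z1)"
      "(z0 * c + z1 * - s) * (z0 * s + z1 * c) = (c\<^sup>2 - s\<^sup>2) * (z0 * z1) + s * c * (z0\<^sup>2 - z1\<^sup>2)"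
    for z0 z1 :: complex
    by (simp_all add: power2_eq_square algebra_simps)
  \<comment> \<open>Here and in \<open>alg3\<close> the letter i is an arbitrary complex number; i *
    i = -1 is used only when the identities are applied.\<close>
  have alg2: "(z0 * c + z1 * (- i * s))\<^sup>2 + (z0 * (- i * s) + z1 * c)\<^sup>2 = (c\<^sup>2 + i * i * s\<^sup>2) * (z0\<^sup>2 + z1\<^sup>2) - 4 * i * s * c * (z0 * z1)"
      "(z0 * (- i * s) + z1 * c)\<^sup>2 - (z0 * c + z1 * (- i * s))\<^sup>2 = (c\<^sup>2 - i * i * s\<^sup>2) * (z1\<^sup>2 - z0\<^sup>2)"
      "(z0 * c + z1 * (- i * s)) * (z0 * (- i * s) + z1 * c) = (c\<^sup>2 + i * i * s\<^sup>2) * (z0 * z1) - i * s * c * (z0\<^sup>2 + z1\<^sup>2)"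
    for z0 z1 i :: complex
    by (simp_all add: power2_eq_square algebra_simps)
  have alg3: "(z0 * (c - i * s) + z1 * 0)\<^sup>2 + (z0 * 0 + z1 * (c + i * s))\<^sup>2 = (c\<^sup>2 + i * i * s\<^sup>2) * (z0\<^sup>2 + z1\<^sup>2) + 2 * i * s * c * (z1\<^sup>2 - z0\<^sup>2)"
      "(z0 * 0 + z1 * (c + i * s))\<^sup>2 - (z0 * (c - i * s) + z1 * 0)\<^sup>2 = (c\<^sup>2 + i * i * s\<^sup>2) * (z1\<^sup>2 - z0\<^sup>2) + 2 * i * s * c * (z1\<^sup>2 + z0\<^sup>2)"
      "(z0 * (c - i * s) + z1 * 0) * (z0 * 0 + z1 * (c + i * s)) = (c\<^sup>2 - i * i * s\<^sup>2) * (z0 * z1)"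
    for z0 z1 i :: complex
    by (simp_all add: power2_eq_square algebra_simps)
  have "lift (rot 1 t) (su_rot 1 t)"
    unfolding lift_def
  proof (intro conjI allI ext)
    have u: "su_rot 1 t $ 1 $ 1 = c" "su_rot 1 t $ 1 $ 2 = s"
      "su_rot 1 t $ 2 $ 1 = - s" "su_rot 1 t $ 2 $ 2 = c"
      by (simp_all add: su_rot_def Let_def c_def s_def)
    show "Determinants.det (su_rot 1 t) = 1"
      using cs'(1) unfolding det_2 u by (simp add: power2_eq_square algebra_simps ii)
    fix x z0 z1
    have v: "(cmat (rot 1 t) *v x) $ 1 = x $ 1"
      "(cmat (rot 1 t) *v x) $ 2 = (1 - 2 * s\<^sup>2) * x $ 2 - 2 * s * c * x $ 3"
      "(cmat (rot 1 t) *v x) $ 3 = 2 * s * c * x $ 2 + (1 - 2 * s\<^sup>2) * x $ 3"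
      by (simp_all add: rot_explicit cmat_def matrix_vector_mult_def sum_3 t)
    show "sub (su_rot 1 t) (quadr x) z0 z1 = quadr (cmat (rot 1 t) *v x) z0 z1"
      unfolding sub_def quadr_def u v alg1  by (simp add: cs'  flip: diff_conv_add_uminus) (simp add: algebra_simps ii)
  qed
  moreover have "lift (rot 2 t) (su_rot 2 t)"
    unfolding lift_def
  proof (intro conjI allI ext)
    have u: "su_rot 2 t $ 1 $ 1 = c" "su_rot 2 t $ 1 $ 2 = - \<i> * s"
      "su_rot 2 t $ 2 $ 1 = - \<i> * s" "su_rot 2 t $ 2 $ 2 = c"
      by (simp_all add: su_rot_def Let_def c_def s_def)
    show "Determinants.det (su_rot 2 t) = 1"
      using cs'(1) unfolding det_2 u by (simp add: power2_eq_square algebra_simps ii)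
    fix x z0 z1
    have v: "(cmat (rot 2 t) *v x) $ 1 = (1 - 2 * s\<^sup>2) * x $ 1 + 2 * s * c * x $ 3"
      "(cmat (rot 2 t) *v x) $ 2 = x $ 2"
      "(cmat (rot 2 t) *v x) $ 3 = (1 - 2 * s\<^sup>2) * x $ 3 - 2 * s * c * x $ 1"
      by (simp_all add: rot_explicit cmat_def matrix_vector_mult_def sum_3 t)
    show "sub (su_rot 2 t) (quadr x) z0 z1 = quadr (cmat (rot 2 t) *v x) z0 z1"
      unfolding sub_def quadr_def u v alg2 i_squared by (simp add: cs'  flip: diff_conv_add_uminus) (simp add: algebra_simps ii)
  qed
  moreover have "lift (rot 3 t) (su_rot 3 t)"
    unfolding lift_def
  proof (intro conjI allI ext)
    have u: "su_rot 3 t $ 1 $ 1 = c - \<i> * s" "su_rot 3 t $ 1 $ 2 = 0"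
      "su_rot 3 t $ 2 $ 1 = 0" "su_rot 3 t $ 2 $ 2 = c + \<i> * s"
      by (simp_all add: su_rot_def Let_def c_def s_def)
    show "Determinants.det (su_rot 3 t) = 1"
      using cs'(1) unfolding det_2 u by (simp add: power2_eq_square algebra_simps ii)
    fix x z0 z1
    have v: "(cmat (rot 3 t) *v x) $ 1 = (1 - 2 * s\<^sup>2) * x $ 1 - 2 * s * c * x $ 2"
      "(cmat (rot 3 t) *v x) $ 2 = 2 * s * c * x $ 1 + (1 - 2 * s\<^sup>2) * x $ 2"
      "(cmat (rot 3 t) *v x) $ 3 = x $ 3"
      by (simp_all add: rot_explicit cmat_def matrix_vector_mult_def sum_3 t)
    show "sub (su_rot 3 t) (quadr x) z0 z1 = quadr (cmat (rot 3 t) *v x) z0 z1"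
      unfolding sub_def quadr_def u v alg3 i_squared by (simp add: cs'  flip: diff_conv_add_uminus) (simp add: algebra_simps ii)
  qed
  ultimately show ?thesis
    using exhaust_3[of j] by blast
qed

lemma ex_lift:
  assumes "g \<in> SO3"
  shows "\<exists>U. lift g U"
proof -
  obtain r s t where "g = rot 3 r ** (rot 2 s ** rot 3 t)"
    using euler_angles[OF assms] .
  then show ?thesis
    by (metis lift_rot lift_mult)
qed

definition act :: "real^3^3 \<Rightarrow> bipoly \<Rightarrow> bipoly" where
  "act g = sub (SOME U. lift g U)"

definition mono2 :: "nat \<Rightarrow> nat \<Rightarrow> bipoly" where
  "mono2 n k = (\<lambda>z0 z1. z0 ^ (n - k) * z1 ^ k)"

definition bform :: "nat \<Rightarrow> (nat \<Rightarrow> complex) \<Rightarrow> bipoly" where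
  "bform n a = (\<lambda>z0 z1. \<Sum>k\<le>n. a k * mono2 n k z0 z1)"

lemma Sym_eq: "Sym n = range (bform n)"
  by (auto simp: Sym_def bform_def mono2_def mult.assoc)

lemma sub_bform: "sub U (bform n a) = (\<lambda>z0 z1. \<Sum>k\<le>n. a k * sub U (mono2 n k) z0 z1)"
  by (simp add: sub_def bform_def)

(* Every monomial of even degree is a product of quadratic forms, and on these the action of a
   lift of g is expressed by g itself. *)
definition rot_mono :: "nat \<Rightarrow> nat \<Rightarrow> real^3^3 \<Rightarrow> bipoly" where
  "rot_mono l k g = (\<lambda>z0 z1.
     quadr (cmat g *v vector [\<i> / 2, -1 / 2, 0]) z0 z1 ^ (l - (k + 1) div 2) *
     quadr (cmat g *v vector [0, 0, 1 / 2]) z0 z1 ^ (k mod 2) *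
     quadr (cmat g *v vector [\<i> / 2, 1 / 2, 0]) z0 z1 ^ (k div 2))"

lemma sub_mono2:
  assumes "lift g U" "k \<le> 2 * l"
  shows "sub U (mono2 (2 * l) k) = rot_mono l k g"
proof -
  have pw: "z0 ^ (2 * p + r) * z1 ^ (2 * q + r) = (z0\<^sup>2) ^ p * (z0 * z1) ^ r * (z1\<^sup>2) ^ q"
    for z0 z1 :: complex and p q r
    unfolding power_add power_mult power_mult_distrib by (simp only: mult_ac)
  \<comment> \<open>The exponents are split by the parity of k: an odd k uses one factor z0 z1, and
    the remaining factors pair up to z0^2 and z1^2.\<close>
  have "2 * l - k = 2 * (l - (k + 1) div 2) + k mod 2" "k = 2 * (k div 2) + k mod 2"
    using assms(2) by presburger+
  then have m: "mono2 (2 * l) k z0 z1 = (z0\<^sup>2) ^ (l - (k + 1) div 2) * (z0 * z1) ^ (k mod 2) * (z1\<^sup>2) ^ (k div 2)"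
    for z0 z1
    unfolding mono2_def by (metis pw)
  \<comment> \<open>The three vectors in \<open>rot_mono\<close> are the preimages of z0^2, z0 z1
    and z1^2 under \<open>quadr\<close>.\<close>
  have q: "quadr (vector [\<i> / 2, -1 / 2, 0]) z0 z1 = z0\<^sup>2" "quadr (vector [0, 0, 1 / 2]) z0 z1 = z0 * z1"
     "quadr (vector [\<i> / 2, 1 / 2, 0]) z0 z1 = z1\<^sup>2" for z0 z1
    by (simp_all add: quadr_def field_simps)
  have s: "quadr (cmat g *v x) z0 z1 = quadr x (z0 * U $ 1 $ 1 + z1 * U $ 2 $ 1) (z0 * U $ 1 $ 2 + z1 * U $ 2 $ 2)" for x z0 z1
    using assms(1) by (metis lift_def sub_def)
  show ?thesis
    unfolding rot_mono_def s q by (simp add: sub_def m)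
qed

text \<open>Two lifts of g agree on each monomial, since both give \<open>rot_mono\<close>, which
  mentions g only. In odd degree the sign of the lift would be visible.\<close>

lemma act_eq_sub:
  assumes "lift g U" "p \<in> Sym (2 * l)"
  shows "act g p = sub U p"
proof -
  have *: "lift g (SOME U. lift g U)"
    using assms(1) by (rule someI)
  obtain a where "p = bform (2 * l) a"
    using assms(2) by (auto simp: Sym_eq)
  then show ?thesis
    unfolding act_def
    by (simp only: sub_bform) (auto simp: sub_mono2[OF assms(1)] sub_mono2[OF *] fun_eq_iff intro!: sum.cong)
qed

lemma act_bform:
  assumes "g \<in> SO3"
  shows "act g (bform (2 * l) a) z0 z1 = (\<Sum>k\<le>2*l. a k * rot_mono l k g z0 z1)"
proof -
  obtain U where U: "lift g U" using ex_lift[OF assms] by blast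
  show ?thesis
    unfolding act_eq_sub[OF U, of _ l, unfolded Sym_eq, OF rangeI] sub_bform
    by (auto simp: sub_mono2[OF U] intro!: sum.cong)
qed

lemma mono2_in_Sym: "k \<le> n \<Longrightarrow> mono2 n k \<in> Sym n"
  unfolding Sym_eq bform_def
  by (intro image_eqI[where x = "\<lambda>i. if i = k then 1 else 0"])
     (auto simp: if_distrib[of "\<lambda>c. c * _"] fun_eq_iff cong: if_cong)

lemma bform_add: "bform n a z0 z1 + bform n b z0 z1 = bform n (\<lambda>k. a k + b k) z0 z1"
  by (simp add: bform_def sum.distrib distrib_right)

lemma bform_cmul: "c * bform n a z0 z1 = bform n (\<lambda>k. c * a k) z0 z1"
  by (simp add: bform_def sum_distrib_left mult.assoc)

lemma Sym_add: "p \<in> Sym n \<Longrightarrow> q \<in> Sym n \<Longrightarrow> (\<lambda>z0 z1. p z0 z1 + q z0 z1) \<in> Sym n"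
  by (auto simp: Sym_eq bform_add)

lemma Sym_cmul: "p \<in> Sym n \<Longrightarrow> (\<lambda>z0 z1. c * p z0 z1) \<in> Sym n"
  by (auto simp: Sym_eq bform_cmul)

lemma Sym_zero: "(\<lambda>z0 z1. 0) \<in> Sym n"
  unfolding Sym_eq by (rule image_eqI[where x = "\<lambda>_. 0"]) (auto simp: bform_def)

lemma Sym_sum: "(\<And>i. i \<in> I \<Longrightarrow> p i \<in> Sym n) \<Longrightarrow> (\<lambda>z0 z1. \<Sum>i\<in>I. p i z0 z1) \<in> Sym n"
  by (induction I rule: infinite_finite_induct) (auto intro: Sym_zero Sym_add)

lemma Sym_mult:
  assumes "p \<in> Sym m" "q \<in> Sym n"
  shows "(\<lambda>z0 z1. p z0 z1 * q z0 z1) \<in> Sym (m + n)"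
proof -
  have mm: "mono2 m i z0 z1 * mono2 n j z0 z1 = mono2 (m + n) (i + j) z0 z1" if "i \<le> m" "j \<le> n" for i j z0 z1
  proof -
    have "m + n - (i + j) = (m - i) + (n - j)"
      using that by simp
    then show ?thesis
      unfolding mono2_def by (simp only: power_add) (simp add: mult_ac)
  qed
  obtain a b where "p = bform m a" "q = bform n b"
    using assms by (auto simp: Sym_eq)
  then have "(\<lambda>z0 z1. p z0 z1 * q z0 z1) =
      (\<lambda>z0 z1. \<Sum>i\<le>m. \<Sum>j\<le>n. (a i * b j) * mono2 (m + n) (i + j) z0 z1)"
    by (auto simp: bform_def sum_product fun_eq_iff mm[symmetric] mult_ac intro!: sum.cong)
  then show ?thesis
    by (auto intro!: Sym_sum Sym_cmul mono2_in_Sym)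
qed

lemma Sym_linear: "(\<lambda>z0 z1. z0 * a + z1 * b) \<in> Sym 1"
  unfolding Sym_eq by (rule image_eqI[where x = "\<lambda>k. if k = 0 then a else b"])
    (auto simp: bform_def mono2_def fun_eq_iff)

lemma Sym_const: "(\<lambda>z0 z1. c) \<in> Sym 0"
  by (auto simp: Sym_eq bform_def mono2_def)

lemma Sym_power: "p \<in> Sym m \<Longrightarrow> (\<lambda>z0 z1. p z0 z1 ^ k) \<in> Sym (m * k)"
  by (induction k) (use Sym_const[of 1] in \<open>auto intro: Sym_mult\<close>)

lemma sub_in_Sym:
  assumes "p \<in> Sym n"
  shows "sub U p \<in> Sym n"
proof -
  have "sub U (mono2 n k) \<in> Sym n" if "k \<le> n" for k
    using Sym_mult[OF Sym_power[OF Sym_linear] Sym_power[OF Sym_linear],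
        of "U $ 1 $ 1" "U $ 2 $ 1" "n - k" "U $ 1 $ 2" "U $ 2 $ 2" k] that
    by (simp add: sub_def mono2_def)
  moreover obtain a where "p = bform n a"
    using assms by (auto simp: Sym_eq)
  ultimately show ?thesis
    by (simp only: sub_bform) (intro Sym_sum Sym_cmul, simp)
qed

lemma act_in_Sym: "p \<in> Sym n \<Longrightarrow> act g p \<in> Sym n"
  by (simp add: act_def sub_in_Sym)

lemma act_mult:
  assumes "g \<in> SO3" "h \<in> SO3" "p \<in> Sym (2 * l)"
  shows "act (g ** h) p = act g (act h p)"
proof -
  obtain U V where UV: "lift g U" "lift h V"
    using ex_lift assms by meson
  show ?thesis
    by (simp add: act_eq_sub[OF lift_mult[OF UV] assms(3)] act_eq_sub[OF UV(2) assms(3)]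
        act_eq_sub[OF UV(1) sub_in_Sym[OF assms(3)]] sub_sub)
qed

lemma act_one: "p \<in> Sym (2 * l) \<Longrightarrow> act (Finite_Cartesian_Product.mat 1) p = p"
  using act_eq_sub[OF lift_one] by simp

lemma act_add: "act g (\<lambda>z0 z1. p z0 z1 + q z0 z1) z0 z1 = act g p z0 z1 + act g q z0 z1"
  by (simp add: act_def sub_def)

lemma act_cmul: "act g (\<lambda>z0 z1. c * p z0 z1) z0 z1 = c * act g p z0 z1"
  by (simp add: act_def sub_def)

lemma act_sum: "act g (\<lambda>z0 z1. \<Sum>i\<in>I. p i z0 z1) z0 z1 = (\<Sum>i\<in>I. act g (p i) z0 z1)"
  by (simp add: act_def sub_def)

section \<open>Derivatives along one-parameter subgroups\<close>

lemma fun_span_zero: "(\<lambda>x. 0) \<in> fun_span A"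
  unfolding fun_span_def by (rule CollectI, rule exI[of _ 0]) auto

lemma fun_span_add_base:
  assumes "F \<in> fun_span A" "a \<in> A"
  shows "(\<lambda>x. F x + c * a x) \<in> fun_span A"
proof -
  obtain n :: nat and k f where f: "\<forall>i<n. f i \<in> A" "F = (\<lambda>x. \<Sum>i<n. k i * f i x)"
    using assms(1) by (auto simp: fun_span_def)
  show ?thesis
    unfolding fun_span_def
    by (rule CollectI, rule exI[of _ "Suc n"], rule exI[of _ "k(n := c)"], rule exI[of _ "f(n := a)"])
       (use f assms(2) in \<open>auto simp: less_Suc_eq fun_eq_iff\<close>)
qed

lemma fun_span_induct [consumes 1, case_names zero step]:
  assumes "F \<in> fun_span A" "P (\<lambda>x. 0)"
    and step: "\<And>F a c. F \<in> fun_span A \<Longrightarrow> P F \<Longrightarrow> a \<in> A \<Longrightarrow> P (\<lambda>x. F x + c * a x)"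
  shows "P F"
proof -
  obtain n :: nat and k f where f: "\<forall>i<n. f i \<in> A" "F = (\<lambda>x. \<Sum>i<n. k i * f i x)"
    using assms(1) by (auto simp: fun_span_def)
  have "(\<lambda>x. \<Sum>i<m. k i * f i x) \<in> fun_span A \<and> P (\<lambda>x. \<Sum>i<m. k i * f i x)" if "m \<le> n" for m
    using that by (induction m) (use f assms(2) fun_span_zero fun_span_add_base step in \<open>force+\<close>)
  then show ?thesis using f(2) by blast
qed

lemma fun_span_base: "a \<in> A \<Longrightarrow> a \<in> fun_span A"
  using fun_span_add_base[OF fun_span_zero, of a A 1] by simp

lemma fun_span_add: "G \<in> fun_span A \<Longrightarrow> F \<in> fun_span A \<Longrightarrow> (\<lambda>x. F x + G x) \<in> fun_span A"
  by (induction rule: fun_span_induct) (auto simp: add.assoc[symmetric] intro: fun_span_add_base)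

lemma fun_span_cmul: "F \<in> fun_span A \<Longrightarrow> (\<lambda>x. c * F x) \<in> fun_span A"
  by (induction rule: fun_span_induct)
     (auto simp: distrib_left mult.assoc[symmetric] intro: fun_span_zero fun_span_add_base)

lemma fun_span_sum:
  "(\<And>i. i \<in> I \<Longrightarrow> F i \<in> fun_span A) \<Longrightarrow> (\<lambda>x. \<Sum>i\<in>I. F i x) \<in> fun_span A"
  by (induction I rule: infinite_finite_induct) (auto intro: fun_span_zero fun_span_add)

lemma fun_span_mono: "A \<subseteq> B \<Longrightarrow> fun_span A \<subseteq> fun_span B"
  unfolding fun_span_def by blast

lemma fun_span_subset: 
  assumes "A \<subseteq> fun_span B" shows "fun_span A \<subseteq> fun_span B"
proof
  show "F \<in> fun_span B" if "F \<in> fun_span A" for F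
    using that
  proof (induction rule: fun_span_induct)
    case zero
    show ?case by (rule fun_span_zero)
  next
    case (step F a c)
    then show ?case
      using assms by (intro fun_span_add[OF fun_span_cmul]) auto
  qed
qed

section \<open>Polynomial functions and smoothness\<close>

text \<open>The complex product is reduced to scaling by real polynomials: f g = Re f g + Im f (i
  g).\<close>

lemma polynomial_function_cmult [intro]:
  fixes f g :: "'a::real_normed_vector \<Rightarrow> complex"
  assumes "polynomial_function f" "polynomial_function g"
  shows "polynomial_function (\<lambda>x. f x * g x)"
proof -
  have "polynomial_function (\<lambda>x. Re (f x))" "polynomial_function (\<lambda>x. Im (f x))"
    using assms(1) unfolding real_polynomial_function_eq[symmetric] polynomial_function_def o_def
    by (auto simp: bounded_linear_Re bounded_linear_Im)
  then have "polynomial_function (\<lambda>x. Re (f x) *\<^sub>R g x + Im (f x) *\<^sub>R (\<i> * g x))"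
    using polynomial_function_compose[OF assms(2) polynomial_function_bounded_linear[OF bounded_linear_mult_right, of \<i>]]
    by (auto intro!: polynomial_function_add polynomial_function_mult assms simp: o_def)
  moreover have "f x * g x = Re (f x) *\<^sub>R g x + Im (f x) *\<^sub>R (\<i> * g x)" for x
    by (simp add: complex_eq_iff)
  ultimately show ?thesis by simp
qed

lemma polynomial_function_cpower [intro]:
  fixes f :: "'a::real_normed_vector \<Rightarrow> complex"
  shows "polynomial_function f \<Longrightarrow> polynomial_function (\<lambda>x. f x ^ n)"
  by (induction n) auto

lemma polynomial_function_scale_left [intro]:
  fixes f :: "'a::real_normed_vector \<Rightarrow> complex"
  shows "polynomial_function f \<Longrightarrow> polynomial_function (\<lambda>x. c * f x)"
  by (rule polynomial_function_cmult[OF polynomial_function_const])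

lemma polynomial_function_cmat_entry:
  "polynomial_function (\<lambda>g. (cmat g *v x) $ i)"
proof -
  have "linear (\<lambda>g. (cmat g *v x) $ i)"
    by (rule linearI) (simp_all add: cmat_def matrix_vector_mult_def sum.distrib algebra_simps sum_distrib_left scaleR_conv_of_real[where 'a = complex])
  then show ?thesis
    by (simp add: polynomial_function_bounded_linear linear_conv_bounded_linear)
qed

lemma polynomial_function_quadr:
  assumes "\<And>i. polynomial_function (\<lambda>w. F w $ i)"
  shows "polynomial_function (\<lambda>w. quadr (F w) z0 z1)"
  unfolding quadr_def
  by (intro polynomial_function_add polynomial_function_cmult polynomial_function_const assms)

lemma polynomial_function_rot_mono: "polynomial_function (\<lambda>g. rot_mono l k g z0 z1)"
  unfolding rot_mono_def
  by (intro polynomial_function_cmult polynomial_function_cpower polynomial_function_quadr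
      polynomial_function_cmat_entry)

lemma act_polynomial:
  assumes "p \<in> Sym (2 * l)"
  obtains P where "polynomial_function P" "\<And>g. g \<in> SO3 \<Longrightarrow> act g p z0 z1 = P g"
proof -
  obtain a where a: "p = bform (2 * l) a"
    using assms by (auto simp: Sym_eq)
  have "polynomial_function (\<lambda>g. \<Sum>k\<le>2*l. a k * rot_mono l k g z0 z1)"
    by (intro polynomial_function_sum polynomial_function_scale_left polynomial_function_rot_mono) simp
  then show ?thesis
    using that a by (metis (no_types, lifting) act_bform)
qed

lemma act_continuous: "p \<in> Sym (2 * l) \<Longrightarrow> continuous_on SO3 (\<lambda>g. act g p z0 z1)"
  by (metis (no_types, lifting) act_polynomial continuous_on_cong continuous_on_polymonial_function)

text \<open>The derivative is produced as a family \<open>D v\<close> that is polynomial in the base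
  point for each fixed direction v, the form in which \<open>Ck_on\<close> iterates
  derivatives.\<close>

lemma has_derivative_real_polynomial_function:
  assumes "real_polynomial_function f"
  shows "\<exists>D. (\<forall>v. real_polynomial_function (D v)) \<and> (\<forall>x. (f has_derivative (\<lambda>v. D v x)) (at x))"
  using assms
proof induction
  case (linear f)
  then show ?case
    by (intro exI[of _ "\<lambda>v x. f v"]) (auto intro: bounded_linear_imp_has_derivative)
next
  case (const c)
  then show ?case by (intro exI[of _ "\<lambda>v x. 0"]) auto
next
  case (add f g)
  then obtain D E where "\<forall>v. real_polynomial_function (D v)" "\<forall>x. (f has_derivative (\<lambda>v. D v x)) (at x)"
    "\<forall>v. real_polynomial_function (E v)" "\<forall>x. (g has_derivative (\<lambda>v. E v x)) (at x)"
    by blast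
  then show ?case
    by (intro exI[of _ "\<lambda>v x. D v x + E v x"]) (auto intro!: has_derivative_add)
next
  case (mult f g)
  then obtain D E where DE: "\<forall>v. real_polynomial_function (D v)" "\<forall>x. (f has_derivative (\<lambda>v. D v x)) (at x)"
    "\<forall>v. real_polynomial_function (E v)" "\<forall>x. (g has_derivative (\<lambda>v. E v x)) (at x)"
    by blast
  have "real_polynomial_function (\<lambda>x. f x * E v x + D v x * g x)" for v
    using DE(1,3) mult.hyps by (intro real_polynomial_function.intros(3,4)) auto
  moreover have "((\<lambda>x. f x * g x) has_derivative (\<lambda>v. f x * E v x + D v x * g x)) (at x)" for x
    by (rule has_derivative_mult[OF DE(2)[rule_format] DE(4)[rule_format]])
  ultimately show ?case
    by (intro exI[of _ "\<lambda>v x. f x * E v x + D v x * g x"]) simp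
qed

lemma frechet_derivative_polynomial_function:
  fixes f :: "'a::euclidean_space \<Rightarrow> 'b::euclidean_space"
  assumes "polynomial_function f"
  shows "polynomial_function (\<lambda>x. frechet_derivative f (at x) v)"
  unfolding polynomial_function_iff_Basis_inner
proof
  fix b :: 'b assume "b \<in> Basis"
  then have "real_polynomial_function (\<lambda>x. f x \<bullet> b)"
    using assms by (simp add: polynomial_function_iff_Basis_inner)
  then obtain D where D: "\<forall>v. real_polynomial_function (D v)"
      "\<forall>x. ((\<lambda>x. f x \<bullet> b) has_derivative (\<lambda>v. D v x)) (at x)"
    using has_derivative_real_polynomial_function by blast
  have "frechet_derivative f (at x) v \<bullet> b = D v x" for x
  proof -
    have "(f has_derivative frechet_derivative f (at x)) (at x)"
      using assms by (simp add: differentiable_at_polynomial_function frechet_derivative_works[symmetric])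
    then have "((\<lambda>x. f x \<bullet> b) has_derivative (\<lambda>v. frechet_derivative f (at x) v \<bullet> b)) (at x)"
      by (rule has_derivative_inner_left)
    then show ?thesis
      using D(2) has_derivative_unique by metis
  qed
  then show "real_polynomial_function (\<lambda>x. frechet_derivative f (at x) v \<bullet> b)"
    using D(1) by simp
qed

lemma Ck_on_polynomial_function:
  fixes f :: "'a::euclidean_space \<Rightarrow> 'b::euclidean_space"
  shows "polynomial_function f \<Longrightarrow> Ck_on k U f"
  by (induction k arbitrary: f)
     (auto simp: continuous_on_polymonial_function differentiable_at_polynomial_function
       intro: frechet_derivative_polynomial_function)

lemma smooth_on_mfd_polynomial:
  fixes f :: "'a::euclidean_space \<Rightarrow> 'b::euclidean_space"
  assumes "polynomial_function P" "\<And>x. x \<in> M \<Longrightarrow> f x = P x"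
  shows "smooth_on_mfd M f"
  unfolding smooth_on_mfd_def
  using assms Ck_on_polynomial_function by (metis IntD1 UNIV_I open_UNIV)

section \<open>Derivatives along right translations\<close>

text \<open>The graph of R_X for X = E_j on continuous functions with continuous derivative. It asks
  for just what integration by parts uses, and it applies alike to smooth functions and to explicit
  matrix coefficients.\<close>

definition rderiv :: "3 \<Rightarrow> (real^3^3 \<Rightarrow> complex) \<Rightarrow> (real^3^3 \<Rightarrow> complex) \<Rightarrow> bool" where
  "rderiv j f f' \<longleftrightarrow> continuous_on SO3 f \<and> continuous_on SO3 f' \<and>
     (\<forall>g\<in>SO3. ((\<lambda>t. f (g ** rot j t)) has_vector_derivative f' g) (at 0))"

lemma rderivD:
  assumes "rderiv j f f'"
  shows "continuous_on SO3 f" "continuous_on SO3 f'"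
    "g \<in> SO3 \<Longrightarrow> ((\<lambda>t. f (g ** rot j t)) has_vector_derivative f' g) (at 0)"
  using assms by (auto simp: rderiv_def)

lemma rderiv_cong:
  assumes "rderiv j f f'" "\<And>g. g \<in> SO3 \<Longrightarrow> f g = h g" "\<And>g. g \<in> SO3 \<Longrightarrow> f' g = h' g"
  shows "rderiv j h h'"
proof -
  have "(\<lambda>t. f (g ** rot j t)) = (\<lambda>t. h (g ** rot j t))" if "g \<in> SO3" for g
    using assms(2) that by (auto simp: SO3_mult)
  then show ?thesis
    using assms unfolding rderiv_def by (metis (no_types, lifting) continuous_on_cong)
qed

lemma rderiv_unique:
  assumes "rderiv j f f1" "rderiv j f f2" "g \<in> SO3"
  shows "f1 g = f2 g"
  using rderivD(3)[OF assms(1,3)] rderivD(3)[OF assms(2,3)] by (rule vector_derivative_unique_at)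

lemma rderiv_zero: "rderiv j (\<lambda>g. 0) (\<lambda>g. 0)"
  by (simp add: rderiv_def)

lemma rderiv_add: "rderiv j f f' \<Longrightarrow> rderiv j h h' \<Longrightarrow> rderiv j (\<lambda>g. f g + h g) (\<lambda>g. f' g + h' g)"
  unfolding rderiv_def by (auto intro!: continuous_intros derivative_intros)

lemma rderiv_cmul: "rderiv j f f' \<Longrightarrow> rderiv j (\<lambda>g. c * f g) (\<lambda>g. c * f' g)"
  unfolding rderiv_def by (auto intro!: continuous_intros derivative_intros has_vector_derivative_mult_right)

lemma rderiv_sum:
  "(\<And>i. i \<in> I \<Longrightarrow> rderiv j (f i) (f' i)) \<Longrightarrow> rderiv j (\<lambda>g. \<Sum>i\<in>I. f i g) (\<lambda>g. \<Sum>i\<in>I. f' i g)"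
  by (induction I rule: infinite_finite_induct) (auto intro: rderiv_zero rderiv_add)

lemma rderiv_cnj: "rderiv j f f' \<Longrightarrow> rderiv j (\<lambda>g. cnj (f g)) (\<lambda>g. cnj (f' g))"
  unfolding rderiv_def by (auto intro!: continuous_intros has_vector_derivative_cnj)

lemma rderiv_mult:
  assumes "rderiv j f f'" "rderiv j h h'"
  shows "rderiv j (\<lambda>g. f g * h g) (\<lambda>g. f g * h' g + f' g * h g)"
proof -
  have "((\<lambda>t. f (g ** rot j t) * h (g ** rot j t)) has_vector_derivative f g * h' g + f' g * h g) (at 0)"
    if "g \<in> SO3" for g
    using has_vector_derivative_mult[OF rderivD(3)[OF assms(1) that] rderivD(3)[OF assms(2) that]] by simp
  then show ?thesis
    using assms unfolding rderiv_def by (auto intro!: continuous_intros)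
qed

text \<open>The derivative at time s is the derivative at time 0 from the base point moved along the
  subgroup.\<close>

lemma rderiv_at:
  assumes "rderiv j f f'" "g \<in> SO3"
  shows "((\<lambda>t. f (g ** rot j t)) has_vector_derivative f' (g ** rot j s)) (at s)"
proof -
  have 1: "((\<lambda>t. f ((g ** rot j s) ** rot j t)) has_vector_derivative f' (g ** rot j s)) (at (s - s))"
    using rderivD(3)[OF assms(1), of "g ** rot j s"] assms(2) by (simp add: SO3_mult)
  have 2: "((\<lambda>t. t - s) has_vector_derivative 1) (at s)"
    by (auto intro!: derivative_eq_intros)
  have "(((\<lambda>t. f ((g ** rot j s) ** rot j t)) \<circ> (\<lambda>t. t - s)) has_vector_derivative (1 *\<^sub>R f' (g ** rot j s))) (at s)"
    by (rule vector_diff_chain_at[OF 2 1])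
  moreover have "g ** rot j s ** rot j (t - s) = g ** rot j t" for t
    by (simp add: matrix_mul_assoc[symmetric] rot_add[symmetric])
  ultimately show ?thesis by (simp add: o_def)
qed

text \<open>The factor c serves the directions cosh \<tau> E3 and sinh \<tau> E1 of the
  tube.\<close>

lemma lie_deriv_rderiv:
  assumes "rderiv j f f'" "g \<in> SO3"
  shows "lie_deriv (c *\<^sub>R Egen j) f g = of_real c * f' g"
proof -
  have 1: "((\<lambda>t. f (g ** rot j t)) has_vector_derivative f' g) (at (0 * c))"
    using rderivD(3)[OF assms] by simp
  have 2: "((\<lambda>t. t * c) has_vector_derivative c) (at 0)"
    by (auto intro!: derivative_eq_intros)
  have "(((\<lambda>t. f (g ** rot j t)) \<circ> (\<lambda>t. t * c)) has_vector_derivative (c *\<^sub>R f' g)) (at 0)"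
    by (rule vector_diff_chain_at[OF 2 1])
  then show ?thesis
    unfolding lie_deriv_def rot_def by (simp add: o_def vector_derivative_at scaleR_conv_of_real[where 'a = complex])
qed

lemma bounded_linear_matrix_mult_left: "bounded_linear (\<lambda>A::real^3^3. g ** A)"
  by (subst linear_conv_bounded_linear[symmetric], rule linearI)
     (simp_all add: vec_eq_iff matrix_matrix_mult_def sum.distrib algebra_simps sum_distrib_left)

lemma bounded_linear_matrix_mult_right: "bounded_linear (\<lambda>A::real^3^3. A ** g)"
  by (subst linear_conv_bounded_linear[symmetric], rule linearI)
     (simp_all add: vec_eq_iff matrix_matrix_mult_def sum.distrib algebra_simps sum_distrib_left)

lemma rot_has_vector_derivative: "(rot j has_vector_derivative Egen j) (at 0)"
proof -
  have "((\<lambda>t. Finite_Cartesian_Product.mat 1 + sin t *\<^sub>R Egen j + (1 - cos t) *\<^sub>R (Egen j ** Egen j))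
      has_vector_derivative Egen j) (at 0)"
    by (auto intro!: derivative_eq_intros has_vector_derivative_real_field)
  then show ?thesis
    unfolding rot_def[abs_def] matexp_of_cube[OF Egen_cube] .
qed

lemma continuous_on_translate_rot: "continuous_on S (\<lambda>t. g ** rot j t)"
  unfolding rot_def[abs_def] matexp_of_cube[OF Egen_cube]
  by (intro bounded_linear.continuous_on[OF bounded_linear_matrix_mult_left] continuous_intros)

lemma translate_rot_has_vector_derivative:
  "((\<lambda>t. g ** rot j t) has_vector_derivative g ** Egen j) (at 0)"
  by (rule bounded_linear.has_vector_derivative[OF bounded_linear_matrix_mult_left rot_has_vector_derivative])

text \<open>Near each point the Lie derivative is the Frechet derivative of a local extension in the
  direction x E_j. The extension changes from point to point but the Lie derivative does not depend
  on it, so continuity can be checked locally.\<close>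

lemma rderiv_smooth:
  fixes f :: "real^3^3 \<Rightarrow> complex"
  assumes "smooth_on_mfd SO3 f"
  shows "rderiv j f (lie_deriv (Egen j) f)"
proof -
  let ?E = "Egen j"
  have loc: "\<exists>U G. open U \<and> p \<in> U \<and> (\<forall>x\<in>SO3 \<inter> U. G x = f x) \<and> continuous_on U G \<and>
      continuous_on U (\<lambda>x. frechet_derivative G (at x) (x ** ?E)) \<and>
      (\<forall>x\<in>SO3 \<inter> U. ((\<lambda>t. f (x ** rot j t)) has_vector_derivative frechet_derivative G (at x) (x ** ?E)) (at 0))"
    if p: "p \<in> SO3" for p
  proof -
    obtain U G where U: "open U" "p \<in> U" "\<And>k. Ck_on k U G" "\<And>x. x \<in> SO3 \<inter> U \<Longrightarrow> G x = f x"
      using assms p unfolding smooth_on_mfd_def by meson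
    have d: "(G has_derivative frechet_derivative G (at x)) (at x)" if "x \<in> U" for x
      using U(3)[of "Suc 0"] that by (auto simp: frechet_derivative_works)
    have c: "continuous_on U (\<lambda>x. frechet_derivative G (at x) v)" for v
      using U(3)[of "Suc 0"] by simp
    \<comment> \<open>\<open>Ck_on\<close> gives continuity of the derivative only for a fixed
      direction, while x E_j moves with x; expansion in a basis separates the two
      dependences.\<close>
    have lin: "frechet_derivative G (at x) v = (\<Sum>b\<in>Basis. (v \<bullet> b) *\<^sub>R frechet_derivative G (at x) b)"
      if "x \<in> U" for x v
      using has_derivative_linear[OF d[OF that]]
      by (subst euclidean_representation[of v, symmetric]) (simp add: linear_sum linear_cmul)
    have "continuous_on U (\<lambda>x. \<Sum>b\<in>Basis. ((x ** ?E) \<bullet> b) *\<^sub>R frechet_derivative G (at x) b)"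
      by (intro continuous_intros c bounded_linear.continuous_on[OF bounded_linear_matrix_mult_right])
    then have cc: "continuous_on U (\<lambda>x. frechet_derivative G (at x) (x ** ?E))"
      by (rule continuous_on_eq) (simp flip: lin)
    have "((\<lambda>t. f (x ** rot j t)) has_vector_derivative frechet_derivative G (at x) (x ** ?E)) (at 0)"
      if x: "x \<in> SO3 \<inter> U" for x
    proof -
      have "(G has_derivative frechet_derivative G (at x)) (at ((\<lambda>t. x ** rot j t) 0))"
        using d x by simp
      then have "((\<lambda>t. G (x ** rot j t)) has_vector_derivative frechet_derivative G (at x) (x ** ?E)) (at 0)"
        using vector_derivative_diff_chain_within[OF translate_rot_has_vector_derivative[of x j], of G "frechet_derivative G (at x)"]
        by (auto simp: o_def has_derivative_at_withinI)
      moreover have "open {t. x ** rot j t \<in> U}"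
        using open_vimage[OF U(1) continuous_on_translate_rot[of UNIV x j]] by (simp add: vimage_def)
      ultimately show ?thesis
        by (rule has_vector_derivative_transform_within_open) (use U(4) x in \<open>auto simp: SO3_mult\<close>)
    qed
    moreover have "continuous_on U G"
      using U(3)[of 0] by simp
    ultimately show ?thesis
      using U(1,2,4) cc by (intro exI[of _ U] exI[of _ G]) auto
  qed
  have ld: "lie_deriv ?E f x = d" if "((\<lambda>t. f (x ** rot j t)) has_vector_derivative d) (at 0)" for x d
    using that by (simp add: lie_deriv_def rot_def vector_derivative_at)
  show ?thesis
    unfolding rderiv_def
  proof (intro conjI ballI)
    show "((\<lambda>t. f (g ** rot j t)) has_vector_derivative lie_deriv ?E f g) (at 0)" if g: "g \<in> SO3" for g
    proof -
      obtain d where d: "((\<lambda>t. f (g ** rot j t)) has_vector_derivative d) (at 0)"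
        using loc[OF g] g by blast
      then show ?thesis using ld[OF d] by simp
    qed
    show "continuous_on SO3 f"
    proof (unfold continuous_on_eq_continuous_within, intro ballI)
      fix p assume p: "p \<in> SO3"
      obtain U G where U: "open U" "p \<in> U" "\<forall>x\<in>SO3 \<inter> U. G x = f x" "continuous_on U G"
        using loc[OF p] by (elim exE conjE) (rule that, assumption+)
      then have "continuous (at p within SO3) G"
        by (meson continuous_at_imp_continuous_at_within continuous_on_eq_continuous_at)
      then show "continuous (at p within SO3) f"
        by (rule continuous_transform_within_openin[where S = "SO3 \<inter> U"])
           (use U p in \<open>auto simp: openin_open\<close>)
    qed
    show "continuous_on SO3 (lie_deriv ?E f)"
    proof (unfold continuous_on_eq_continuous_within, intro ballI)
      fix p assume p: "p \<in> SO3"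
      obtain U G where U: "open U" "p \<in> U" 
          "continuous_on U (\<lambda>x. frechet_derivative G (at x) (x ** ?E))"
          "\<forall>x\<in>SO3 \<inter> U. ((\<lambda>t. f (x ** rot j t)) has_vector_derivative frechet_derivative G (at x) (x ** ?E)) (at 0)"
        using loc[OF p] by (elim exE conjE) (rule that, assumption+)
      then have "continuous (at p within SO3) (\<lambda>x. frechet_derivative G (at x) (x ** ?E))"
        by (meson continuous_at_imp_continuous_at_within continuous_on_eq_continuous_at)
      then show "continuous (at p within SO3) (lie_deriv ?E f)"
        by (rule continuous_transform_within_openin[where S = "SO3 \<inter> U"])
           (use U p in \<open>auto simp: openin_open intro!: ld[symmetric]\<close>)
    qed
  qed
qed

section \<open>The raising, lowering and weight operators on binary forms\<close>

lemma d0_bform: "d0 (bform n a) z0 z1 = (\<Sum>k\<le>n. a k * (of_nat (n - k) * z0 ^ (n - k - 1) * z1 ^ k))"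
  and DERIV_bform_0: "((\<lambda>z. bform n a z z1) has_field_derivative d0 (bform n a) z0 z1) (at z0)"
proof -
  have "((\<lambda>z. bform n a z z1) has_field_derivative
      (\<Sum>k\<le>n. a k * (of_nat (n - k) * z0 ^ (n - k - 1) * z1 ^ k))) (at z0)"
    unfolding bform_def mono2_def
    by (rule DERIV_sum) (auto intro!: derivative_eq_intros)
  then show "d0 (bform n a) z0 z1 = (\<Sum>k\<le>n. a k * (of_nat (n - k) * z0 ^ (n - k - 1) * z1 ^ k))"
    "((\<lambda>z. bform n a z z1) has_field_derivative d0 (bform n a) z0 z1) (at z0)"
    by (simp_all add: d0_def DERIV_imp_deriv)
qed

lemma d1_bform: "d1 (bform n a) z0 z1 = (\<Sum>k\<le>n. a k * (of_nat k * z0 ^ (n - k) * z1 ^ (k - 1)))"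
proof -
  have "((\<lambda>z. bform n a z0 z) has_field_derivative
      (\<Sum>k\<le>n. a k * (of_nat k * z0 ^ (n - k) * z1 ^ (k - 1)))) (at z1)"
    unfolding bform_def mono2_def
    by (rule DERIV_sum) (auto intro!: derivative_eq_intros)
  then show ?thesis
    by (simp add: d1_def DERIV_imp_deriv)
qed

lemma Sym_chain:
  assumes p: "p \<in> Sym n"
    and z0: "(z0 has_vector_derivative a) (at t)" and z1: "(z1 has_vector_derivative b) (at t)"
  shows "((\<lambda>t. p (z0 t) (z1 t)) has_vector_derivative
    a * d0 p (z0 t) (z1 t) + b * d1 p (z0 t) (z1 t)) (at t)"
proof -
  obtain c where c: "p = bform n c"
    using p by (auto simp: Sym_eq)
  have pw: "((\<lambda>t. z t ^ m) has_vector_derivative d * (of_nat m * z t ^ (m - 1))) (at t)"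
    if "(z has_vector_derivative d) (at t)" for z :: "real \<Rightarrow> complex" and d m
  proof -
    have "((\<lambda>w. w ^ m) has_field_derivative of_nat m * z t ^ (m - 1)) (at (z t))"
      by (auto intro!: derivative_eq_intros)
    from field_vector_diff_chain_at[OF that this] show ?thesis
      by (simp add: o_def)
  qed
  have "((\<lambda>t. bform n c (z0 t) (z1 t)) has_vector_derivative
      (\<Sum>k\<le>n. c k * (z0 t ^ (n - k) * (b * (of_nat k * z1 t ^ (k - 1)))
         + (a * (of_nat (n - k) * z0 t ^ (n - k - 1))) * z1 t ^ k))) (at t)"
    unfolding bform_def mono2_def
    by (intro has_vector_derivative_sum has_vector_derivative_mult_right has_vector_derivative_mult pw z0 z1)
  then show ?thesis
    unfolding c d0_bform d1_bform sum_distrib_left sum.distrib[symmetric]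
    by (rule has_vector_derivative_eq_rhs) (simp add: algebra_simps)
qed

text \<open>At k = 0 the truncated index k - 1 is harmless because the coefficient is zero.\<close>

lemma sym_raise_bform: "sym_raise (bform n a) = (\<lambda>z0 z1. \<Sum>k\<le>n. a k * of_nat k * mono2 n (k - 1) z0 z1)"
proof (intro ext)
  fix z0 z1
  have "z0 * (a k * (of_nat k * z0 ^ (n - k) * z1 ^ (k - 1))) = a k * of_nat k * mono2 n (k - 1) z0 z1"
    if "k \<le> n" for k
  proof (cases k)
    case (Suc m)
    then have "n - m = Suc (n - k)" using that by simp
    then show ?thesis by (simp add: Suc mono2_def)
  qed simp
  then show "sym_raise (bform n a) z0 z1 = (\<Sum>k\<le>n. a k * of_nat k * mono2 n (k - 1) z0 z1)"
    unfolding sym_raise_def d1_bform sum_distrib_left by (intro sum.cong refl) (simp only: atMost_iff)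
qed

text \<open>At k = n the monomial \<open>mono2 n (n + 1)\<close> has the wrong degree, but its
  coefficient is zero.\<close>

lemma sym_lower_bform: "sym_lower (bform n a) = (\<lambda>z0 z1. \<Sum>k\<le>n. a k * of_nat (n - k) * mono2 n (k + 1) z0 z1)"
proof (intro ext)
  fix z0 z1
  have "z1 * (a k * (of_nat (n - k) * z0 ^ (n - k - 1) * z1 ^ k)) = a k * of_nat (n - k) * mono2 n (k + 1) z0 z1"
    for k
    by (simp add: mono2_def)
  then show "sym_lower (bform n a) z0 z1 = (\<Sum>k\<le>n. a k * of_nat (n - k) * mono2 n (k + 1) z0 z1)"
    unfolding sym_lower_def d0_bform sum_distrib_left by (intro sum.cong refl) (simp only: atMost_iff)
qed

lemma sym_weight_bform:
  "sym_weight (bform n a) = (\<lambda>z0 z1. \<Sum>k\<le>n. a k * (of_nat (n - k) - of_nat k) * mono2 n k z0 z1)"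
proof (intro ext)
  fix z0 z1
  have "z0 * (a k * (of_nat (n - k) * z0 ^ (n - k - 1) * z1 ^ k)) - z1 * (a k * (of_nat k * z0 ^ (n - k) * z1 ^ (k - 1)))
      = a k * (of_nat (n - k) - of_nat k) * mono2 n k z0 z1" for k
    by (cases "n - k"; cases k) (simp_all add: mono2_def algebra_simps)
  then show "sym_weight (bform n a) z0 z1 = (\<Sum>k\<le>n. a k * (of_nat (n - k) - of_nat k) * mono2 n k z0 z1)"
    unfolding sym_weight_def d0_bform d1_bform sum_distrib_left sum_subtractf[symmetric]
    by (intro sum.cong refl) (simp only: atMost_iff)
qed

lemma sym_ops_in_Sym:
  assumes "p \<in> Sym n"
  shows "sym_raise p \<in> Sym n" "sym_lower p \<in> Sym n" "sym_weight p \<in> Sym n"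
proof -
  obtain a where a: "p = bform n a"
    using assms by (auto simp: Sym_eq)
  have "(\<lambda>z0 z1. a k * of_nat (n - k) * mono2 n (k + 1) z0 z1) \<in> Sym n" if "k \<le> n" for k
    using that by (cases "k = n") (auto intro!: Sym_cmul mono2_in_Sym simp: Sym_zero)
  then show "sym_lower p \<in> Sym n"
    unfolding a sym_lower_bform by (intro Sym_sum) (simp del: of_nat_diff)
  show "sym_raise p \<in> Sym n" "sym_weight p \<in> Sym n"
    unfolding a sym_raise_bform sym_weight_bform by (intro Sym_sum Sym_cmul mono2_in_Sym; simp)+
qed

lemma sym_ops_linear:
  assumes "p \<in> Sym n" "q \<in> Sym n"
  shows "sym_raise (\<lambda>z0 z1. p z0 z1 + c * q z0 z1) = (\<lambda>z0 z1. sym_raise p z0 z1 + c * sym_raise q z0 z1)"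
    "sym_lower (\<lambda>z0 z1. p z0 z1 + c * q z0 z1) = (\<lambda>z0 z1. sym_lower p z0 z1 + c * sym_lower q z0 z1)"
    "sym_weight (\<lambda>z0 z1. p z0 z1 + c * q z0 z1) = (\<lambda>z0 z1. sym_weight p z0 z1 + c * sym_weight q z0 z1)"
proof -
  obtain a b where a: "p = bform n a" "q = bform n b"
    using assms by (auto simp: Sym_eq)
  have *: "(\<lambda>z0 z1. p z0 z1 + c * q z0 z1) = bform n (\<lambda>k. a k + c * b k)"
    by (simp add: a bform_add bform_cmul)
  show "sym_raise (\<lambda>z0 z1. p z0 z1 + c * q z0 z1) = (\<lambda>z0 z1. sym_raise p z0 z1 + c * sym_raise q z0 z1)"
    "sym_lower (\<lambda>z0 z1. p z0 z1 + c * q z0 z1) = (\<lambda>z0 z1. sym_lower p z0 z1 + c * sym_lower q z0 z1)"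
    "sym_weight (\<lambda>z0 z1. p z0 z1 + c * q z0 z1) = (\<lambda>z0 z1. sym_weight p z0 z1 + c * sym_weight q z0 z1)"
    unfolding * unfolding a sym_raise_bform sym_lower_bform sym_weight_bform sum_distrib_left sum.distrib[symmetric]
    by (simp_all add: algebra_simps)
qed

lemma sym_ops_mono2:
  assumes "k \<le> n"
  shows "sym_raise (mono2 n k) = (\<lambda>z0 z1. of_nat k * mono2 n (k - 1) z0 z1)"
    "sym_lower (mono2 n k) = (\<lambda>z0 z1. of_nat (n - k) * mono2 n (k + 1) z0 z1)"
    "sym_weight (mono2 n k) = (\<lambda>z0 z1. (of_nat (n - k) - of_nat k) * mono2 n k z0 z1)"
proof -
  have *: "mono2 n k = bform n (\<lambda>i. if i = k then 1 else 0)"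
    using assms by (simp add: bform_def fun_eq_iff if_distrib[of "\<lambda>c. c * _"] cong: if_cong)
  show "sym_raise (mono2 n k) = (\<lambda>z0 z1. of_nat k * mono2 n (k - 1) z0 z1)"
    "sym_lower (mono2 n k) = (\<lambda>z0 z1. of_nat (n - k) * mono2 n (k + 1) z0 z1)"
    "sym_weight (mono2 n k) = (\<lambda>z0 z1. (of_nat (n - k) - of_nat k) * mono2 n k z0 z1)"
    unfolding * sym_raise_bform sym_lower_bform sym_weight_bform using assms
    by (auto simp: fun_eq_iff bform_def if_distrib[of "\<lambda>c. c * _"] cong: if_cong)
qed

text \<open>The prescribed actions of E1 + iE2, -E1 + iE2 and 2iE3, solved for E1, E2 and
  E3.\<close>

definition dE :: "3 \<Rightarrow> bipoly \<Rightarrow> bipoly" where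
  "dE j p = (\<lambda>z0 z1.
     if j = 1 then (sym_raise p z0 z1 - sym_lower p z0 z1) / 2
     else if j = 2 then (sym_raise p z0 z1 + sym_lower p z0 z1) / (2 * \<i>)
     else sym_weight p z0 z1 / (2 * \<i>))"

lemma dE_in_Sym:
  assumes "p \<in> Sym n"
  shows "dE j p \<in> Sym n"
proof -
  have "dE 1 p = (\<lambda>z0 z1. 1 / 2 * sym_raise p z0 z1 + - 1 / 2 * sym_lower p z0 z1)"
    "dE 2 p = (\<lambda>z0 z1. 1 / (2 * \<i>) * sym_raise p z0 z1 + 1 / (2 * \<i>) * sym_lower p z0 z1)"
    "dE 3 p = (\<lambda>z0 z1. 1 / (2 * \<i>) * sym_weight p z0 z1)"
    by (simp_all add: dE_def fun_eq_iff field_simps)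
  then have "dE 1 p \<in> Sym n" "dE 2 p \<in> Sym n" "dE 3 p \<in> Sym n"
    by (simp_all only:) (intro Sym_add Sym_cmul sym_ops_in_Sym assms)+
  then show ?thesis
    using exhaust_3[of j] by auto
qed

lemma su_rot_add: "su_rot j (s + t) = su_rot j s ** su_rot j t"
  by (simp add: su_rot_def Let_def vec_eq_iff forall_2 matrix_matrix_mult_def sum_2 add_divide_distrib
      cos_add sin_add algebra_simps)

lemma su_rot_0 [simp]: "su_rot j 0 = Finite_Cartesian_Product.mat 1"
  by (simp add: su_rot_def Let_def vec_eq_iff forall_2 Finite_Cartesian_Product.mat_def)

lemma su_rot_has_vector_derivative:
  assumes p: "p \<in> Sym n"
  shows "((\<lambda>t. sub (su_rot j t) p w0 w1) has_vector_derivative dE j p w0 w1) (at 0)"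
proof -
  have c: "((\<lambda>t. complex_of_real (cos (t / 2))) has_vector_derivative 0) (at 0)"
    and s: "((\<lambda>t. complex_of_real (sin (t / 2))) has_vector_derivative 1 / 2) (at 0)"
    by (auto intro!: derivative_eq_intros has_vector_derivative_of_real simp: has_real_derivative_iff_has_vector_derivative[symmetric])
  let ?c = "\<lambda>t. complex_of_real (cos (t / 2))" and ?s = "\<lambda>t. complex_of_real (sin (t / 2))"
  have e: "\<And>t. su_rot 1 t $ 1 $ 1 = ?c t" "\<And>t. su_rot 1 t $ 1 $ 2 = ?s t"
     "\<And>t. su_rot 1 t $ 2 $ 1 = - ?s t" "\<And>t. su_rot 1 t $ 2 $ 2 = ?c t"
     "\<And>t. su_rot 2 t $ 1 $ 1 = ?c t" "\<And>t. su_rot 2 t $ 1 $ 2 = - \<i> * ?s t"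
     "\<And>t. su_rot 2 t $ 2 $ 1 = - \<i> * ?s t" "\<And>t. su_rot 2 t $ 2 $ 2 = ?c t"
     "\<And>t. su_rot 3 t $ 1 $ 1 = ?c t - \<i> * ?s t" "\<And>t. su_rot 3 t $ 1 $ 2 = 0"
     "\<And>t. su_rot 3 t $ 2 $ 1 = 0" "\<And>t. su_rot 3 t $ 2 $ 2 = ?c t + \<i> * ?s t"
    by (simp_all add: su_rot_def Let_def)
  have "((\<lambda>t. sub (su_rot 1 t) p w0 w1) has_vector_derivative dE 1 p w0 w1) (at 0)"
  proof -
    have 1: "((\<lambda>t. w0 * ?c t + w1 * - ?s t) has_vector_derivative w0 * 0 + w1 * - (1 / 2)) (at 0)"
      by (intro has_vector_derivative_add has_vector_derivative_mult_right has_vector_derivative_minus c s)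
    have 2: "((\<lambda>t. w0 * ?s t + w1 * ?c t) has_vector_derivative w0 * (1 / 2) + w1 * 0) (at 0)"
      by (intro has_vector_derivative_add has_vector_derivative_mult_right c s)
    show ?thesis
      unfolding sub_def e
      by (rule has_vector_derivative_eq_rhs[OF Sym_chain[OF p 1 2]])
         (simp add: dE_def sym_raise_def sym_lower_def field_simps)
  qed
  moreover have "((\<lambda>t. sub (su_rot 2 t) p w0 w1) has_vector_derivative dE 2 p w0 w1) (at 0)"
  proof -
    have 1: "((\<lambda>t. w0 * ?c t + w1 * (- \<i> * ?s t)) has_vector_derivative w0 * 0 + w1 * (- \<i> * (1 / 2))) (at 0)"
      by (intro has_vector_derivative_add has_vector_derivative_mult_right c s)
    have 2: "((\<lambda>t. w0 * (- \<i> * ?s t) + w1 * ?c t) has_vector_derivative w0 * (- \<i> * (1 / 2)) + w1 * 0) (at 0)"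
      by (intro has_vector_derivative_add has_vector_derivative_mult_right c s)
    show ?thesis
      unfolding sub_def e
      by (rule has_vector_derivative_eq_rhs[OF Sym_chain[OF p 1 2]])
         (simp add: dE_def sym_raise_def sym_lower_def complex_eq_iff Re_divide Im_divide, simp add: field_simps)
  qed
  moreover have "((\<lambda>t. sub (su_rot 3 t) p w0 w1) has_vector_derivative dE 3 p w0 w1) (at 0)"
  proof -
    have 1: "((\<lambda>t. w0 * (?c t - \<i> * ?s t) + w1 * 0) has_vector_derivative w0 * (0 - \<i> * (1 / 2)) + 0) (at 0)"
      by (intro has_vector_derivative_add has_vector_derivative_diff has_vector_derivative_mult_right c s) simp
    have 2: "((\<lambda>t. w0 * 0 + w1 * (?c t + \<i> * ?s t)) has_vector_derivative 0 + w1 * (0 + \<i> * (1 / 2))) (at 0)"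
      by (intro has_vector_derivative_add has_vector_derivative_mult_right c s) simp
    show ?thesis
      unfolding sub_def e
      by (rule has_vector_derivative_eq_rhs[OF Sym_chain[OF p 1 2]])
         (simp add: dE_def sym_weight_def complex_eq_iff Re_divide Im_divide, simp add: field_simps)
  qed
  ultimately show ?thesis
    using exhaust_3[of j] by blast
qed

text \<open>The lift of g is a fixed outer substitution and the lift of the rotation a moving inner
  one, so right translation differentiates the form before g acts on it.\<close>

lemma rderiv_act:
  assumes p: "p \<in> Sym (2 * l)"
  shows "rderiv j (\<lambda>g. act g p z0 z1) (\<lambda>g. act g (dE j p) z0 z1)"
  unfolding rderiv_def
proof (intro conjI ballI)
  show "continuous_on SO3 (\<lambda>g. act g p z0 z1)" "continuous_on SO3 (\<lambda>g. act g (dE j p) z0 z1)"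
    using act_continuous dE_in_Sym p by blast+
  fix g assume "g \<in> SO3"
  then obtain U where U: "lift g U"
    using ex_lift by blast
  have "act (g ** rot j t) p z0 z1 = sub U (sub (su_rot j t) p) z0 z1" for t
    using act_eq_sub[OF lift_mult[OF U lift_rot] p] by (simp add: sub_sub)
  moreover have "act g (dE j p) z0 z1 = sub U (dE j p) z0 z1"
    using act_eq_sub[OF U dE_in_Sym[OF p]] by simp
  ultimately show "((\<lambda>t. act (g ** rot j t) p z0 z1) has_vector_derivative act g (dE j p) z0 z1) (at 0)"
    using su_rot_has_vector_derivative[OF p] by (simp add: sub_def[of U])
qed

section \<open>Forms determined by their values at finitely many points\<close>

lemma bform_eq_iff: "bform n a = bform n b \<longleftrightarrow> (\<forall>k\<le>n. a k = b k)"
proof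
  assume "bform n a = bform n b"
  then have "bform n a 1 x = bform n b 1 x" for x
    by simp
  then have "\<forall>x. (\<Sum>k\<le>n. a k * x ^ k) = (\<Sum>k\<le>n. b k * x ^ k)"
    by (simp add: bform_def mono2_def)
  then show "\<forall>k\<le>n. a k = b k"
    by (simp only: Transcendental.polyfun_eq_coeffs)
qed (simp add: bform_def)

text \<open>p(1, z) is a polynomial in z of degree at most n with n + 1 roots.\<close>

lemma Sym_vanishing:
  assumes "p \<in> Sym n" "\<And>i. i \<le> n \<Longrightarrow> p 1 (of_nat i) = 0"
  shows "p = (\<lambda>z0 z1. 0)"
proof -
  obtain a where a: "p = bform n a"
    using assms(1) by (auto simp: Sym_eq)
  have "a k = 0" if "k \<le> n" for k
  proof (rule ccontr)
    assume "a k \<noteq> 0"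
    then have fin: "finite {z. (\<Sum>i\<le>n. a i * z ^ i) = 0}" and card: "card {z. (\<Sum>i\<le>n. a i * z ^ i) = 0} \<le> n"
      using Transcendental.polyfun_rootbound[of a k n] that by auto
    have "of_nat ` {..n} \<subseteq> {z. (\<Sum>i\<le>n. a i * z ^ i) = 0}"
      using assms(2) by (auto simp: a bform_def mono2_def)
    then have "card (of_nat ` {..n} :: complex set) \<le> n"
      using card card_mono[OF fin] by (meson le_trans)
    moreover have "card (of_nat ` {..n} :: complex set) = Suc n"
      by (simp add: card_image inj_on_def)
    ultimately show False by simp
  qed
  then show ?thesis
    by (simp add: a bform_def fun_eq_iff)
qed

text \<open>The Lagrange basis for the nodes 0, ..., n, made homogeneous.\<close>

definition lagr :: "nat \<Rightarrow> nat \<Rightarrow> bipoly" where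
  "lagr n i = (\<lambda>z0 z1. \<Prod>j\<in>{..n} - {i}. (z1 - of_nat j * z0) / (of_nat i - of_nat j))"

lemma Sym_prod:
  "finite I \<Longrightarrow> (\<And>i. i \<in> I \<Longrightarrow> p i \<in> Sym 1) \<Longrightarrow> (\<lambda>z0 z1. \<Prod>i\<in>I. p i z0 z1) \<in> Sym (card I)"
proof (induction I rule: finite_induct)
  case empty
  then show ?case using Sym_const[of 1] by simp
next
  case (insert i I)
  then show ?case using Sym_mult[of "p i" 1 "\<lambda>z0 z1. \<Prod>i\<in>I. p i z0 z1" "card I"] by simp
qed

lemma lagr_in_Sym: "i \<le> n \<Longrightarrow> lagr n i \<in> Sym n"
proof -
  assume "i \<le> n"
  have "(\<lambda>z0 z1. (z1 - of_nat j * z0) / (of_nat i - of_nat j)) \<in> Sym 1" for j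
    using Sym_linear[of "- of_nat j / (of_nat i - of_nat j)" "1 / (of_nat i - of_nat j)"]
    by (simp add: diff_divide_distrib mult.commute)
  then have "lagr n i \<in> Sym (card ({..n} - {i}))"
    unfolding lagr_def by (intro Sym_prod) auto
  then show ?thesis using \<open>i \<le> n\<close> by simp
qed

lemma lagr_delta: "i \<le> n \<Longrightarrow> k \<le> n \<Longrightarrow> lagr n i 1 (of_nat k) = (if i = k then 1 else 0)"
proof (cases "i = k")
  case True
  then show ?thesis by (simp add: lagr_def prod.neutral)
next
  case False
  assume "i \<le> n" "k \<le> n"
  then have "k \<in> {..n} - {i}" using False by auto
  then show ?thesis using False unfolding lagr_def by (auto simp: prod_zero_iff)
qed

lemma lagrange_interpolation:
  assumes p: "p \<in> Sym n"
  shows "p z0 z1 = (\<Sum>i\<le>n. p 1 (of_nat i) * lagr n i z0 z1)"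
proof -
  let ?q = "\<lambda>z0 z1. p z0 z1 + - 1 * (\<Sum>i\<le>n. p 1 (of_nat i) * lagr n i z0 z1)"
  have "?q \<in> Sym n"
    by (intro Sym_add Sym_cmul Sym_sum p lagr_in_Sym) simp
  moreover have "?q 1 (of_nat k) = 0" if "k \<le> n" for k
    using that by (simp add: lagr_delta if_distrib[of "\<lambda>c. _ * c"] cong: if_cong)
  ultimately have "?q = (\<lambda>z0 z1. 0)"
    by (rule Sym_vanishing)
  then have "?q z0 z1 = 0" by meson
  then show ?thesis by simp
qed

lemma act_interpolation:
  assumes "p \<in> Sym n"
  shows "act g p z0 z1 = (\<Sum>i\<le>n. lagr n i z0 z1 * act g p 1 (of_nat i))"
  using lagrange_interpolation[OF act_in_Sym[OF assms], of g z0 z1] by (simp add: mult.commute)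

section \<open>Square-integrable functions\<close>

lemma L2D:
  assumes "f \<in> L2 M"
  shows "f \<in> borel_measurable M" "integrable M (\<lambda>x. (cmod (f x))\<^sup>2)"
  using assms by (auto simp: L2_def)

lemma cmod_add_sq_le: "(cmod (a + b))\<^sup>2 \<le> 2 * (cmod a)\<^sup>2 + 2 * (cmod b)\<^sup>2"
proof -
  have "(cmod (a + b))\<^sup>2 \<le> (cmod a + cmod b)\<^sup>2"
    by (intro power_mono norm_triangle_ineq) simp
  also have "\<dots> \<le> 2 * (cmod a)\<^sup>2 + 2 * (cmod b)\<^sup>2"
    using sum_squares_bound[of "cmod a" "cmod b"] by (simp add: power2_sum)
  finally show ?thesis .
qed

lemma L2_zero: "(\<lambda>x. 0) \<in> L2 M"
  by (simp add: L2_def)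

lemma L2_add:
  assumes "f \<in> L2 M" "g \<in> L2 M"
  shows "(\<lambda>x. f x + g x) \<in> L2 M"
proof -
  have "integrable M (\<lambda>x. (cmod (f x + g x))\<^sup>2)"
    by (rule Bochner_Integration.integrable_bound[where f = "\<lambda>x. 2 * (cmod (f x))\<^sup>2 + 2 * (cmod (g x))\<^sup>2"])
       (use L2D[OF assms(1)] L2D[OF assms(2)] cmod_add_sq_le in auto)
  then show ?thesis
    using L2D[OF assms(1)] L2D[OF assms(2)] by (auto simp: L2_def)
qed

lemma L2_cmul: "f \<in> L2 M \<Longrightarrow> (\<lambda>x. c * f x) \<in> L2 M"
  by (auto simp: L2_def norm_mult power_mult_distrib)

lemma L2_diff: "f \<in> L2 M \<Longrightarrow> g \<in> L2 M \<Longrightarrow> (\<lambda>x. f x - g x) \<in> L2 M"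
  using L2_add[OF _ L2_cmul[of g M "- 1"], of f] by simp

lemma fun_span_L2: "A \<subseteq> L2 M \<Longrightarrow> fun_span A \<subseteq> L2 M"
proof
  fix F assume "A \<subseteq> L2 M" "F \<in> fun_span A"
  then show "F \<in> L2 M"
  proof (induction rule: fun_span_induct[OF \<open>F \<in> fun_span A\<close>])
    case 1
    show ?case by (rule L2_zero)
  next
    case (2 F a c)
    then show ?case by (intro L2_add L2_cmul) auto
  qed
qed

lemma weighted_am_gm: 
  fixes s :: real assumes "s > 0" shows "2 * (x * y) \<le> s * x\<^sup>2 + y\<^sup>2 / s"
proof -
  have "0 \<le> (s * x - y)\<^sup>2 / s" using assms by simp
  also have "\<dots> = s * x\<^sup>2 + y\<^sup>2 / s - 2 * (x * y)"
    using assms by (simp add: power2_eq_square field_simps)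
  finally show ?thesis by simp
qed

lemma borel_measurable_cnj [intro]:
  assumes "g \<in> borel_measurable M"
  shows "(\<lambda>x. cnj (g x)) \<in> borel_measurable M"
  by (rule measurable_compose[OF assms borel_measurable_continuous_onI[OF continuous_on_cnj[OF continuous_on_id]]])

lemma L2_inner_integrable:
  assumes "f \<in> L2 M" "g \<in> L2 M"
  shows "integrable M (\<lambda>x. f x * cnj (g x))"
proof (rule Bochner_Integration.integrable_bound[where f = "\<lambda>x. (cmod (f x))\<^sup>2 + (cmod (g x))\<^sup>2"])
  show "AE x in M. norm (f x * cnj (g x)) \<le> norm ((cmod (f x))\<^sup>2 + (cmod (g x))\<^sup>2)"
  proof (rule AE_I2)
    fix x show "norm (f x * cnj (g x)) \<le> norm ((cmod (f x))\<^sup>2 + (cmod (g x))\<^sup>2)"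
      using weighted_am_gm[of 1 "cmod (f x)" "cmod (g x)"] mult_nonneg_nonneg[of "cmod (f x)" "cmod (g x)"]
      unfolding norm_mult complex_mod_cnj real_norm_def by linarith
  qed
next
  show "(\<lambda>x. f x * cnj (g x)) \<in> borel_measurable M"
    using L2D(1)[OF assms(1)] borel_measurable_cnj[OF L2D(1)[OF assms(2)]] by simp
qed (use L2D[OF assms(1)] L2D[OF assms(2)] in auto)

lemma l2_inner_add_left:
  "f \<in> L2 M \<Longrightarrow> g \<in> L2 M \<Longrightarrow> h \<in> L2 M \<Longrightarrow>
   l2_inner M (\<lambda>x. f x + g x) h = l2_inner M f h + l2_inner M g h"
  unfolding l2_inner_def distrib_right
  by (intro Bochner_Integration.integral_add L2_inner_integrable)

lemma l2_inner_cmul_left: "l2_inner M (\<lambda>x. c * f x) h = c * l2_inner M f h"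
  unfolding l2_inner_def mult.assoc by (rule Bochner_Integration.integral_mult_right_zero)

lemma l2_inner_cnj: "l2_inner M g f = cnj (l2_inner M f g)"
  unfolding l2_inner_def Bochner_Integration.integral_cnj[symmetric] by (simp add: mult.commute)

lemma l2_inner_add_right:
  "f \<in> L2 M \<Longrightarrow> g \<in> L2 M \<Longrightarrow> h \<in> L2 M \<Longrightarrow>
   l2_inner M h (\<lambda>x. f x + g x) = l2_inner M h f + l2_inner M h g"
  by (subst (1 2 3) l2_inner_cnj) (simp add: l2_inner_add_left)

lemma l2_inner_cmul_right: "l2_inner M h (\<lambda>x. c * f x) = cnj c * l2_inner M h f"
  by (subst (1 2) l2_inner_cnj) (simp add: l2_inner_cmul_left)

lemma l2_inner_diff_left:
  "f \<in> L2 M \<Longrightarrow> g \<in> L2 M \<Longrightarrow> h \<in> L2 M \<Longrightarrow>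
   l2_inner M (\<lambda>x. f x - g x) h = l2_inner M f h - l2_inner M g h"
  using l2_inner_add_left[OF _ L2_cmul[of g M "- 1"], of f h] l2_inner_cmul_left[of M "- 1" g h] by simp

lemma l2_norm_sq: "(l2_norm M f)\<^sup>2 = (\<integral>x. (cmod (f x))\<^sup>2 \<partial>M)"
  by (simp add: l2_norm_def)

lemma l2_norm_nonneg: "l2_norm M f \<ge> 0"
  by (simp add: l2_norm_def)

lemma l2_inner_self: "l2_inner M f f = complex_of_real ((l2_norm M f)\<^sup>2)"
  unfolding l2_norm_sq l2_inner_def integral_complex_of_real[symmetric]
  by (simp add: complex_norm_square[symmetric])

lemma l2_norm_add_sq_le:
  assumes "f \<in> L2 M" "g \<in> L2 M"
  shows "(l2_norm M (\<lambda>x. f x + g x))\<^sup>2 \<le> 2 * (l2_norm M f)\<^sup>2 + 2 * (l2_norm M g)\<^sup>2"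
proof -
  have "(\<integral>x. (cmod (f x + g x))\<^sup>2 \<partial>M) \<le> (\<integral>x. 2 * (cmod (f x))\<^sup>2 + 2 * (cmod (g x))\<^sup>2 \<partial>M)"
    by (intro integral_mono Bochner_Integration.integrable_add integrable_mult_right
        L2D(2) L2_add assms cmod_add_sq_le)
  also have "\<dots> = 2 * (\<integral>x. (cmod (f x))\<^sup>2 \<partial>M) + 2 * (\<integral>x. (cmod (g x))\<^sup>2 \<partial>M)"
    using L2D(2)[OF assms(1)] L2D(2)[OF assms(2)] by simp
  finally show ?thesis
    by (simp add: l2_norm_sq)
qed

text \<open>A weighted substitute for the Cauchy-Schwarz inequality: instead of optimizing over s
  once, each use chooses its own s.\<close>

lemma l2_inner_bound:
  assumes "f \<in> L2 M" "g \<in> L2 M" "s > 0"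
  shows "2 * cmod (l2_inner M f g) \<le> s * (l2_norm M f)\<^sup>2 + (l2_norm M g)\<^sup>2 / s"
proof -
  have "2 * cmod (l2_inner M f g) \<le> 2 * (\<integral>x. cmod (f x * cnj (g x)) \<partial>M)"
    unfolding l2_inner_def using integral_norm_bound by simp
  also have "\<dots> = (\<integral>x. 2 * (cmod (f x) * cmod (g x)) \<partial>M)"
    by (simp add: norm_mult)
  also have "\<dots> \<le> (\<integral>x. s * (cmod (f x))\<^sup>2 + (cmod (g x))\<^sup>2 / s \<partial>M)"
    using weighted_am_gm[OF assms(3)] L2D(2)[OF assms(1)] L2D(2)[OF assms(2)]
      integrable_norm[OF L2_inner_integrable[OF assms(1,2)]]
    by (intro integral_mono) (auto simp: norm_mult)
  also have "\<dots> = s * (\<integral>x. (cmod (f x))\<^sup>2 \<partial>M) + (\<integral>x. (cmod (g x))\<^sup>2 \<partial>M) / s"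
    using L2D(2)[OF assms(1)] L2D(2)[OF assms(2)] by simp
  finally show ?thesis
    by (simp add: l2_norm_sq)
qed

lemma l2_inner_zero_norm:
  assumes "f \<in> L2 M" "g \<in> L2 M" "l2_norm M g = 0"
  shows "l2_inner M f g = 0"
proof (rule ccontr)
  assume "l2_inner M f g \<noteq> 0"
  define n where "n = (l2_norm M f)\<^sup>2"
  \<comment> \<open>With a null g the bound reads 2 c \<le> s n for c the modulus of the inner
    product; this s turns it into 2 s (n + 1) \<le> s n, which is absurd.\<close>
  define s where "s = cmod (l2_inner M f g) / (n + 1)"
  have n: "n \<ge> 0" by (simp add: n_def)
  then have s: "s > 0" using \<open>l2_inner M f g \<noteq> 0\<close> by (simp add: s_def)
  have "2 * (s * (n + 1)) \<le> s * n"
    using l2_inner_bound[OF assms(1,2) s] assms(3) n by (simp add: n_def[symmetric] s_def)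
  then have "s * (n + 2) \<le> 0" by (simp add: algebra_simps)
  then show False using s n by (simp add: mult_le_0_iff)
qed

lemma l2_pythagoras:
  assumes "f \<in> L2 M" "g \<in> L2 M" "l2_inner M f g = 0"
  shows "(l2_norm M (\<lambda>x. f x + g x))\<^sup>2 = (l2_norm M f)\<^sup>2 + (l2_norm M g)\<^sup>2"
proof -
  have "l2_inner M g f = 0"
    using l2_inner_cnj[of M g f] assms(3) by simp
  then have "l2_inner M (\<lambda>x. f x + g x) (\<lambda>x. f x + g x) = l2_inner M f f + l2_inner M g g"
    using assms by (simp add: l2_inner_add_left l2_inner_add_right L2_add)
  then show ?thesis
    unfolding l2_inner_self of_real_add[symmetric] by (simp only: of_real_eq_iff)
qed

lemma l2_inner_cong_AE:
  assumes "f \<in> borel_measurable M" "f' \<in> borel_measurable M" "g \<in> borel_measurable M" "g' \<in> borel_measurable M"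
    "AE x in M. f x = f' x" "AE x in M. g x = g' x"
  shows "l2_inner M f g = l2_inner M f' g'"
  unfolding l2_inner_def using assms by (intro integral_cong_AE borel_measurable_times borel_measurable_cnj) auto

lemma l2_norm_cong_AE:
  assumes "f \<in> borel_measurable M" "f' \<in> borel_measurable M" "AE x in M. f x = f' x"
  shows "l2_norm M f = l2_norm M f'"
  unfolding l2_norm_def using assms by (intro arg_cong[where f = sqrt] integral_cong_AE) auto

lemma l2_norm_zero_iff:
  assumes "f \<in> L2 M"
  shows "l2_norm M f = 0 \<longleftrightarrow> (AE x in M. f x = 0)"
  using integral_nonneg_eq_0_iff_AE[OF L2D(2)[OF assms]] by (simp add: l2_norm_def)

lemma l2_orth_span:
  assumes "F \<in> fun_span A" "A \<subseteq> L2 M" "h \<in> L2 M" "\<And>a. a \<in> A \<Longrightarrow> l2_inner M h a = 0"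
  shows "l2_inner M h F = 0"
  using assms(1)
proof (induction rule: fun_span_induct)
  case zero
  show ?case by (simp add: l2_inner_def)
next
  case (step F a c)
  then show ?case
    using fun_span_L2[OF assms(2)] assms(2-)
    by (subst l2_inner_add_right) (auto simp: l2_inner_cmul_right intro: L2_cmul)
qed

text \<open>One Gram-Schmidt step per element: the projection p onto A is corrected by the component
  of h - p along e, the part of b orthogonal to A.\<close>

lemma l2_projection:
  assumes "finite A" "A \<subseteq> L2 M" "h \<in> L2 M"
  shows "\<exists>p\<in>fun_span A. \<forall>a\<in>A. l2_inner M (\<lambda>x. h x - p x) a = 0"
  using assms
proof (induction A arbitrary: h rule: finite_induct)
  case empty
  then show ?case using fun_span_zero by auto
next
  case (insert b A)
  have A: "A \<subseteq> L2 M" and b: "b \<in> L2 M" and h: "h \<in> L2 M"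
    using insert.prems by auto
  obtain p where p: "p \<in> fun_span A" "\<forall>a\<in>A. l2_inner M (\<lambda>x. h x - p x) a = 0"
    using insert.IH[OF A h] by blast
  obtain q where q: "q \<in> fun_span A" "\<forall>a\<in>A. l2_inner M (\<lambda>x. b x - q x) a = 0"
    using insert.IH[OF A b] by blast
  have pL: "p \<in> L2 M" and qL: "q \<in> L2 M"
    using p(1) q(1) fun_span_L2[OF A] by auto
  define e where "e = (\<lambda>x. b x - q x)"
  define k where "k = (\<lambda>x. h x - p x)"
  have e: "e \<in> L2 M" and k: "k \<in> L2 M"
    by (simp_all add: e_def k_def L2_diff b h pL qL)
  have eA: "l2_inner M e a = 0" if "a \<in> A" for a
    using q(2) that by (simp add: e_def)
  have kA: "l2_inner M k a = 0" if "a \<in> A" for a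
    using p(2) that by (simp add: k_def)
  have kq: "l2_inner M k q = 0" and eq: "l2_inner M e q = 0"
    using l2_orth_span[OF q(1) A] k e kA eA by auto
  \<comment> \<open>If e is null, b agrees almost everywhere with an element of the span of A and
    the coefficient is set to 0.\<close>
  define \<alpha> where "\<alpha> = (if l2_norm M e = 0 then 0 else l2_inner M k e / of_real ((l2_norm M e)\<^sup>2))"
  define r where "r = (\<lambda>x. p x + \<alpha> * e x)"
  have r_eq: "(\<lambda>x. h x - r x) = (\<lambda>x. k x - \<alpha> * e x)"
    by (auto simp: r_def k_def)
  have in_span: "r \<in> fun_span (insert b A)"
  proof -
    have sub: "fun_span A \<subseteq> fun_span (insert b A)"
      by (intro fun_span_mono) auto
    have "(\<lambda>x. b x + -1 * q x) \<in> fun_span (insert b A)"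
      by (rule fun_span_add[OF fun_span_cmul fun_span_base]) (use q(1) sub in auto)
    then have "e \<in> fun_span (insert b A)"
      by (simp add: e_def)
    then show ?thesis
      unfolding r_def by (intro fun_span_add[OF fun_span_cmul]) (use p(1) sub in auto)
  qed
  have ip: "l2_inner M (\<lambda>x. h x - r x) a = l2_inner M k a - \<alpha> * l2_inner M e a" if "a \<in> L2 M" for a
    unfolding r_eq using l2_inner_diff_left[OF k L2_cmul[OF e] that] by (simp add: l2_inner_cmul_left)
  have "l2_inner M (\<lambda>x. h x - r x) a = 0" if "a \<in> A" for a
    using ip[of a] that A eA kA by auto
  moreover have "l2_inner M (\<lambda>x. h x - r x) b = 0"
  proof -
    have "b = (\<lambda>x. e x + q x)" by (simp add: e_def)
    then have "l2_inner M (\<lambda>x. h x - r x) b = l2_inner M k e - \<alpha> * l2_inner M e e"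
      using ip[OF b] l2_inner_add_right[OF e qL k] l2_inner_add_right[OF e qL e] kq eq by simp
    also have "\<dots> = 0"
      using l2_inner_zero_norm[OF k e] by (simp add: \<alpha>_def l2_inner_self)
    finally show ?thesis .
  qed
  ultimately show ?case
    using in_span by blast
qed

text \<open>The inner product with a fixed b is continuous in L2.\<close>

lemma l2_closure_orth:
  assumes "f \<in> l2_closure M A" "b \<in> L2 M" "\<And>a. a \<in> A \<Longrightarrow> a \<in> L2 M \<Longrightarrow> l2_inner M a b = 0"
  shows "l2_inner M f b = 0"
proof -
  have f: "f \<in> L2 M" using assms(1) by (simp add: l2_closure_def)
  define n where "n = (l2_norm M b)\<^sup>2"
  have n: "n \<ge> 0" by (simp add: n_def)
  have "cmod (l2_inner M f b) \<le> e" if "e > 0" for e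
  proof -
    \<comment> \<open>Chosen so that n / s \<le> e; approximating f with squared error below e / s
      then makes both terms of the bound at most e.\<close>
    define s where "s = (n + 1) / e"
    have s: "s > 0" using that n by (simp add: s_def)
    have "sqrt (e / s) > 0" using that s by simp
    then obtain a where a: "a \<in> A" "a \<in> L2 M" "l2_norm M (\<lambda>x. f x - a x) < sqrt (e / s)"
      using assms(1) unfolding l2_closure_def by blast
    have "l2_inner M f b = l2_inner M (\<lambda>x. f x - a x) b"
      using l2_inner_diff_left[OF f a(2) assms(2)] assms(3)[OF a(1,2)] by simp
    then have "2 * cmod (l2_inner M f b) \<le> s * (l2_norm M (\<lambda>x. f x - a x))\<^sup>2 + n / s"
      using l2_inner_bound[OF L2_diff[OF f a(2)] assms(2) s] by (simp add: n_def)
    also have "(l2_norm M (\<lambda>x. f x - a x))\<^sup>2 \<le> e / s"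
      using power_mono[OF less_imp_le[OF a(3)] l2_norm_nonneg, of 2] that s by simp
    then have "s * (l2_norm M (\<lambda>x. f x - a x))\<^sup>2 + n / s \<le> e + n / s"
      using s by (simp add: field_simps)
    also have "n / s \<le> e"
      using n that by (simp add: s_def field_simps)
    finally show ?thesis by simp
  qed
  then have "cmod (l2_inner M f b) \<le> 0"
    by (rule field_le_epsilon[of _ 0, simplified])
  then show ?thesis by simp
qed

lemma l2_closure_approx:
  assumes f: "f \<in> L2 M" and approx: "\<And>e. e > 0 \<Longrightarrow> \<exists>h\<in>l2_closure M A. l2_norm M (\<lambda>x. f x - h x) < e"
  shows "f \<in> l2_closure M A"
  unfolding l2_closure_def
proof (intro CollectI conjI allI impI f)
  fix e :: real assume e: "e > 0"
  obtain h where h: "h \<in> l2_closure M A" "l2_norm M (\<lambda>x. f x - h x) < e / 2"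
    using approx[of "e / 2"] e by auto
  have "e / 2 > 0" using e by simp
  then obtain a where a: "a \<in> A" "a \<in> L2 M" "l2_norm M (\<lambda>x. h x - a x) < e / 2"
    using h(1) unfolding l2_closure_def by blast
  have hL: "h \<in> L2 M" using h(1) by (simp add: l2_closure_def)
  have "(l2_norm M (\<lambda>x. (f x - h x) + (h x - a x)))\<^sup>2
      \<le> 2 * (l2_norm M (\<lambda>x. f x - h x))\<^sup>2 + 2 * (l2_norm M (\<lambda>x. h x - a x))\<^sup>2"
    by (intro l2_norm_add_sq_le L2_diff f hL a)
  also have "\<dots> < 2 * (e / 2)\<^sup>2 + 2 * (e / 2)\<^sup>2"
    using h(2) a(3) by (intro add_strict_mono mult_strict_left_mono power_strict_mono l2_norm_nonneg) auto
  also have "\<dots> = e\<^sup>2"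
    by (simp add: power2_eq_square)
  finally have "l2_norm M (\<lambda>x. f x - a x) < e"
    using e by (simp add: power_less_imp_less_base)
  then show "\<exists>g\<in>A \<inter> L2 M. l2_norm M (\<lambda>x. f x - g x) < e"
    using a by blast
qed

lemma l2_closure_AE:
  assumes "f \<in> l2_closure M A" "f' \<in> L2 M" "AE x in M. f x = f' x"
  shows "f' \<in> l2_closure M A"
proof (rule l2_closure_approx[OF assms(2)])
  fix e :: real assume "e > 0"
  have "f \<in> L2 M" using assms(1) by (simp add: l2_closure_def)
  then have "l2_norm M (\<lambda>x. f' x - f x) = 0"
    using assms(2,3) by (subst l2_norm_zero_iff) (auto intro: L2_diff)
  then show "\<exists>h\<in>l2_closure M A. l2_norm M (\<lambda>x. f' x - h x) < e"
    using assms(1) \<open>e > 0\<close> by (intro bexI[of _ f]) simp_all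
qed

lemma l2_closure_base: "f \<in> A \<Longrightarrow> f \<in> L2 M \<Longrightarrow> f \<in> l2_closure M A"
  unfolding l2_closure_def by (auto intro!: bexI[of _ f] simp: l2_norm_def)

lemma l2_closure_mono_closure:
  assumes "A \<inter> L2 M \<subseteq> l2_closure M B"
  shows "l2_closure M A \<subseteq> l2_closure M B"
proof
  fix f assume f: "f \<in> l2_closure M A"
  show "f \<in> l2_closure M B"
  proof (rule l2_closure_approx)
    show "f \<in> L2 M" using f by (simp add: l2_closure_def)
    show "\<exists>h\<in>l2_closure M B. l2_norm M (\<lambda>x. f x - h x) < e" if "e > 0" for e
      using f that assms unfolding l2_closure_def by blast
  qed
qed

text \<open>p - s lies in the span and is therefore orthogonal to h - p, so Pythagoras applies to h
  - s = (h - p) + (p - s).\<close>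

lemma l2_norm_projection_le:
  assumes "A \<subseteq> L2 M" "h \<in> L2 M" "p \<in> fun_span A" "\<forall>a\<in>A. l2_inner M (\<lambda>x. h x - p x) a = 0"
    "s \<in> fun_span A"
  shows "l2_norm M (\<lambda>x. h x - p x) \<le> l2_norm M (\<lambda>x. h x - s x)"
proof -
  have L: "p \<in> L2 M" "s \<in> L2 M"
    using assms fun_span_L2 by blast+
  have "(\<lambda>x. p x + -1 * s x) \<in> fun_span A"
    by (rule fun_span_add[OF fun_span_cmul]) (use assms in auto)
  then have "l2_inner M (\<lambda>x. h x - p x) (\<lambda>x. p x - s x) = 0"
    using l2_orth_span[of "\<lambda>x. p x - s x" A M "\<lambda>x. h x - p x"] assms L by (auto intro: L2_diff)
  then have "(l2_norm M (\<lambda>x. (h x - p x) + (p x - s x)))\<^sup>2 =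
      (l2_norm M (\<lambda>x. h x - p x))\<^sup>2 + (l2_norm M (\<lambda>x. p x - s x))\<^sup>2"
    by (intro l2_pythagoras L2_diff assms L)
  then have "(l2_norm M (\<lambda>x. h x - p x))\<^sup>2 \<le> (l2_norm M (\<lambda>x. h x - s x))\<^sup>2"
    by simp
  then show ?thesis
    using l2_norm_nonneg power2_le_imp_le by blast
qed

text \<open>Finite-dimensional subspaces are closed: the projection of f is at least as close to f
  as any approximant, hence at distance 0.\<close>

lemma l2_closure_finite_span:
  assumes "finite A" "A \<subseteq> L2 M" "f \<in> l2_closure M X"
    and X: "\<And>x. x \<in> X \<Longrightarrow> x \<in> L2 M \<Longrightarrow> \<exists>F\<in>fun_span A. AE y in M. x y = F y"
  shows "\<exists>F\<in>fun_span A. AE y in M. f y = F y"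
proof -
  have f: "f \<in> L2 M" using assms(3) by (simp add: l2_closure_def)
  obtain p where p: "p \<in> fun_span A" "\<forall>a\<in>A. l2_inner M (\<lambda>x. f x - p x) a = 0"
    using l2_projection[OF assms(1,2) f] by blast
  have pL: "p \<in> L2 M" using p(1) fun_span_L2[OF assms(2)] by auto
  have "l2_norm M (\<lambda>x. f x - p x) \<le> e" if e: "e > 0" for e
  proof -
    obtain x where x: "x \<in> X" "x \<in> L2 M" "l2_norm M (\<lambda>y. f y - x y) < e"
      using assms(3) e unfolding l2_closure_def by blast
    obtain F where F: "F \<in> fun_span A" "AE y in M. x y = F y"
      using X x by blast
    have FL: "F \<in> L2 M" using F(1) fun_span_L2[OF assms(2)] by auto
    have "l2_norm M (\<lambda>x. f x - p x) \<le> l2_norm M (\<lambda>y. f y - F y)"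
      by (rule l2_norm_projection_le[OF assms(2) f p F(1)])
    also have "\<dots> = l2_norm M (\<lambda>y. f y - x y)"
      by (rule l2_norm_cong_AE) (use F(2) L2_diff[OF f FL] L2_diff[OF f x(2)] L2D(1) in auto)
    finally show ?thesis using x(3) by simp
  qed
  then have "l2_norm M (\<lambda>x. f x - p x) \<le> 0"
    by (rule field_le_epsilon[of _ 0, simplified])
  then have "l2_norm M (\<lambda>x. f x - p x) = 0"
    using l2_norm_nonneg[of M "\<lambda>x. f x - p x"] by simp
  then have "AE x in M. f x - p x = 0"
    using l2_norm_zero_iff[OF L2_diff[OF f pL]] by simp
  then show ?thesis using p(1) by (intro bexI[of _ p]) auto
qed

lemma has_vector_derivative_quotient:
  assumes "(f has_vector_derivative d) (at x)"
  shows "((\<lambda>t. (f (x + t) - f x) /\<^sub>R t) \<longlongrightarrow> d) (at 0)"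
proof -
  have "((\<lambda>t. norm (f (x + t) - f x - t *\<^sub>R d) / norm t) \<longlongrightarrow> 0) (at 0)"
    using assms by (simp add: has_vector_derivative_def has_derivative_at)
  then have "((\<lambda>t. (f (x + t) - f x - t *\<^sub>R d) /\<^sub>R t) \<longlongrightarrow> 0) (at 0)"
    by (intro tendsto_norm_zero_cancel[of "\<lambda>t. (f (x + t) - f x - t *\<^sub>R d) /\<^sub>R t"]) (simp add: divide_inverse mult.commute)
  then have "((\<lambda>t. (f (x + t) - f x - t *\<^sub>R d) /\<^sub>R t + d) \<longlongrightarrow> 0 + d) (at 0)"
    by (intro tendsto_add tendsto_const)
  moreover have "(f (x + t) - f x - t *\<^sub>R d) /\<^sub>R t + d = (f (x + t) - f x) /\<^sub>R t" if "t \<noteq> 0" for t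
    using that by (simp add: scaleR_diff_right)
  ultimately show ?thesis
    by (subst LIM_equal[where g = "\<lambda>t. (f (x + t) - f x - t *\<^sub>R d) /\<^sub>R t + d"]) auto
qed

section \<open>Integration against Haar measure\<close>

locale haar_SO3 =
  fixes \<mu> :: "(real^3^3) measure"
  assumes haar: "normalized_haar \<mu>"
begin

lemma sets_haar: "sets \<mu> = sets (restrict_space borel SO3)"
  using haar by (simp add: normalized_haar_def)

lemma space_haar [simp]: "space \<mu> = SO3"
  using sets_eq_imp_space_eq[OF sets_haar] by (simp add: space_restrict_space)

sublocale prob_space \<mu>
  by (rule prob_spaceI) (use haar in \<open>simp add: normalized_haar_def\<close>)

lemma borel_measurable_haar: "continuous_on SO3 f \<Longrightarrow> f \<in> borel_measurable \<mu>"
  using borel_measurable_continuous_on_restrict[of SO3 f] measurable_cong_sets[OF sets_haar refl] by blast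

lemma continuous_bounded:
  fixes f :: "real^3^3 \<Rightarrow> complex"
  assumes "continuous_on SO3 f"
  obtains B where "B > 0" "\<And>g. g \<in> SO3 \<Longrightarrow> cmod (f g) \<le> B"
proof -
  have "bounded (f ` SO3)"
    by (intro compact_imp_bounded compact_continuous_image assms compact_SO3)
  then show ?thesis
    using that unfolding bounded_pos by blast
qed

lemma continuous_integrable:
  fixes f :: "real^3^3 \<Rightarrow> complex"
  assumes "continuous_on SO3 f"
  shows "integrable \<mu> f"
proof -
  obtain B where "B > 0" "\<And>g. g \<in> SO3 \<Longrightarrow> cmod (f g) \<le> B"
    using continuous_bounded[OF assms] by blast
  then show ?thesis
    by (intro integrable_const_bound[where B = B] borel_measurable_haar assms AE_I2) auto
qed

lemma continuous_in_L2:
  fixes f :: "real^3^3 \<Rightarrow> complex"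
  assumes "continuous_on SO3 f"
  shows "f \<in> L2 \<mu>"
proof -
  have "integrable \<mu> (\<lambda>x. complex_of_real ((cmod (f x))\<^sup>2))"
    by (intro continuous_integrable continuous_intros assms)
  then show ?thesis
    using borel_measurable_haar[OF assms] integrable_norm by (fastforce simp: L2_def norm_power)
qed

lemma mult_measurable: "g \<in> SO3 \<Longrightarrow> (\<lambda>h. g ** h) \<in> measurable \<mu> \<mu>"
proof -
  assume g: "g \<in> SO3"
  have "(\<lambda>h. g ** h) \<in> measurable \<mu> (restrict_space borel SO3)"
    using g SO3_mult[OF g]
    by (intro measurable_restrict_space2 borel_measurable_haar
        bounded_linear.continuous_on[OF bounded_linear_matrix_mult_left] continuous_on_id) auto
  then show ?thesis
    using measurable_cong_sets[OF refl sets_haar] by blast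
qed

lemma distr_left_mult:
  assumes g: "g \<in> SO3"
  shows "distr \<mu> \<mu> (\<lambda>h. g ** h) = \<mu>"
proof (rule measure_eqI)
  fix A assume "A \<in> sets (distr \<mu> \<mu> (\<lambda>h. g ** h))"
  then have A: "A \<in> sets \<mu>" by simp
  have gi: "matrix_inv g \<in> SO3" using SO3_inv[OF g] .
  have "(\<lambda>h. g ** h) -` A \<inter> SO3 = (\<lambda>h. matrix_inv g ** h) ` A"
  proof (intro equalityI subsetI)
    fix h assume "h \<in> (\<lambda>h. g ** h) -` A \<inter> SO3"
    then show "h \<in> (\<lambda>h. matrix_inv g ** h) ` A"
      by (intro image_eqI[of _ _ "g ** h"]) (auto simp: matrix_mul_assoc SO3_left_inv[OF g])
  next
    fix h assume "h \<in> (\<lambda>h. matrix_inv g ** h) ` A"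
    then obtain a where a: "a \<in> A" "h = matrix_inv g ** a" by blast
    then have "a \<in> SO3" using sets.sets_into_space[OF A] by auto
    then show "h \<in> (\<lambda>h. g ** h) -` A \<inter> SO3"
      using a SO3_mult[OF gi] by (auto simp: matrix_mul_assoc SO3_right_inv[OF g])
  qed
  then show "emeasure (distr \<mu> \<mu> (\<lambda>h. g ** h)) A = emeasure \<mu> A"
    using haar gi A by (simp add: emeasure_distr[OF mult_measurable[OF g] A] normalized_haar_def)
qed simp

lemma integral_left_mult:
  fixes f :: "real^3^3 \<Rightarrow> complex"
  assumes g: "g \<in> SO3" and f: "continuous_on SO3 f"
  shows "(\<integral>h. f (g ** h) \<partial>\<mu>) = (\<integral>h. f h \<partial>\<mu>)"
  using integral_distr[OF mult_measurable[OF g] borel_measurable_haar[OF f]]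
  by (simp add: distr_left_mult[OF g])

lemma continuous_on_transpose: "continuous_on S (\<lambda>g::real^3^3. transpose g)"
  unfolding Finite_Cartesian_Product.transpose_def by (intro continuous_intros)

text \<open>f(k^-1 g) is integrated over both variables. Integrating over g first gives the integral
  of f; integrating over k first gives that of f composed with inversion. Each inner integral uses
  left invariance only.\<close>

lemma integral_inverse:
  fixes f :: "real^3^3 \<Rightarrow> complex"
  assumes f: "continuous_on SO3 f"
  shows "(\<integral>h. f h \<partial>\<mu>) = (\<integral>h. f (transpose h) \<partial>\<mu>)"
proof -
  interpret P: pair_prob_space \<mu> \<mu> by standard
  have tr: "transpose g \<in> SO3" if "g \<in> SO3" for g
    using SO3_inv[OF that] SO3_inv_eq[OF that] by simp
  have id: "(\<lambda>g. g) \<in> borel_measurable \<mu>"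
    by (intro borel_measurable_haar continuous_on_id)
  have mem: "transpose (fst p) ** snd p \<in> SO3" if "p \<in> space (\<mu> \<Otimes>\<^sub>M \<mu>)" for p
  proof -
    have "fst p \<in> SO3" "snd p \<in> SO3"
      using that by (simp_all add: space_pair_measure mem_Times_iff)
    then show ?thesis
      by (rule SO3_mult[OF tr])
  qed
  have "(\<lambda>p. transpose (fst p) ** snd p) \<in> measurable (\<mu> \<Otimes>\<^sub>M \<mu>) (restrict_space borel SO3)"
  proof (rule measurable_restrict_space2)
    show "(\<lambda>p. transpose (fst p) ** snd p) \<in> space (\<mu> \<Otimes>\<^sub>M \<mu>) \<rightarrow> SO3"
      by (rule funcsetI) (rule mem)
    have 1: "(\<lambda>p. fst p) \<in> borel_measurable (\<mu> \<Otimes>\<^sub>M \<mu>)"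
      by (rule measurable_compose[OF measurable_fst id])
    have 2: "(\<lambda>p. snd p) \<in> borel_measurable (\<mu> \<Otimes>\<^sub>M \<mu>)"
      by (rule measurable_compose[OF measurable_snd id])
    show "(\<lambda>p. transpose (fst p) ** snd p) \<in> borel_measurable (\<mu> \<Otimes>\<^sub>M \<mu>)"
      by (rule borel_measurable_continuous_Pair[OF 1 2])
        (unfold matrix_matrix_mult_def Finite_Cartesian_Product.transpose_def, intro continuous_intros)
  qed
  moreover have "f \<in> borel_measurable (restrict_space borel SO3)"
    by (rule borel_measurable_continuous_on_restrict[OF f])
  ultimately have "(\<lambda>p. f (transpose (fst p) ** snd p)) \<in> borel_measurable (\<mu> \<Otimes>\<^sub>M \<mu>)"
    by (rule measurable_compose)
  moreover obtain B where B: "B > 0" "\<And>g. g \<in> SO3 \<Longrightarrow> cmod (f g) \<le> B"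
    using continuous_bounded[OF f] by blast
  ultimately have "integrable (\<mu> \<Otimes>\<^sub>M \<mu>) (\<lambda>p. f (transpose (fst p) ** snd p))"
    using B(2)[OF mem] by (intro P.P.integrable_const_bound[where B = B] AE_I2)
  then have "integrable (\<mu> \<Otimes>\<^sub>M \<mu>) (case_prod (\<lambda>k g. f (transpose k ** g)))"
    by (simp add: case_prod_beta')
  from P.Fubini_integral[OF this]
  have F: "(\<integral>g. (\<integral>k. f (transpose k ** g) \<partial>\<mu>) \<partial>\<mu>) = (\<integral>k. (\<integral>g. f (transpose k ** g) \<partial>\<mu>) \<partial>\<mu>)" .
  have ft: "continuous_on SO3 (\<lambda>k. f (transpose k))"
    using tr by (intro continuous_on_compose2[OF f continuous_on_transpose]) auto
  have "(\<integral>k. f (transpose k ** g) \<partial>\<mu>) = (\<integral>k. f (transpose k) \<partial>\<mu>)" if "g \<in> SO3" for g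
    using integral_left_mult[OF tr[OF that] ft] by (simp add: matrix_transpose_mul transpose_transpose)
  then have "(\<integral>g. (\<integral>k. f (transpose k ** g) \<partial>\<mu>) \<partial>\<mu>) = (\<integral>g. (\<integral>k. f (transpose k) \<partial>\<mu>) \<partial>\<mu>)"
    by - (rule Bochner_Integration.integral_cong[OF refl], simp)
  moreover have "(\<integral>k. (\<integral>g. f (transpose k ** g) \<partial>\<mu>) \<partial>\<mu>) = (\<integral>k. (\<integral>g. f g \<partial>\<mu>) \<partial>\<mu>)"
    by (rule Bochner_Integration.integral_cong[OF refl]) (use integral_left_mult[OF tr f] in simp)
  ultimately have "(\<integral>g. (\<integral>k. f (transpose k) \<partial>\<mu>) \<partial>\<mu>) = (\<integral>k. (\<integral>g. f g \<partial>\<mu>) \<partial>\<mu>)"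
    using F by argo
  then show ?thesis
    using prob_space by simp
qed

text \<open>Inversion turns right translations into left translations.\<close>

lemma integral_right_mult:
  fixes f :: "real^3^3 \<Rightarrow> complex"
  assumes h: "h \<in> SO3" and f: "continuous_on SO3 f"
  shows "(\<integral>g. f (g ** h) \<partial>\<mu>) = (\<integral>g. f g \<partial>\<mu>)"
proof -
  have tr: "transpose g \<in> SO3" if "g \<in> SO3" for g
    using SO3_inv[OF that] SO3_inv_eq[OF that] by simp
  have fh: "continuous_on SO3 (\<lambda>g. f (g ** h))"
    using h by (intro continuous_on_compose2[OF f]
        bounded_linear.continuous_on[OF bounded_linear_matrix_mult_right] continuous_on_id) auto
  have ft: "continuous_on SO3 (\<lambda>k. f (transpose k))"
    using tr by (intro continuous_on_compose2[OF f continuous_on_transpose]) auto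
  have "(\<integral>g. f (g ** h) \<partial>\<mu>) = (\<integral>g. f (transpose (transpose h ** g)) \<partial>\<mu>)"
    using integral_inverse[OF fh] by (simp add: matrix_transpose_mul transpose_transpose)
  also have "\<dots> = (\<integral>g. f (transpose g) \<partial>\<mu>)"
    by (rule integral_left_mult[OF tr[OF h] ft])
  also have "\<dots> = (\<integral>g. f g \<partial>\<mu>)"
    using integral_inverse[OF f] by simp
  finally show ?thesis .
qed

text \<open>Every difference quotient of u along the subgroup has integral 0 by right invariance.
  The mean value inequality bounds the quotients by the supremum of u', so dominated convergence
  passes this to the limit.\<close>

lemma integral_rderiv:
  assumes u: "rderiv j u u'"
  shows "(\<integral>g. u' g \<partial>\<mu>) = 0"
proof -
  obtain B where B: "B > 0" "\<And>g. g \<in> SO3 \<Longrightarrow> cmod (u' g) \<le> B"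
    using continuous_bounded[OF rderivD(2)[OF u]] by blast
  define s where "s n g = complex_of_real (real (Suc n)) * (u (g ** rot j (1 / real (Suc n))) - u g)" for n g
  have shift: "continuous_on SO3 (\<lambda>g. u (g ** rot j t))" for t
    by (intro continuous_on_compose2[OF rderivD(1)[OF u]]
        bounded_linear.continuous_on[OF bounded_linear_matrix_mult_right] continuous_on_id) (auto intro: SO3_mult)
  have sc: "continuous_on SO3 (s n)" for n
    unfolding s_def by (intro continuous_intros shift rderivD(1)[OF u])
  have "(\<lambda>n. \<integral>g. s n g \<partial>\<mu>) \<longlonglongrightarrow> (\<integral>g. u' g \<partial>\<mu>)"
  proof (rule integral_dominated_convergence[where w = "\<lambda>_. B"])
    show "u' \<in> borel_measurable \<mu>" "\<And>n. s n \<in> borel_measurable \<mu>"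
      by (intro borel_measurable_haar rderivD(2)[OF u] sc)+
    show "integrable \<mu> (\<lambda>_. B)" by simp
    show "AE g in \<mu>. (\<lambda>n. s n g) \<longlonglongrightarrow> u' g"
    proof (rule AE_I2)
      fix g assume "g \<in> space \<mu>"
      then have "((\<lambda>t. u (g ** rot j t)) has_vector_derivative u' g) (at 0)"
        using rderivD(3)[OF u] by simp
      then have "((\<lambda>t. (u (g ** rot j (0 + t)) - u (g ** rot j 0)) /\<^sub>R t) \<longlongrightarrow> u' g) (at 0)"
        by (rule has_vector_derivative_quotient)
      moreover have "filterlim (\<lambda>n. 1 / real (Suc n)) (at 0) sequentially"
        unfolding filterlim_at using lim_1_over_n[THEN LIMSEQ_Suc] by auto
      ultimately have "(\<lambda>n. (u (g ** rot j (0 + 1 / real (Suc n))) - u (g ** rot j 0)) /\<^sub>R (1 / real (Suc n))) \<longlonglongrightarrow> u' g"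
        by (rule filterlim_compose)
      then show "(\<lambda>n. s n g) \<longlonglongrightarrow> u' g"
        by (simp add: s_def scaleR_conv_of_real)
    qed
    show "AE g in \<mu>. cmod (s n g) \<le> B" for n
    proof (rule AE_I2)
      fix g assume "g \<in> space \<mu>"
      then have g: "g \<in> SO3" by simp
      define t where "t = 1 / real (Suc n)"
      have "cmod (u (g ** rot j t) - u (g ** rot j 0)) \<le> B * norm (t - 0)"
      proof (rule differentiable_bound[where S = UNIV and f' = "\<lambda>x h. h *\<^sub>R u' (g ** rot j x)"])
        show "((\<lambda>t. u (g ** rot j t)) has_derivative (\<lambda>h. h *\<^sub>R u' (g ** rot j x))) (at x within UNIV)" for x
          using rderiv_at[OF u g] by (simp add: has_vector_derivative_def)
        show "onorm (\<lambda>h. h *\<^sub>R u' (g ** rot j x)) \<le> B" for x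
          using B(2)[OF SO3_mult[OF g rot_in_SO3]] by (intro onorm_le) (simp add: mult.commute[of B] mult_left_mono)
      qed auto
      then have "real (Suc n) * cmod (u (g ** rot j t) - u g) \<le> real (Suc n) * (B * norm t)"
        by (intro mult_left_mono) auto
      also have "\<dots> = B" by (simp add: t_def)
      finally show "cmod (s n g) \<le> B"
        unfolding s_def norm_mult norm_of_real t_def by simp
    qed
  qed
  moreover have "(\<integral>g. s n g \<partial>\<mu>) = 0" for n
    unfolding s_def
    using continuous_integrable[OF shift] continuous_integrable[OF rderivD(1)[OF u]]
      integral_right_mult[OF rot_in_SO3 rderivD(1)[OF u]]
    by simp
  ultimately have "(\<lambda>n. 0) \<longlonglongrightarrow> (\<integral>g. u' g \<partial>\<mu>)"
    by simp
  then show ?thesis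
    by (simp add: LIMSEQ_const_iff)
qed

lemma rderiv_by_parts:
  assumes f: "rderiv j f f'" and h: "rderiv j h h'"
  shows "l2_inner \<mu> f' h = - l2_inner \<mu> f h'"
proof -
  have "l2_inner \<mu> f h' + l2_inner \<mu> f' h = (\<integral>g. f g * cnj (h' g) + f' g * cnj (h g) \<partial>\<mu>)"
    unfolding l2_inner_def
    by (intro Bochner_Integration.integral_add[symmetric] continuous_integrable continuous_intros
        rderivD[OF f] rderivD[OF h])
  also have "\<dots> = 0"
    by (rule integral_rderiv[OF rderiv_mult[OF f rderiv_cnj[OF h]]])
  finally show ?thesis
    by (simp add: add_eq_0_iff)
qed

text \<open>If U met SO(3), finitely many translates of U would cover the compact group, whose total
  mass would then be 0.\<close>

lemma null_open_SO3_empty: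
  assumes U: "open U" and null: "emeasure \<mu> (SO3 \<inter> U) = 0"
  shows "SO3 \<inter> U = {}"
proof (rule ccontr)
  assume "SO3 \<inter> U \<noteq> {}"
  then obtain h where h: "h \<in> SO3" "h \<in> U" by blast
  have meas: "SO3 \<inter> V \<in> sets \<mu>" if "open V" for V
    using that by (auto simp: sets_haar sets_restrict_space)
  define T where "T g = (\<lambda>x. (h ** matrix_inv g) ** x) -` U" for g :: "real^3^3"
  have "open (T g)" for g
    unfolding T_def
    by (rule open_vimage[OF U linear_continuous_on[OF bounded_linear_matrix_mult_left]])
  moreover have "SO3 \<subseteq> (\<Union>g\<in>SO3. T g)"
    using h by (auto simp: T_def SO3_left_inv matrix_mul_assoc[symmetric])
  ultimately obtain C where C: "C \<subseteq> SO3" "finite C" "SO3 \<subseteq> (\<Union>g\<in>C. T g)"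
    using compactE_image[OF compact_SO3] by metis
  have null_T: "emeasure \<mu> (SO3 \<inter> T g) = 0" if "g \<in> SO3" for g
  proof -
    have k: "h ** matrix_inv g \<in> SO3" using that h by (intro SO3_mult SO3_inv)
    have "SO3 \<inter> T g = (\<lambda>x. (h ** matrix_inv g) ** x) -` (SO3 \<inter> U) \<inter> space \<mu>"
      using SO3_mult[OF k] by (auto simp: T_def)
    then have "emeasure \<mu> (SO3 \<inter> T g) = emeasure (distr \<mu> \<mu> (\<lambda>x. (h ** matrix_inv g) ** x)) (SO3 \<inter> U)"
      using emeasure_distr[OF mult_measurable[OF k] meas[OF U]] by simp
    then show ?thesis
      by (simp add: distr_left_mult[OF k] null)
  qed
  have "emeasure \<mu> SO3 \<le> emeasure \<mu> (\<Union>g\<in>C. SO3 \<inter> T g)"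
    using C \<open>\<And>g. open (T g)\<close> by (intro emeasure_mono) (auto intro!: meas)
  also have "\<dots> \<le> (\<Sum>g\<in>C. emeasure \<mu> (SO3 \<inter> T g))"
    using C \<open>\<And>g. open (T g)\<close> by (intro emeasure_subadditive_finite) (auto intro!: meas)
  also have "\<dots> = 0"
    using C null_T by (intro sum.neutral) auto
  finally show False
    using emeasure_space_1 by simp
qed

lemma continuous_AE_zero:
  fixes f :: "real^3^3 \<Rightarrow> complex"
  assumes f: "continuous_on SO3 f" and ae: "AE g in \<mu>. f g = 0" and g: "g \<in> SO3"
  shows "f g = 0"
proof -
  obtain U where U: "open U" "U \<inter> SO3 = f -` (- {0}) \<inter> SO3"
    using continuous_on_open_invariant[THEN iffD1, OF f, rule_format, of "- {0}"] by auto
  have "emeasure \<mu> (SO3 \<inter> U) = 0"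
  proof -
    have "{x \<in> space \<mu>. \<not> f x = 0} = SO3 \<inter> U"
      using U(2) by auto
    moreover have "SO3 \<inter> U \<in> sets \<mu>"
      using U(1) by (auto simp: sets_haar sets_restrict_space)
    ultimately show ?thesis
      using ae AE_iff_measurable[of "SO3 \<inter> U" \<mu> "\<lambda>x. f x = 0"] by simp
  qed
  then have "SO3 \<inter> U = {}"
    by (rule null_open_SO3_empty[OF U(1)])
  then show ?thesis
    using U(2) g by auto
qed

end

section \<open>Peter--Weyl blocks\<close>

text \<open>Matrix coefficients in which the vectors range over X and the functionals are the
  evaluations at points (z0, z1).\<close>

definition blk_gen :: "bipoly set \<Rightarrow> (real^3^3 \<Rightarrow> complex) set" where
  "blk_gen X = {\<lambda>g. act g p z0 z1 | p z0 z1. p \<in> X}"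

lemma blk_gen_span_eq:
  assumes "X \<subseteq> Sym n"
  shows "fun_span (blk_gen X) = fun_span ((\<lambda>(p, i) g. act g p 1 (of_nat i)) ` (X \<times> {..n}))"
proof
  show "fun_span (blk_gen X) \<subseteq> fun_span ((\<lambda>(p, i) g. act g p 1 (of_nat i)) ` (X \<times> {..n}))"
  proof (rule fun_span_subset, rule subsetI)
    fix f assume "f \<in> blk_gen X"
    then obtain p z0 z1 where f: "f = (\<lambda>g. act g p z0 z1)" "p \<in> X"
      by (auto simp: blk_gen_def)
    have "f = (\<lambda>g. \<Sum>i\<le>n. lagr n i z0 z1 * act g p 1 (of_nat i))"
      unfolding f using act_interpolation[of p n] f(2) assms by blast
    also have "\<dots> \<in> fun_span ((\<lambda>(p, i) g. act g p 1 (of_nat i)) ` (X \<times> {..n}))"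
      using f(2) by (intro fun_span_sum fun_span_cmul fun_span_base) force
    finally show "f \<in> fun_span ((\<lambda>(p, i) g. act g p 1 (of_nat i)) ` (X \<times> {..n}))" .
  qed
  show "fun_span ((\<lambda>(p, i) g. act g p 1 (of_nat i)) ` (X \<times> {..n})) \<subseteq> fun_span (blk_gen X)"
    by (rule fun_span_mono) (auto simp: blk_gen_def)
qed

lemma act_bform_mono2: "act g (bform n a) z0 z1 = (\<Sum>k\<le>n. a k * act g (mono2 n k) z0 z1)"
  unfolding act_def by (rule fun_cong[OF fun_cong[OF sub_bform]])

definition blk :: "nat \<Rightarrow> (real^3^3 \<Rightarrow> complex) set" where
  "blk l = fun_span (blk_gen (Sym (2 * l)))"

definition line_blk :: "bipoly \<Rightarrow> (real^3^3 \<Rightarrow> complex) set" where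
  "line_blk p = fun_span (blk_gen {p})"

definition line_basis :: "nat \<Rightarrow> bipoly \<Rightarrow> (real^3^3 \<Rightarrow> complex) set" where
  "line_basis n p = (\<lambda>i g. act g p 1 (of_nat i)) ` {..n}"

definition blk_basis :: "nat \<Rightarrow> (real^3^3 \<Rightarrow> complex) set" where
  "blk_basis l = (\<Union>k\<le>2*l. line_basis (2 * l) (mono2 (2 * l) k))"

lemma finite_line_basis: "finite (line_basis n p)"
  by (simp add: line_basis_def)

lemma finite_blk_basis: "finite (blk_basis l)"
  by (simp add: blk_basis_def finite_line_basis)

lemma line_blk_eq: "p \<in> Sym n \<Longrightarrow> line_blk p = fun_span (line_basis n p)"
  unfolding line_blk_def by (subst blk_gen_span_eq[of _ n]) (auto simp: line_basis_def intro!: arg_cong[where f = fun_span])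

lemma blk_eq: "blk l = fun_span (blk_basis l)"
proof
  show "blk l \<subseteq> fun_span (blk_basis l)"
    unfolding blk_def blk_gen_span_eq[OF subset_refl]
  proof (rule fun_span_subset, rule subsetI)
    fix f assume "f \<in> (\<lambda>(p, i) g. act g p 1 (of_nat i)) ` (Sym (2 * l) \<times> {..2 * l})"
    then obtain a i where f: "f = (\<lambda>g. act g (bform (2 * l) a) 1 (of_nat i))" "i \<le> 2 * l"
      by (auto simp: Sym_eq)
    show "f \<in> fun_span (blk_basis l)"
      unfolding f act_bform_mono2 using f(2)
      by (intro fun_span_sum fun_span_cmul fun_span_base) (auto simp: blk_basis_def line_basis_def)
  qed
  show "fun_span (blk_basis l) \<subseteq> blk l"
    unfolding blk_def
    by (rule fun_span_mono) (auto simp: blk_basis_def line_basis_def blk_gen_def intro!: mono2_in_Sym)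
qed

lemma line_blk_subset_blk: "p \<in> Sym (2 * l) \<Longrightarrow> line_blk p \<subseteq> blk l"
  unfolding blk_def line_blk_def by (rule fun_span_mono) (auto simp: blk_gen_def)

text \<open>Terms with the same evaluation point are collected, leaving one form per node. This
  tuple of forms is the tensor behind F, and R_x acts on it form by form.\<close>

lemma blk_repr:
  assumes "F \<in> blk l"
  obtains q where "\<And>i. q i \<in> Sym (2 * l)" "F = (\<lambda>g. \<Sum>i\<le>2*l. act g (q i) 1 (of_nat i))"
proof -
  have "\<exists>q. (\<forall>i. q i \<in> Sym (2 * l)) \<and> F = (\<lambda>g. \<Sum>i\<le>2*l. act g (q i) 1 (of_nat i))"
    using assms unfolding blk_def blk_gen_span_eq[OF subset_refl]
  proof (induction rule: fun_span_induct)
    case zero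
    show ?case
      by (intro exI[of _ "\<lambda>i z0 z1. 0"]) (simp add: Sym_zero act_def sub_def)
  next
    case (step F f c)
    then obtain q p m where q: "\<And>i. q i \<in> Sym (2 * l)" "F = (\<lambda>g. \<Sum>i\<le>2*l. act g (q i) 1 (of_nat i))"
      and p: "f = (\<lambda>g. act g p 1 (of_nat m))" "p \<in> Sym (2 * l)" "m \<le> 2 * l"
      by auto
    let ?r = "\<lambda>i z0 z1. q i z0 z1 + (if i = m then c else 0) * p z0 z1"
    have "?r i \<in> Sym (2 * l)" for i
      by (intro Sym_add Sym_cmul q p)
    moreover have "(\<Sum>i\<le>2*l. act g (?r i) 1 (of_nat i)) = F g + c * f g" for g
      unfolding act_add act_cmul sum.distrib q(2) p(1)
      using p(3) by (simp add: if_distrib[of "\<lambda>c. c * _"] cong: if_cong)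
    ultimately show ?case
      by (intro exI[of _ ?r]) auto
  qed
  then show ?thesis using that by blast
qed

lemma line_blk_reprI: "(\<lambda>g. \<Sum>i\<le>n. act g (\<lambda>z0 z1. c i * p z0 z1) 1 (of_nat i)) \<in> line_blk p"
  unfolding act_cmul line_blk_def
  by (intro fun_span_sum fun_span_cmul fun_span_base) (auto simp: blk_gen_def)

lemma sym_raise_dE: "sym_raise p z0 z1 = dE 1 p z0 z1 + \<i> * dE 2 p z0 z1"
  and sym_lower_dE: "sym_lower p z0 z1 = - dE 1 p z0 z1 + \<i> * dE 2 p z0 z1"
  and sym_weight_dE: "sym_weight p z0 z1 = 2 * \<i> * dE 3 p z0 z1"
  by (simp_all add: dE_def field_simps)

lemma vanishing_dE:
  assumes r: "\<And>i. r i \<in> Sym (2 * l)" and v: "\<And>g. g \<in> SO3 \<Longrightarrow> (\<Sum>i\<le>n. act g (r i) 1 (of_nat i)) = 0"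
    and g: "g \<in> SO3"
  shows "(\<Sum>i\<le>n. act g (dE j (r i)) 1 (of_nat i)) = 0"
proof -
  have 1: "rderiv j (\<lambda>g. \<Sum>i\<le>n. act g (r i) 1 (of_nat i)) (\<lambda>g. \<Sum>i\<le>n. act g (dE j (r i)) 1 (of_nat i))"
    by (intro rderiv_sum rderiv_act[where l = l] r)
  have 2: "rderiv j (\<lambda>g. \<Sum>i\<le>n. act g (r i) 1 (of_nat i)) (\<lambda>g. 0)"
    by (rule rderiv_cong[OF rderiv_zero]) (simp_all add: v)
  show ?thesis
    by (rule rderiv_unique[OF 1 2 g])
qed

lemma vanishing_raise_lower:
  assumes r: "\<And>i. r i \<in> Sym (2 * l)" and v: "\<And>g. g \<in> SO3 \<Longrightarrow> (\<Sum>i\<le>n. act g (r i) 1 (of_nat i)) = 0"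
    and g: "g \<in> SO3"
  shows "(\<Sum>i\<le>n. act g (sym_raise (r i)) 1 (of_nat i)) = 0" "(\<Sum>i\<le>n. act g (sym_lower (r i)) 1 (of_nat i)) = 0"
proof -
  have e: "sym_raise p = (\<lambda>z0 z1. dE 1 p z0 z1 + \<i> * dE 2 p z0 z1)"
    "sym_lower p = (\<lambda>z0 z1. -1 * dE 1 p z0 z1 + \<i> * dE 2 p z0 z1)" for p
    by (simp_all add: fun_eq_iff sym_raise_dE sym_lower_dE)
  show "(\<Sum>i\<le>n. act g (sym_raise (r i)) 1 (of_nat i)) = 0" "(\<Sum>i\<le>n. act g (sym_lower (r i)) 1 (of_nat i)) = 0"
    unfolding e act_add act_cmul sum.distrib sum_distrib_left[symmetric]
    using vanishing_dE[OF r v g, of 1] vanishing_dE[OF r v g, of 2] by simp_all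
qed

text \<open>Repeated lowering carries the identity from z0^n to every monomial. At g = 1 it then
  says that the sum of c_i p(1, i) is 0 for every form p, and the Lagrange forms isolate each
  c_k.\<close>

lemma vanishing_highest_weight:
  fixes l defines "n \<equiv> 2 * l"
  assumes v: "\<And>g. g \<in> SO3 \<Longrightarrow> (\<Sum>i\<le>n. act g (\<lambda>z0 z1. c i * mono2 n 0 z0 z1) 1 (of_nat i)) = 0"
    and "k \<le> n"
  shows "c k = 0"
proof -
  have V: "\<forall>g\<in>SO3. (\<Sum>i\<le>n. act g (\<lambda>z0 z1. c i * mono2 n j z0 z1) 1 (of_nat i)) = 0" if "j \<le> n" for j
    using that
  proof (induction j)
    case 0
    then show ?case using v by simp
  next
    case (Suc j)
    have in_Sym: "(\<lambda>z0 z1. c i * mono2 n j z0 z1) \<in> Sym (2 * l)" for i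
      using Suc.prems by (intro Sym_cmul) (simp add: n_def mono2_in_Sym)
    have low: "sym_lower (\<lambda>z0 z1. c i * mono2 n j z0 z1) = (\<lambda>z0 z1. of_nat (n - j) * (c i * mono2 n (Suc j) z0 z1))" for i
    proof -
      have j: "j \<le> n" using Suc.prems by simp
      have z: "sym_lower (\<lambda>z0 z1. 0) = (\<lambda>z0 z1. 0)"
        by (simp add: sym_lower_def d0_def fun_eq_iff)
      show ?thesis
        using sym_ops_linear(2)[OF Sym_zero mono2_in_Sym[OF j], of "c i"]
        unfolding z sym_ops_mono2(2)[OF j] by (simp add: mult.left_commute)
    qed
    have "\<forall>g\<in>SO3. of_nat (n - j) * (\<Sum>i\<le>n. act g (\<lambda>z0 z1. c i * mono2 n (Suc j) z0 z1) 1 (of_nat i)) = 0"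
      using vanishing_raise_lower(2)[OF in_Sym, where n = n] Suc
      unfolding low act_cmul[of _ "of_nat (n - j)"] sum_distrib_left by simp
    then show ?case using Suc.prems by simp
  qed
  have "(\<Sum>i\<le>n. c i * p 1 (of_nat i)) = 0" if "p \<in> Sym n" for p
  proof -
    obtain a where a: "p = bform n a" using \<open>p \<in> Sym n\<close> by (auto simp: Sym_eq)
    have "(\<Sum>i\<le>n. c i * mono2 n j 1 (of_nat i)) = 0" if "j \<le> n" for j
    proof -
      have "act (Finite_Cartesian_Product.mat 1) (\<lambda>z0 z1. c i * mono2 n j z0 z1) = (\<lambda>z0 z1. c i * mono2 n j z0 z1)" for i
        using that by (intro act_one[of _ l] Sym_cmul) (simp add: n_def mono2_in_Sym)
      then show ?thesis
        using V[OF that, rule_format, OF SO3_one] by simp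
    qed
    then have "(\<Sum>j\<le>n. a j * (\<Sum>i\<le>n. c i * mono2 n j 1 (of_nat i))) = 0"
      by simp
    then show ?thesis
      unfolding a bform_def sum_distrib_left by (subst sum.swap) (simp add: mult_ac)
  qed
  from this[OF lagr_in_Sym[OF \<open>k \<le> n\<close>]] show ?thesis
    using \<open>k \<le> n\<close> by (simp add: lagr_delta if_distrib[of "\<lambda>x. _ * x"] cong: if_cong)
qed

lemma bform_delta_0: "bform n (\<lambda>k. if k = 0 then c else 0) = (\<lambda>z0 z1. c * mono2 n 0 z0 z1)"
  by (simp add: bform_def fun_eq_iff if_distrib[of "\<lambda>x. x * _"] cong: if_cong)

text \<open>Injectivity of the map from tensors to functions. The induction is on a bound d for the
  indices of non-zero coefficients: raising decreases d by one and kills only the multiples of z0^n,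
  which are the highest-weight case.\<close>

lemma vanishing_imp_zero:
  fixes l defines "n \<equiv> 2 * l"
  assumes v: "\<And>g. g \<in> SO3 \<Longrightarrow> (\<Sum>i\<le>n. act g (r i) 1 (of_nat i)) = 0"
    and r: "\<And>i. r i \<in> Sym n" and "i \<le> n"
  shows "r i = (\<lambda>z0 z1. 0)"
proof -
  have main: "\<forall>i\<le>n. \<forall>k\<le>n. a i k = 0"
    if "d \<le> n" "\<And>i k. k > d \<Longrightarrow> a i k = 0"
       "\<forall>g\<in>SO3. (\<Sum>i\<le>n. act g (bform n (a i)) 1 (of_nat i)) = 0" for d a
    using that
  proof (induction d arbitrary: a)
    case 0
    have "bform n (a i) = (\<lambda>z0 z1. a i 0 * mono2 n 0 z0 z1)" for i
    proof -
      have "bform n (a i) = bform n (\<lambda>k. if k = 0 then a i 0 else 0)"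
        unfolding bform_eq_iff using 0(2) by simp
      then show ?thesis
        by (simp only: bform_delta_0)
    qed
    then have "a i 0 = 0" if "i \<le> n" for i
      using vanishing_highest_weight[where l = l and c = "\<lambda>i. a i 0" and k = i] 0(3) that by (simp add: n_def)
    then show ?case
      using 0(2) by (metis neq0_conv)
  next
    case (Suc d)
    define b where "b i k = (if k < n then a i (Suc k) * of_nat (Suc k) else 0)" for i k
    have raise: "sym_raise (bform n (a i)) = bform n (b i)" for i
    proof (intro ext)
      fix z0 z1
      have "(\<Sum>k\<le>n. a i k * of_nat k * mono2 n (k - 1) z0 z1) = (\<Sum>k<n. a i (Suc k) * of_nat (Suc k) * mono2 n k z0 z1)"
        by (subst sum.atMost_shift) simp
      also have "\<dots> = (\<Sum>k\<le>n. b i k * mono2 n k z0 z1)"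
        by (simp add: b_def lessThan_Suc_atMost[symmetric])
      finally show "sym_raise (bform n (a i)) z0 z1 = bform n (b i) z0 z1"
        by (subst sym_raise_bform) (simp only: bform_def)
    qed
    have "\<forall>i\<le>n. \<forall>k\<le>n. b i k = 0"
    proof (rule Suc.IH)
      show "d \<le> n" using Suc.prems by simp
      show "b i k = 0" if "k > d" for i k
        using Suc.prems(2)[of "Suc k" i] that by (simp add: b_def)
      show "\<forall>g\<in>SO3. (\<Sum>i\<le>n. act g (bform n (b i)) 1 (of_nat i)) = 0"
      proof
        fix g assume g: "g \<in> SO3"
        have "(\<Sum>i\<le>n. act g (sym_raise (bform n (a i))) 1 (of_nat i)) = 0"
          by (rule vanishing_raise_lower(1)[where l = l]) (use Suc.prems(3) g in \<open>auto simp: n_def Sym_eq\<close>)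
        then show "(\<Sum>i\<le>n. act g (bform n (b i)) 1 (of_nat i)) = 0"
          by (simp only: raise)
      qed
    qed
    then have 1: "a i (Suc k) = 0" if "i \<le> n" "k < n" for i k
    proof -
      have "b i k = 0" using \<open>\<forall>i\<le>n. \<forall>k\<le>n. b i k = 0\<close> that by simp
      then show ?thesis using that by (simp add: b_def del: of_nat_Suc)
    qed
    \<comment> \<open>The raised forms vanish, so only the coefficient of z0^n is left.\<close>
    have "a i k = (if k = 0 then a i 0 else 0)" if "i \<le> n" "k \<le> n" for i k
      using 1[of i "k - 1"] that by (cases k) auto
    then have "bform n (a i) = (\<lambda>z0 z1. a i 0 * mono2 n 0 z0 z1)" if "i \<le> n" for i
    proof -
      have "bform n (a i) = bform n (\<lambda>k. if k = 0 then a i 0 else 0)"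
        unfolding bform_eq_iff using \<open>\<And>i k. i \<le> n \<Longrightarrow> k \<le> n \<Longrightarrow> a i k = (if k = 0 then a i 0 else 0)\<close> that by blast
      then show ?thesis
        by (simp only: bform_delta_0)
    qed
    then have "a i 0 = 0" if "i \<le> n" for i
      using vanishing_highest_weight[where l = l and c = "\<lambda>i. a i 0" and k = i] Suc.prems(3) that by (simp add: n_def)
    then show ?case
    proof (intro allI impI)
      fix i k assume "\<And>i. i \<le> n \<Longrightarrow> a i 0 = 0" "i \<le> n" "k \<le> n"
      then show "a i k = 0"
        using 1[of i "k - 1"] by (cases k) auto
    qed
  qed
  have "\<exists>a. r i = bform n a \<and> (\<forall>k>n. a k = 0)" for i
  proof -
    obtain a where "r i = bform n a" using r[of i] by (auto simp: Sym_eq)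
    \<comment> \<open>Coefficients beyond n do not affect the form; setting them to 0 meets the
      bound of \<open>main\<close> with d = n.\<close>
    then show ?thesis
      by (intro exI[of _ "\<lambda>k. if k \<le> n then a k else 0"]) (auto simp: bform_def)
  qed
  then obtain a where a: "\<And>i. r i = bform n (a i)" "\<And>i k. k > n \<Longrightarrow> a i k = 0"
    by metis
  then have "\<forall>i\<le>n. \<forall>k\<le>n. a i k = 0"
    using main[of n a] v by simp
  then show ?thesis
    using \<open>i \<le> n\<close> by (simp add: a(1) bform_def)
qed

section \<open>Polynomials on the group as sums of matrix coefficients\<close>

definition wlift :: "real^3^3 \<Rightarrow> complex^2^2" where
  "wlift g = (SOME U. lift g U)"

lemma lift_wlift: "g \<in> SO3 \<Longrightarrow> lift g (wlift g)"
  unfolding wlift_def using ex_lift someI_ex by metis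

lemma act_wlift: "act g = sub (wlift g)"
  by (simp add: act_def wlift_def)

text \<open>Monomials in the entries of the chosen lift. Those of even degree do not depend on its
  sign.\<close>

definition umon :: "nat \<Rightarrow> nat \<Rightarrow> nat \<Rightarrow> nat \<Rightarrow> real^3^3 \<Rightarrow> complex" where
  "umon a b c d g = wlift g $ 1 $ 1 ^ a * wlift g $ 1 $ 2 ^ b * wlift g $ 2 $ 1 ^ c * wlift g $ 2 $ 2 ^ d"

lemma umon_mult: "umon a b c d g * umon a' b' c' d' g = umon (a + a') (b + b') (c + c') (d + d') g"
  by (simp add: umon_def power_add mult_ac)

text \<open>The determinant relation ad = 1 + bc trades a diagonal pair for an antidiagonal one, at
  the price of a monomial of degree two less.\<close>

lemma umon_straighten:
  assumes "g \<in> SO3"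
  shows "umon (Suc a) b c (Suc d) g = umon a b c d g + umon a (Suc b) (Suc c) d g"
proof -
  have "wlift g $ 1 $ 1 * wlift g $ 2 $ 2 = 1 + wlift g $ 1 $ 2 * wlift g $ 2 $ 1"
    using lift_wlift[OF assms] by (simp add: lift_def det_2 algebra_simps)
  then have "umon a b c d g * (wlift g $ 1 $ 1 * wlift g $ 2 $ 2) = umon a b c d g * (1 + wlift g $ 1 $ 2 * wlift g $ 2 $ 1)"
    by simp
  then show ?thesis
    by (simp add: umon_def algebra_simps)
qed

text \<open>The determinant relation and the action identities hold on SO(3) only, so membership in
  a span is taken up to values off the group.\<close>

definition span_on_SO3 :: "(real^3^3 \<Rightarrow> complex) set \<Rightarrow> (real^3^3 \<Rightarrow> complex) set" where
  "span_on_SO3 A = {f. \<exists>F\<in>fun_span A. \<forall>g\<in>SO3. f g = F g}"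

lemma span_on_SO3_cong: "f \<in> span_on_SO3 A \<Longrightarrow> (\<And>g. g \<in> SO3 \<Longrightarrow> f g = h g) \<Longrightarrow> h \<in> span_on_SO3 A"
  unfolding span_on_SO3_def by auto

lemma span_on_SO3_base: "f \<in> A \<Longrightarrow> f \<in> span_on_SO3 A"
  unfolding span_on_SO3_def using fun_span_base by blast

lemma span_on_SO3_add: "f \<in> span_on_SO3 A \<Longrightarrow> h \<in> span_on_SO3 A \<Longrightarrow> (\<lambda>g. f g + h g) \<in> span_on_SO3 A"
proof -
  assume "f \<in> span_on_SO3 A" "h \<in> span_on_SO3 A"
  then obtain F H where "F \<in> fun_span A" "H \<in> fun_span A" "\<forall>g\<in>SO3. f g = F g" "\<forall>g\<in>SO3. h g = H g"
    unfolding span_on_SO3_def by auto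
  then show ?thesis
    unfolding span_on_SO3_def by (intro CollectI bexI[OF _ fun_span_add[of H A F]]) auto
qed

lemma span_on_SO3_cmul: "f \<in> span_on_SO3 A \<Longrightarrow> (\<lambda>g. c * f g) \<in> span_on_SO3 A"
proof -
  assume "f \<in> span_on_SO3 A"
  then obtain F where "F \<in> fun_span A" "\<forall>g\<in>SO3. f g = F g"
    unfolding span_on_SO3_def by auto
  then show ?thesis
    unfolding span_on_SO3_def by (intro CollectI bexI[OF _ fun_span_cmul[of F A c]]) auto
qed

lemma span_on_SO3_diff: "f \<in> span_on_SO3 A \<Longrightarrow> h \<in> span_on_SO3 A \<Longrightarrow> (\<lambda>g. f g - h g) \<in> span_on_SO3 A"
  using span_on_SO3_add[OF _ span_on_SO3_cmul[of h A "-1"], of f] by simp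

lemma span_on_SO3_zero: "(\<lambda>g. 0) \<in> span_on_SO3 A"
  unfolding span_on_SO3_def by (intro CollectI bexI[OF _ fun_span_zero]) simp

lemma span_on_SO3_sum:
  "(\<And>i. i \<in> I \<Longrightarrow> f i \<in> span_on_SO3 A) \<Longrightarrow> (\<lambda>g. \<Sum>i\<in>I. f i g) \<in> span_on_SO3 A"
  by (induction I rule: infinite_finite_induct) (auto intro: span_on_SO3_zero span_on_SO3_add)

lemma span_on_SO3_trans:
  assumes "f \<in> span_on_SO3 A" "\<And>a. a \<in> A \<Longrightarrow> a \<in> span_on_SO3 B"
  shows "f \<in> span_on_SO3 B"
proof -
  obtain F where F: "F \<in> fun_span A" "\<And>g. g \<in> SO3 \<Longrightarrow> f g = F g"
    using assms(1) unfolding span_on_SO3_def by blast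
  have "F \<in> span_on_SO3 B"
    using F(1)
  proof (induction rule: fun_span_induct)
    case zero
    show ?case by (rule span_on_SO3_zero)
  next
    case (step F a c)
    then show ?case
      using span_on_SO3_add[OF _ span_on_SO3_cmul[OF assms(2)]] by blast
  qed
  then show ?thesis
    by (rule span_on_SO3_cong) (simp add: F(2))
qed

definition matrix_coeffs :: "(real^3^3 \<Rightarrow> complex) set" where
  "matrix_coeffs = {\<lambda>g. act g p z0 z1 | p z0 z1 l. p \<in> Sym (2 * l)}"

lemma binomial_bform:
  "(z0 * A + z1 * C) ^ s * (z0 * B + z1 * D) ^ t =
    (\<Sum>i\<le>s. \<Sum>j\<le>t. (of_nat (s choose i) * of_nat (t choose j) * (A ^ i * C ^ (s - i) * B ^ j * D ^ (t - j))) *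
      mono2 (s + t) (s + t - i - j) z0 z1)" for z0 z1 A B C D :: complex
proof -
  have "mono2 (s + t) (s + t - i - j) z0 z1 = z0 ^ i * z1 ^ (s - i) * (z0 ^ j * z1 ^ (t - j))"
    if "i \<le> s" "j \<le> t" for i j
  proof -
    have "s + t - (s + t - i - j) = i + j" "s + t - i - j = (s - i) + (t - j)"
      using that by auto
    then show ?thesis
      unfolding mono2_def by (simp only: power_add) (simp add: mult_ac)
  qed
  then show ?thesis
    unfolding binomial_ring sum_product
    by (intro sum.cong refl) (simp add: power_mult_distrib mult_ac)
qed

text \<open>Extraction of a coefficient is a combination of evaluations at the nodes: \<kappa> i is
  the k-th coefficient of the i-th Lagrange form.\<close>

lemma coefficient_functional:
  obtains \<kappa> :: "nat \<Rightarrow> complex" where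
    "\<And>m. m \<le> n \<Longrightarrow> (\<Sum>i\<le>n. \<kappa> i * mono2 n m 1 (of_nat i)) = (if m = k then 1 else 0)"
proof -
  have "\<forall>i. \<exists>a. i \<le> n \<longrightarrow> lagr n i = bform n a"
    using lagr_in_Sym by (auto simp: Sym_eq)
  then obtain a where a: "\<And>i. i \<le> n \<Longrightarrow> lagr n i = bform n (a i)"
    using choice[of "\<lambda>i a. i \<le> n \<longrightarrow> lagr n i = bform n a"] by blast
  have "(\<Sum>i\<le>n. a i k * mono2 n m 1 (of_nat i)) = (if m = k then 1 else 0)" if m: "m \<le> n" "k \<le> n" for m
  proof -
    have "bform n (\<lambda>j. if j = m then 1 else 0) = mono2 n m"
      using m by (simp add: bform_def fun_eq_iff if_distrib[of "\<lambda>c. c * _"] cong: if_cong)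
    also have "\<dots> = (\<lambda>z0 z1. \<Sum>i\<le>n. mono2 n m 1 (of_nat i) * lagr n i z0 z1)"
      using lagrange_interpolation[OF mono2_in_Sym[OF m(1)]] by blast
    also have "\<dots> = bform n (\<lambda>j. \<Sum>i\<le>n. mono2 n m 1 (of_nat i) * a i j)"
    proof (intro ext)
      fix z0 z1
      have "(\<Sum>i\<le>n. mono2 n m 1 (of_nat i) * lagr n i z0 z1) =
          (\<Sum>i\<le>n. \<Sum>k\<le>n. mono2 n m 1 (of_nat i) * a i k * mono2 n k z0 z1)"
        by (simp add: a bform_def sum_distrib_left mult.assoc)
      also have "\<dots> = (\<Sum>k\<le>n. \<Sum>i\<le>n. mono2 n m 1 (of_nat i) * a i k * mono2 n k z0 z1)"
        by (rule sum.swap)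
      finally show "(\<Sum>i\<le>n. mono2 n m 1 (of_nat i) * lagr n i z0 z1) =
          bform n (\<lambda>j. \<Sum>i\<le>n. mono2 n m 1 (of_nat i) * a i j) z0 z1"
        by (simp add: bform_def sum_distrib_right)
    qed
    finally have "(if k = m then 1 else 0) = (\<Sum>i\<le>n. mono2 n m 1 (of_nat i) * a i k)"
      unfolding bform_eq_iff using m(2) by blast
    then show ?thesis
      by (auto simp: mult.commute split: if_splits)
  qed
  \<comment> \<open>For k > n no m \<le> n equals k, and the zero functional serves.\<close>
  then show ?thesis
    using that[of "\<lambda>i. if k \<le> n then a i k else 0"] by (cases "k \<le> n") auto
qed

text \<open>By straightening, monomials with the same row and column degrees differ by monomials of
  lower degree, so modulo the induction hypothesis they are all equal. One coefficient of g.(z0^s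
  z1^t) is a combination of exactly these monomials with positive integer weights; dividing by the
  sum of the weights expresses each of them.\<close>

lemma umon_in_span:
  "a + b + c + d = 2 * l \<Longrightarrow> umon a b c d \<in> span_on_SO3 matrix_coeffs"
proof (induction l arbitrary: a b c d rule: less_induct)
  case (less l)
  define r s t where "r = a + b" and "s = a + c" and "t = b + d"
  have st: "s + t = 2 * l" using less.prems by (simp add: s_def t_def)
  \<comment> \<open>With r the degree in the first row of the lift and s, t those in its columns, a
    monomial is fixed by its first exponent i; \<open>valid i\<close> says that no subtraction is
    truncated.\<close>
  define v where "v i = umon i (r - i) (s - i) (t + i - r)" for i
  define valid where "valid i \<longleftrightarrow> i \<le> s \<and> i \<le> r \<and> r \<le> t + i" for i
  have va: "valid a" and v_a: "v a = umon a b c d"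
    by (auto simp: valid_def v_def r_def s_def t_def)
  have step: "(\<lambda>g. v (Suc i) g - v i g) \<in> span_on_SO3 matrix_coeffs" if "valid i" "valid (Suc i)" for i
  proof -
    have vi: "v i = umon i (Suc (r - Suc i)) (Suc (s - Suc i)) (t + i - r)"
      "v (Suc i) = umon (Suc i) (r - Suc i) (s - Suc i) (Suc (t + i - r))"
      using that by (auto simp: v_def valid_def Suc_diff_Suc Suc_diff_le)
    have l: "l > 0" using that st by (auto simp: valid_def)
    have "i + (r - Suc i) + (s - Suc i) + (t + i - r) = 2 * (l - 1)"
      using that st l by (auto simp: valid_def)
    then have "umon i (r - Suc i) (s - Suc i) (t + i - r) \<in> span_on_SO3 matrix_coeffs"
      using less.IH[of "l - 1"] l by simp
    then show ?thesis
      by (rule span_on_SO3_cong) (simp add: vi umon_straighten)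
  qed
  have up: "(\<lambda>g. v j g - v i g) \<in> span_on_SO3 matrix_coeffs" if "i \<le> j" "valid i" "valid j" for i j
    using that
  proof (induction j rule: dec_induct)
    case base
    then show ?case using span_on_SO3_zero by simp
  next
    case (step j)
    have "valid j" using step by (auto simp: valid_def)
    then have "(\<lambda>g. (v j g - v i g) + (v (Suc j) g - v j g)) \<in> span_on_SO3 matrix_coeffs"
      using step \<open>\<And>i. valid i \<Longrightarrow> valid (Suc i) \<Longrightarrow> (\<lambda>g. v (Suc i) g - v i g) \<in> span_on_SO3 matrix_coeffs\<close>
      by (intro span_on_SO3_add) auto
    then show ?case by simp
  qed
  have diff: "(\<lambda>g. v i g - v a g) \<in> span_on_SO3 matrix_coeffs" if "valid i" for i
  proof (cases "a \<le> i")
    case True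
    then show ?thesis using up va that by blast
  next
    case False
    then have "(\<lambda>g. -1 * (v a g - v i g)) \<in> span_on_SO3 matrix_coeffs"
      using up va that by (intro span_on_SO3_cmul) auto
    then show ?thesis by simp
  qed
  \<comment> \<open>The weight that the binomial theorem gives to \<open>v i\<close> in the
    coefficient of z0^r z1^(s + t - r) in g.(z0^s z1^t).\<close>
  define w where "w i = (s choose i) * (t choose (r - i))" for i
  define I where "I = {i. valid i}"
  have fI: "finite I" by (rule finite_subset[of _ "{..s}"]) (auto simp: I_def valid_def)
  have aI: "a \<in> I" using va by (simp add: I_def)
  have "w a > 0"
    using va by (auto simp: w_def valid_def)
  then have W: "(\<Sum>i\<in>I. w i) > 0"
    using fI aI by (intro sum_pos2[of I a w]) auto
  have T: "(\<lambda>g. \<Sum>i\<in>I. of_nat (w i) * v i g) \<in> span_on_SO3 matrix_coeffs"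
  proof -
    obtain \<kappa> :: "nat \<Rightarrow> complex" where \<kappa>: "\<And>m. m \<le> s + t \<Longrightarrow>
        (\<Sum>i\<le>s+t. \<kappa> i * mono2 (s + t) m 1 (of_nat i)) = (if m = s + t - r then 1 else 0)"
      using coefficient_functional[of "s + t" "s + t - r"] by blast
    have "(\<lambda>g. act g (mono2 (s + t) t) 1 (of_nat i)) \<in> matrix_coeffs" for i
    proof -
      have "mono2 (s + t) t \<in> Sym (2 * l)" using mono2_in_Sym[of t "s + t"] st by simp
      then show ?thesis unfolding matrix_coeffs_def by blast
    qed
    then have "(\<lambda>g. \<Sum>i\<le>s+t. \<kappa> i * act g (mono2 (s + t) t) 1 (of_nat i)) \<in> span_on_SO3 matrix_coeffs"
      by (intro span_on_SO3_sum span_on_SO3_cmul span_on_SO3_base)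
    moreover have "(\<Sum>i\<le>s+t. \<kappa> i * act g (mono2 (s + t) t) 1 (of_nat i)) = (\<Sum>i\<in>I. of_nat (w i) * v i g)" for g
    proof -
      define U where "U = wlift g"
      define cf where "cf i j = (of_nat (s choose i) * of_nat (t choose j) *
          (U$1$1 ^ i * U$2$1 ^ (s - i) * U$1$2 ^ j * U$2$2 ^ (t - j)) :: complex)" for i j
      have a: "act g (mono2 (s + t) t) z0 z1 = (\<Sum>i\<le>s. \<Sum>j\<le>t. cf i j * mono2 (s + t) (s + t - i - j) z0 z1)" for z0 z1
        using binomial_bform[of z0 "U$1$1" z1 "U$2$1" s "U$1$2" "U$2$2" t]
        by (simp add: act_wlift sub_def cf_def U_def mono2_def)
      have a': "act g (mono2 (s + t) t) z0 z1 =
          (\<Sum>p\<in>{..s}\<times>{..t}. cf (fst p) (snd p) * mono2 (s + t) (s + t - fst p - snd p) z0 z1)" for z0 z1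
        by (simp add: a sum.cartesian_product case_prod_beta')
      have "(\<Sum>i\<le>s+t. \<kappa> i * act g (mono2 (s + t) t) 1 (of_nat i)) =
          (\<Sum>p\<in>{..s}\<times>{..t}. cf (fst p) (snd p) * (\<Sum>i\<le>s+t. \<kappa> i * mono2 (s + t) (s + t - fst p - snd p) 1 (of_nat i)))"
        unfolding a' sum_distrib_left by (subst sum.swap) (simp add: mult_ac)
      also have "\<dots> = (\<Sum>p\<in>{..s}\<times>{..t}. cf (fst p) (snd p) * (if fst p + snd p = r then 1 else 0))"
      proof (intro sum.cong refl)
        fix p assume "p \<in> {..s} \<times> {..t}"
        then have "(s + t - fst p - snd p = s + t - r) = (fst p + snd p = r)"
          using less.prems by (auto simp: r_def s_def t_def)
        then show "cf (fst p) (snd p) * (\<Sum>i\<le>s+t. \<kappa> i * mono2 (s + t) (s + t - fst p - snd p) 1 (of_nat i)) =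
            cf (fst p) (snd p) * (if fst p + snd p = r then 1 else 0)"
          using \<kappa>[of "s + t - fst p - snd p"] by simp
      qed
      also have "\<dots> = (\<Sum>p\<in>(\<lambda>i. (i, r - i)) ` I. cf (fst p) (snd p))"
        by (intro sum.mono_neutral_cong_right)
          (auto simp: I_def valid_def image_iff split: if_splits)
      also have "\<dots> = (\<Sum>i\<in>I. cf i (r - i))"
        by (subst sum.reindex) (auto simp: inj_on_def)
      also have "\<dots> = (\<Sum>i\<in>I. of_nat (w i) * v i g)"
        by (intro sum.cong refl) (auto simp: I_def valid_def cf_def w_def v_def umon_def U_def mult_ac)
      finally show ?thesis .
    qed
    ultimately show ?thesis by simp
  qed
  \<comment> \<open>Subtracting the differences replaces every \<open>v i\<close> by
    \<open>v a\<close>, which leaves the sum of the weights times \<open>v a\<close>.\<close>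
  have "(\<lambda>g. (\<Sum>i\<in>I. of_nat (w i) * v i g) - (\<Sum>i\<in>I. of_nat (w i) * (v i g - v a g))) \<in> span_on_SO3 matrix_coeffs"
    by (rule span_on_SO3_diff[OF T span_on_SO3_sum[OF span_on_SO3_cmul[OF diff]]]) (simp add: I_def)
  then have "(\<lambda>g. of_nat (\<Sum>i\<in>I. w i) * v a g) \<in> span_on_SO3 matrix_coeffs"
    by (simp add: right_diff_distrib sum_subtractf sum_distrib_right)
  then have "(\<lambda>g. 1 / of_nat (\<Sum>i\<in>I. w i) * (of_nat (\<Sum>i\<in>I. w i) * v a g)) \<in> span_on_SO3 matrix_coeffs"
    by (rule span_on_SO3_cmul)
  moreover have "of_nat (\<Sum>i\<in>I. w i) \<noteq> (0::complex)"
    using W by (subst of_nat_eq_0_iff) simp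
  ultimately have "v a \<in> span_on_SO3 matrix_coeffs"
    by simp
  then show ?case using v_a by simp
qed

text \<open>A grading modulo 2 by the degree in the lift. The entries of g are quadratic in the
  lift, hence even, and the even part is closed under products; so it contains all polynomials in
  g.\<close>

definition parity_span :: "nat \<Rightarrow> (real^3^3 \<Rightarrow> complex) set" where
  "parity_span e = span_on_SO3 {umon a b c d | a b c d. (a + b + c + d) mod 2 = e}"

lemma parity_span_mult:
  assumes "f \<in> parity_span e" "h \<in> parity_span e'"
  shows "(\<lambda>g. f g * h g) \<in> parity_span ((e + e') mod 2)"
proof -
  let ?M = "\<lambda>e. {umon a b c d | a b c d. (a + b + c + d) mod 2 = e}"
  have mon: "(\<lambda>g. u g * u' g) \<in> parity_span ((e + e') mod 2)" if u: "u \<in> ?M e" "u' \<in> ?M e'" for u u'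
  proof -
    obtain a b c d a' b' c' d' where "u = umon a b c d" "u' = umon a' b' c' d'"
      and e: "(a + b + c + d) mod 2 = e" "(a' + b' + c' + d') mod 2 = e'"
      using u by auto
    moreover have "((a + a') + (b + b') + (c + c') + (d + d')) mod 2 = (e + e') mod 2"
      using mod_add_eq[of "a + b + c + d" 2 "a' + b' + c' + d'"] unfolding e by (simp add: algebra_simps)
    ultimately show ?thesis
      unfolding parity_span_def by (intro span_on_SO3_base) (auto simp: umon_mult)
  qed
  have left: "(\<lambda>g. F g * u' g) \<in> parity_span ((e + e') mod 2)" if "F \<in> fun_span (?M e)" "u' \<in> ?M e'" for F u'
    using that(1)
  proof (induction rule: fun_span_induct)
    case zero
    show ?case using span_on_SO3_zero by (simp add: parity_span_def)
  next
    case (step F u c)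
    have "(\<lambda>g. F g * u' g + c * (u g * u' g)) \<in> parity_span ((e + e') mod 2)"
      using step mon[OF _ that(2)] unfolding parity_span_def by (intro span_on_SO3_add span_on_SO3_cmul) auto
    then show ?case by (simp add: algebra_simps)
  qed
  have both: "(\<lambda>g. F g * H g) \<in> parity_span ((e + e') mod 2)" if "H \<in> fun_span (?M e')" "F \<in> fun_span (?M e)" for F H
    using that(1)
  proof (induction rule: fun_span_induct)
    case zero
    show ?case using span_on_SO3_zero by (simp add: parity_span_def)
  next
    case (step H u c)
    have "(\<lambda>g. F g * H g + c * (F g * u g)) \<in> parity_span ((e + e') mod 2)"
      using step left[OF that(2)] unfolding parity_span_def by (intro span_on_SO3_add span_on_SO3_cmul) auto
    then show ?case by (simp add: algebra_simps)
  qed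
  obtain F H where FH: "F \<in> fun_span (?M e)" "H \<in> fun_span (?M e')" "\<And>g. g \<in> SO3 \<Longrightarrow> f g = F g" "\<And>g. g \<in> SO3 \<Longrightarrow> h g = H g"
    using assms unfolding parity_span_def span_on_SO3_def by blast
  show ?thesis
    using both[OF FH(2,1)] unfolding parity_span_def by (rule span_on_SO3_cong) (simp add: FH)
qed

lemma parity_span_lin:
  "f \<in> parity_span e \<Longrightarrow> h \<in> parity_span e \<Longrightarrow> (\<lambda>g. f g + h g) \<in> parity_span e"
  "f \<in> parity_span e \<Longrightarrow> (\<lambda>g. k * f g) \<in> parity_span e"
  unfolding parity_span_def by (blast intro: span_on_SO3_add span_on_SO3_cmul)+

lemma parity_span_const: "(\<lambda>g. k) \<in> parity_span 0"
proof -
  have "umon 0 0 0 0 \<in> parity_span 0"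
    unfolding parity_span_def by (rule span_on_SO3_base) force
  from parity_span_lin(2)[OF this, of k] show ?thesis
    by (simp add: umon_def)
qed

lemma parity_span_linear_form: "(\<lambda>g. x * wlift g $ i $ j + y * wlift g $ i' $ j') \<in> parity_span 1"
proof -
  have "umon 1 0 0 0 \<in> parity_span 1" "umon 0 1 0 0 \<in> parity_span 1" "umon 0 0 1 0 \<in> parity_span 1" "umon 0 0 0 1 \<in> parity_span 1"
    unfolding parity_span_def by (rule span_on_SO3_base, force)+
  then have "(\<lambda>g. wlift g $ i $ j) \<in> parity_span 1" for i j
    using exhaust_2[of i] exhaust_2[of j] by (auto simp: umon_def[abs_def])
  then show ?thesis
    by (intro parity_span_lin)
qed

lemma parity_span_entry: "(\<lambda>g. complex_of_real (g $ i $ j)) \<in> parity_span 0"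
proof -
  define q where "q z0 z1 = (\<lambda>g. quadr (cmat g *v axis j 1) z0 z1)" for z0 z1
  have q: "q z0 z1 \<in> parity_span 0" for z0 z1
  proof -
    let ?A = "\<lambda>g. z0 * wlift g $ 1 $ 1 + z1 * wlift g $ 2 $ 1" and ?B = "\<lambda>g. z0 * wlift g $ 1 $ 2 + z1 * wlift g $ 2 $ 2"
    let ?x = "axis j 1 :: complex^3"
    have pr: "(\<lambda>g. ?A g * ?A g) \<in> parity_span 0" "(\<lambda>g. ?B g * ?B g) \<in> parity_span 0" "(\<lambda>g. ?A g * ?B g) \<in> parity_span 0"
      using parity_span_mult[OF parity_span_linear_form parity_span_linear_form] by simp_all
    have "(\<lambda>g. (- \<i> * ?x $ 1) * (?A g * ?A g + ?B g * ?B g) + (?x $ 2 * (?B g * ?B g + -1 * (?A g * ?A g)) + (2 * ?x $ 3) * (?A g * ?B g))) \<in> parity_span 0"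
      by (intro parity_span_lin pr)
    then show ?thesis
      unfolding parity_span_def
    proof (rule span_on_SO3_cong)
      fix g assume "g \<in> SO3"
      then have "q z0 z1 g = sub (wlift g) (quadr ?x) z0 z1"
        using lift_wlift by (simp add: lift_def q_def)
      then show "(- \<i> * ?x $ 1) * (?A g * ?A g + ?B g * ?B g) + (?x $ 2 * (?B g * ?B g + -1 * (?A g * ?A g)) + (2 * ?x $ 3) * (?A g * ?B g)) = q z0 z1 g"
        by (simp add: sub_def quadr_def power2_eq_square)
    qed
  qed
  have e: "(cmat g *v axis j 1) $ i = complex_of_real (g $ i $ j)" for g i
    by (simp add: cmat_def matrix_vector_mult_def axis_def if_distrib[of "\<lambda>x. _ * x"] cong: if_cong)
  \<comment> \<open>The coordinates of a vector are recovered from its quadratic form by evaluation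
    at (1, 1), (1, -1), (0, 1) and (1, 0).\<close>
  have "(\<lambda>g. complex_of_real (g $ 3 $ j)) = (\<lambda>g. 1 / 4 * q 1 1 g + - 1 / 4 * q 1 (-1) g)"
    by (simp add: q_def quadr_def e fun_eq_iff field_simps)
  moreover have "(\<lambda>g. complex_of_real (g $ 1 $ j)) = (\<lambda>g. \<i> / 4 * q 1 1 g + \<i> / 4 * q 1 (-1) g)"
    by (simp add: q_def quadr_def e fun_eq_iff field_simps)
  moreover have "(\<lambda>g. complex_of_real (g $ 2 $ j)) = (\<lambda>g. 1 / 2 * q 0 1 g + - 1 / 2 * q 1 0 g)"
    by (simp add: q_def quadr_def e fun_eq_iff field_simps)
  ultimately have "(\<lambda>g. complex_of_real (g $ 1 $ j)) \<in> parity_span 0" "(\<lambda>g. complex_of_real (g $ 2 $ j)) \<in> parity_span 0"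
    "(\<lambda>g. complex_of_real (g $ 3 $ j)) \<in> parity_span 0"
    by (simp_all only:) (intro parity_span_lin q)+
  then show ?thesis
    using exhaust_3[of i] by auto
qed

lemma real_polynomial_in_parity_span:
  "real_polynomial_function (P :: real^3^3 \<Rightarrow> real) \<Longrightarrow> (\<lambda>g. complex_of_real (P g)) \<in> parity_span 0"
proof (induction rule: real_polynomial_function.induct)
  case (linear f)
  have fg: "f g = (\<Sum>b\<in>Basis. f b * (g \<bullet> b))" for g
  proof -
    have "f (\<Sum>b\<in>Basis. (g \<bullet> b) *\<^sub>R b) = (\<Sum>b\<in>Basis. f b * (g \<bullet> b))"
      using bounded_linear.linear[OF linear] by (simp add: linear_sum linear_cmul mult.commute del: euclidean_representation)
    then show ?thesis by (simp add: euclidean_representation)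
  qed
  have eq: "(\<lambda>g. complex_of_real (f g)) = (\<lambda>g. \<Sum>b\<in>Basis. complex_of_real (f b) * complex_of_real (g \<bullet> b))"
    by (rule ext, subst fg) simp
  have "(\<lambda>g. complex_of_real (f b) * complex_of_real (g \<bullet> b)) \<in> parity_span 0" if b: "b \<in> Basis" for b
  proof -
    obtain i j where "b = axis i (axis j 1)"
      using b by (auto simp: Basis_vec_def)
    then have "(\<lambda>g. complex_of_real (g \<bullet> b)) = (\<lambda>g. complex_of_real (g $ i $ j))"
      by (simp add: inner_axis)
    then have "(\<lambda>g. complex_of_real (g \<bullet> b)) \<in> parity_span 0"
      using parity_span_entry[of i j] by (simp only:)
    then show ?thesis
      by (rule parity_span_lin(2))
  qed
  then show ?case
    unfolding eq parity_span_def by (rule span_on_SO3_sum)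
next
  case (const c)
  show ?case by (rule parity_span_const)
next
  case (add f h)
  then show ?case using parity_span_lin(1) by simp
next
  case (mult f h)
  then show ?case using parity_span_mult[of _ 0 _ 0] by simp
qed

lemma polynomial_in_span:
  assumes "polynomial_function (P :: real^3^3 \<Rightarrow> complex)"
  shows "P \<in> span_on_SO3 matrix_coeffs"
proof -
  have "real_polynomial_function (\<lambda>g. Re (P g))" "real_polynomial_function (\<lambda>g. Im (P g))"
    using assms unfolding polynomial_function_def o_def
    by (auto simp: bounded_linear_Re bounded_linear_Im)
  then have "(\<lambda>g. complex_of_real (Re (P g)) + \<i> * complex_of_real (Im (P g))) \<in> parity_span 0"
    by (intro parity_span_lin real_polynomial_in_parity_span)
  moreover have "(\<lambda>g. complex_of_real (Re (P g)) + \<i> * complex_of_real (Im (P g))) = P"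
    by (simp add: fun_eq_iff complex_eq_iff)
  ultimately have "P \<in> parity_span 0" by simp
  then show ?thesis
    unfolding parity_span_def
  proof (rule span_on_SO3_trans)
    fix u assume "u \<in> {umon a b c d |a b c d. (a + b + c + d) mod 2 = 0}"
    then obtain a b c d where u: "u = umon a b c d" "(a + b + c + d) mod 2 = 0" by auto
    then have "2 dvd a + b + c + d" by presburger
    then obtain l where "a + b + c + d = 2 * l" by (rule dvdE)
    then show "u \<in> span_on_SO3 matrix_coeffs"
      unfolding u by (rule umon_in_span)
  qed
qed

section \<open>Legendre polynomials and invariant inner products\<close>

lemma pderiv_funpow_power:
  "poly ((pderiv ^^ k) ([:- a, 1:] ^ m)) x =
     (if k \<le> m then fact m / fact (m - k) * (x - a) ^ (m - k) else (0::real))"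
proof (induction k arbitrary: m)
  case 0
  then show ?case by (simp add: poly_power)
next
  case (Suc k)
  have sm: "(pderiv ^^ k) (smult c p) = smult c ((pderiv ^^ k) p)" for c and p :: "real poly"
    by (induction k) (simp_all add: pderiv_smult)
  show ?case
  proof (cases m)
    case 0
    have "(pderiv ^^ k) (0 :: real poly) = 0"
      by (induction k) simp_all
    then show ?thesis by (simp add: 0 funpow_Suc_right pderiv_1 del: funpow.simps)
  next
    case (Suc m')
    have "pderiv ([:- a, 1:] ^ m) = smult (of_nat m) ([:- a, 1:] ^ m')"
      unfolding Suc pderiv_power_Suc by (simp add: pderiv_pCons)
    then have "(pderiv ^^ Suc k) ([:- a, 1:] ^ m) = smult (of_nat m) ((pderiv ^^ k) ([:- a, 1:] ^ m'))"
      by (simp add: funpow_Suc_right sm del: funpow.simps)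
    then show ?thesis
      using Suc.IH[of m'] Suc by (simp add: field_simps)
  qed
qed

text \<open>In Rodrigues' formula x^2 - 1 = (x - 1)((x - 1) + 2) is expanded in powers of x - 1,
  whose l-fold derivatives are explicit.\<close>

lemma legendre_expansion:
  "poly (legendre l) x = (\<Sum>k\<le>l. real (l choose k) * real ((l + k) choose l) * ((x - 1) / 2) ^ k)"
proof -
  have lin_add: "(pderiv ^^ n) (p + q) = (pderiv ^^ n) p + (pderiv ^^ n) q" for n and p q :: "real poly"
    by (induction n) (simp_all add: pderiv_add)
  have lin_sm: "(pderiv ^^ n) (smult c p) = smult c ((pderiv ^^ n) p)" for n c and p :: "real poly"
    by (induction n) (simp_all add: pderiv_smult)
  have lin_sum: "(pderiv ^^ n) (sum p I) = (\<Sum>i\<in>I. (pderiv ^^ n) (p i))" for n and p :: "nat \<Rightarrow> real poly" and I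
  proof -
    have "(pderiv ^^ n) (0 :: real poly) = 0" by (induction n) simp_all
    then show ?thesis
      by (induction I rule: infinite_finite_induct) (simp_all add: lin_add)
  qed
  have "[:-1, 0, 1::real:] ^ l = ([:- 1, 1:] * ([:- 1, 1:] + [:2:])) ^ l"
    by simp
  also have "\<dots> = (\<Sum>k\<le>l. smult (real (l choose k) * 2 ^ (l - k)) ([:- 1, 1:] ^ (l + k)))"
    unfolding power_mult_distrib binomial_ring sum_distrib_left
    by (intro sum.cong refl)
      (simp add: power_add mult_ac of_nat_poly poly_const_pow) 
  finally have *: "(pderiv ^^ l) ([:-1, 0, 1::real:] ^ l) =
      (\<Sum>k\<le>l. smult (real (l choose k) * 2 ^ (l - k)) ((pderiv ^^ l) ([:- 1, 1:] ^ (l + k))))"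
    by (simp add: lin_sum lin_sm)
  have "poly (legendre l) x = 1 / (2 ^ l * fact l) *
      (\<Sum>k\<le>l. real (l choose k) * 2 ^ (l - k) * (fact (l + k) / fact k * (x - 1) ^ k))"
    unfolding legendre_def * by (simp add: poly_sum pderiv_funpow_power)
  also have "\<dots> = (\<Sum>k\<le>l. real (l choose k) * real ((l + k) choose l) * ((x - 1) / 2) ^ k)"
    unfolding sum_distrib_left
  proof (intro sum.cong refl)
    fix k assume "k \<in> {..l}"
    then have "(2::real) ^ l = 2 ^ (l - k) * 2 ^ k"
      by (simp flip: power_add)
    moreover have "real ((l + k) choose l) = fact (l + k) / (fact l * fact k)"
      by (simp add: binomial_fact)
    ultimately show "1 / (2 ^ l * fact l) * (real (l choose k) * 2 ^ (l - k) * (fact (l + k) / fact k * (x - 1) ^ k))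
        = real (l choose k) * real ((l + k) choose l) * ((x - 1) / 2) ^ k"
      by (simp add: power_divide mult_ac)
  qed
  finally show ?thesis .
qed

lemma binomial_sq_quotient:
  assumes "k \<le> l"
  shows "(real (l choose k))\<^sup>2 / real ((2 * l) choose k) =
    real ((2 * l - k) choose l) * real (l choose k) / real ((2 * l) choose l)"
proof -
  have "2 * l - k - l = l - k" "2 * l - l = l" using assms by auto
  then show ?thesis
    using assms by (simp add: binomial_fact power2_eq_square field_simps)
qed

text \<open>The left side is the squared norm of z0^l (2 z0 + (2 / s) z1)^l. After the quotient of
  binomials is rewritten, the reversal k -> l - k turns the sum into the expansion of P_l at x = 1 +
  2 s^2, where (x - 1) / 2 = s^2.\<close>

lemma norm_sum_legendre:
  fixes s :: real
  assumes "s \<noteq> 0"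
  shows "(\<Sum>k\<le>l. (real (l choose k) * 2 ^ (l - k) * (2 / s) ^ k)\<^sup>2 / real ((2 * l) choose k))
    = 4 ^ l / s ^ (2 * l) * poly (legendre l) (1 + 2 * s\<^sup>2) / real ((2 * l) choose l)"
proof -
  have "(\<Sum>k\<le>l. (real (l choose k) * 2 ^ (l - k) * (2 / s) ^ k)\<^sup>2 / real ((2 * l) choose k))
      = (\<Sum>k\<le>l. real ((2 * l - k) choose l) * real (l choose k) / real ((2 * l) choose l) * (4 ^ (l - k) * (4 / s\<^sup>2) ^ k))"
  proof (intro sum.cong refl)
    fix k assume "k \<in> {..l}"
    then have b: "(real (l choose k))\<^sup>2 / real ((2 * l) choose k) =
      real ((2 * l - k) choose l) * real (l choose k) / real ((2 * l) choose l)"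
      by (intro binomial_sq_quotient) simp
    have "(2 ^ (l - k))\<^sup>2 = (4::real) ^ (l - k)" "((2 / s) ^ k)\<^sup>2 = (4 / s\<^sup>2) ^ k"
      by (simp_all add: power2_eq_square flip: power_mult_distrib)
    then have "(real (l choose k) * 2 ^ (l - k) * (2 / s) ^ k)\<^sup>2 / real ((2 * l) choose k)
        = (real (l choose k))\<^sup>2 / real ((2 * l) choose k) * (4 ^ (l - k) * (4 / s\<^sup>2) ^ k)"
      by (simp add: power_mult_distrib)
    then show "(real (l choose k) * 2 ^ (l - k) * (2 / s) ^ k)\<^sup>2 / real ((2 * l) choose k)
       = real ((2 * l - k) choose l) * real (l choose k) / real ((2 * l) choose l) * (4 ^ (l - k) * (4 / s\<^sup>2) ^ k)"
      using b by simp
  qed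
  also have "\<dots> = (\<Sum>k\<le>l. real ((l + k) choose l) * real (l choose k) / real ((2 * l) choose l) * (4 ^ k * (4 / s\<^sup>2) ^ (l - k)))"
    by (subst sum.nat_diff_reindex[symmetric, of _ "Suc l", unfolded lessThan_Suc_atMost])
      (auto intro!: sum.cong simp: binomial_symmetric[of _ l, symmetric] algebra_simps mult_2)
  also have "\<dots> = 4 ^ l / s ^ (2 * l) * (\<Sum>k\<le>l. real (l choose k) * real ((l + k) choose l) * (s\<^sup>2) ^ k) / real ((2 * l) choose l)"
    unfolding sum_distrib_left sum_divide_distrib
  proof (intro sum.cong refl)
    fix k assume "k \<in> {..l}"
    then have "(4::real) ^ l = 4 ^ k * 4 ^ (l - k)" "s ^ (2 * l) = (s\<^sup>2) ^ k * (s\<^sup>2) ^ (l - k)"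
      by (simp_all add: power_mult flip: power_add)
    then show "real ((l + k) choose l) * real (l choose k) / real ((2 * l) choose l) * (4 ^ k * (4 / s\<^sup>2) ^ (l - k))
       = 4 ^ l / s ^ (2 * l) * (real (l choose k) * real ((l + k) choose l) * (s\<^sup>2) ^ k) / real ((2 * l) choose l)"
      using assms by (simp add: power_divide mult_ac)
  qed
  finally show ?thesis
    by (simp add: legendre_expansion)
qed

lemma
  assumes B: "invariant_inner_product n B"
  shows inner_add_left: "p \<in> Sym n \<Longrightarrow> q \<in> Sym n \<Longrightarrow> r \<in> Sym n \<Longrightarrow>
      B (\<lambda>z0 z1. p z0 z1 + q z0 z1) r = B p r + B q r"
    and inner_cmul_left: "p \<in> Sym n \<Longrightarrow> q \<in> Sym n \<Longrightarrow> B (\<lambda>z0 z1. c * p z0 z1) q = c * B p q"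
    and inner_cnj: "p \<in> Sym n \<Longrightarrow> q \<in> Sym n \<Longrightarrow> B q p = cnj (B p q)"
    and inner_raise: "p \<in> Sym n \<Longrightarrow> q \<in> Sym n \<Longrightarrow> B (sym_raise p) q = B p (sym_lower q)"
    and inner_weight: "p \<in> Sym n \<Longrightarrow> q \<in> Sym n \<Longrightarrow> B (sym_weight p) q = B p (sym_weight q)"
  using B unfolding invariant_inner_product_def bi_smult_def bi_add_def by blast+

lemma inner_cmul_right:
  assumes B: "invariant_inner_product n B" and m: "p \<in> Sym n" "q \<in> Sym n"
  shows "B p (\<lambda>z0 z1. c * q z0 z1) = cnj c * B p q"
  using inner_cnj[OF B Sym_cmul[OF m(2), of c] m(1)] inner_cmul_left[OF B m(2,1), of c] inner_cnj[OF B m(2,1)]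
  by simp

lemma inner_sum_left:
  assumes B: "invariant_inner_product n B" and "\<And>i. i \<in> I \<Longrightarrow> p i \<in> Sym n" "r \<in> Sym n"
  shows "B (\<lambda>z0 z1. \<Sum>i\<in>I. p i z0 z1) r = (\<Sum>i\<in>I. B (p i) r)"
proof -
  have z: "B (\<lambda>z0 z1. 0) r = 0"
    using inner_cmul_left[OF B Sym_zero assms(3), of 0] by simp
  show ?thesis
    using assms(2)
    by (induction I rule: infinite_finite_induct)
      (simp_all add: z inner_add_left[OF B _ Sym_sum assms(3)])
qed

text \<open>The monomials are eigenvectors of the self-adjoint \<open>sym_weight\<close> with
  distinct eigenvalues n - 2k, hence orthogonal. Adjointness of raising and lowering gives a
  recursion for their norms.\<close>

lemma invariant_inner_mono2:
  assumes B: "invariant_inner_product n B" and u: "B (mono2 n 0) (mono2 n 0) = 1"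
    and "j \<le> n" "k \<le> n"
  shows "B (mono2 n j) (mono2 n k) = (if j = k then 1 / of_nat (n choose k) else 0)"
proof (cases "j = k")
  case False
  have m: "mono2 n j \<in> Sym n" "mono2 n k \<in> Sym n"
    using assms(3,4) mono2_in_Sym by auto
  note w = inner_weight[OF B m]
  have "(of_nat (n - j) - of_nat j) * B (mono2 n j) (mono2 n k) = (of_nat (n - k) - of_nat k) * B (mono2 n j) (mono2 n k)"
    using w unfolding sym_ops_mono2(3)[OF assms(3)] sym_ops_mono2(3)[OF assms(4)]
      inner_cmul_left[OF B m] inner_cmul_right[OF B m] by simp
  then have "(2 * of_nat k - 2 * of_nat j) * B (mono2 n j) (mono2 n k) = 0"
    using assms(3,4) by (simp add: of_nat_diff algebra_simps)
  then show ?thesis using False by simp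
next
  case True
  have "B (mono2 n k) (mono2 n k) = 1 / of_nat (n choose k)"
    using \<open>k \<le> n\<close>
  proof (induction k)
    case 0
    then show ?case using u by simp
  next
    case (Suc k)
    have m: "mono2 n k \<in> Sym n" "mono2 n (Suc k) \<in> Sym n"
      using Suc.prems by (auto intro: mono2_in_Sym)
    note rl = inner_raise[OF B m(2,1)]
    have e: "of_nat (Suc k) * B (mono2 n k) (mono2 n k) = of_nat (n - k) * B (mono2 n (Suc k)) (mono2 n (Suc k))"
      using rl Suc.prems
      unfolding sym_ops_mono2(1)[OF Suc.prems] sym_ops_mono2(2)[OF Suc_leD[OF Suc.prems]]
      by (simp add: inner_cmul_left[OF B m(1,1)] inner_cmul_right[OF B m(2,2)] del: of_nat_Suc of_nat_diff)
    have "Suc k * (n choose Suc k) = (n - k) * (n choose k)"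
      by (simp only: binomial_absorption binomial_absorb_comp)
    then have b: "of_nat (Suc k) * of_nat (n choose Suc k) = (of_nat (n - k) * of_nat (n choose k) :: complex)"
      by (metis of_nat_mult)
    have "n choose k \<noteq> 0" "n choose Suc k \<noteq> 0" "n - k \<noteq> 0"
      using Suc.prems by auto
    then show ?case
      using e b Suc.IH Suc.prems by (simp add: field_simps del: of_nat_Suc of_nat_diff) 
  qed
  then show ?thesis using True by simp
qed

section \<open>Tuples of forms, the Casimir operator and orthogonality of blocks\<close>

definition bsum :: "nat \<Rightarrow> (nat \<Rightarrow> bipoly) \<Rightarrow> real^3^3 \<Rightarrow> complex" where
  "bsum n q g = (\<Sum>i\<le>n. act g (q i) 1 (of_nat i))"

lemma bsum_in_blk: "(\<And>i. q i \<in> Sym (2 * l)) \<Longrightarrow> bsum n q \<in> blk l"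
  unfolding bsum_def[abs_def] blk_def
  by (intro fun_span_sum fun_span_base) (auto simp: blk_gen_def)

lemma blk_bsum:
  assumes "F \<in> blk l"
  obtains q where "\<And>i. q i \<in> Sym (2 * l)" "F = bsum (2 * l) q"
proof (rule blk_repr[OF assms])
  fix q assume "\<And>i. q i \<in> Sym (2 * l)" "F = (\<lambda>g. \<Sum>i\<le>2*l. act g (q i) 1 (of_nat i))"
  then show thesis
    by (intro that[of q]) (simp_all add: bsum_def[abs_def])
qed

lemma rderiv_bsum: "(\<And>i. q i \<in> Sym (2 * l)) \<Longrightarrow> rderiv j (bsum n q) (bsum n (\<lambda>i. dE j (q i)))"
  unfolding bsum_def[abs_def] by (intro rderiv_sum rderiv_act[where l = l])

lemma bsum_add: "bsum n (\<lambda>i z0 z1. p i z0 z1 + q i z0 z1) = (\<lambda>g. bsum n p g + bsum n q g)"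
  by (simp add: bsum_def fun_eq_iff act_add sum.distrib)

lemma bsum_cmul: "bsum n (\<lambda>i z0 z1. c * p i z0 z1) = (\<lambda>g. c * bsum n p g)"
  by (simp add: bsum_def fun_eq_iff act_cmul sum_distrib_left)

lemma bsum_sum: "bsum n (\<lambda>i z0 z1. \<Sum>j\<in>J. p j i z0 z1) = (\<lambda>g. \<Sum>j\<in>J. bsum n (p j) g)"
  by (rule ext) (simp only: bsum_def act_sum, rule sum.swap)

lemma Sym_induct [consumes 1, case_names zero step]:
  assumes "p \<in> Sym n" "P (\<lambda>z0 z1. 0)"
    and step: "\<And>p k c. p \<in> Sym n \<Longrightarrow> P p \<Longrightarrow> k \<le> n \<Longrightarrow> P (\<lambda>z0 z1. p z0 z1 + c * mono2 n k z0 z1)"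
  shows "P p"
proof -
  obtain a where a: "p = bform n a"
    using assms(1) by (auto simp: Sym_eq)
  have "(\<lambda>z0 z1. \<Sum>k<m. a k * mono2 n k z0 z1) \<in> Sym n \<and> P (\<lambda>z0 z1. \<Sum>k<m. a k * mono2 n k z0 z1)" if "m \<le> Suc n" for m
    using that
  proof (induction m)
    case 0
    then show ?case using assms(2) by (simp add: Sym_zero)
  next
    case (Suc m)
    then show ?case
      using step[of "\<lambda>z0 z1. \<Sum>k<m. a k * mono2 n k z0 z1" m "a m"]
      by (auto intro!: Sym_add Sym_cmul mono2_in_Sym)
  qed
  from this[of "Suc n"] show ?thesis
    by (simp add: a bform_def[abs_def] lessThan_Suc_atMost)
qed

text \<open>The Casimir element H^2 + 2H + 4FE of sl(2), with H the weight, E the raising and F the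
  lowering operator.\<close>

definition casimir :: "bipoly \<Rightarrow> bipoly" where
  "casimir p = (\<lambda>z0 z1. (sym_weight (sym_weight p) z0 z1 + 2 * sym_weight p z0 z1) + 4 * sym_lower (sym_raise p) z0 z1)"

text \<open>On \<open>mono2 n k\<close>, with h = n - 2k, the three terms add up to h^2 + 2h + 4k(n
  + 1 - k) = n(n + 2).\<close>

lemma casimir_eq:
  assumes "p \<in> Sym n"
  shows "casimir p = (\<lambda>z0 z1. of_nat (n * (n + 2)) * p z0 z1)"
  using assms
proof (induction rule: Sym_induct)
  case zero
  show ?case by (simp add: casimir_def sym_weight_def sym_lower_def sym_raise_def d0_def d1_def)
next
  case (step p k c)
  note m = mono2_in_Sym[OF step.hyps(2)]
  note ops = sym_ops_in_Sym
  have "casimir (mono2 n k) = (\<lambda>z0 z1. of_nat (n * (n + 2)) * mono2 n k z0 z1)"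
  proof -
    have z: "sym_lower (\<lambda>z0 z1. 0) = (\<lambda>z0 z1. 0)" "sym_weight (\<lambda>z0 z1. 0) = (\<lambda>z0 z1. 0)"
      by (simp_all add: sym_lower_def sym_weight_def d0_def d1_def fun_eq_iff)
    have lc: "sym_lower (\<lambda>z0 z1. c * mono2 n i z0 z1) = (\<lambda>z0 z1. c * sym_lower (mono2 n i) z0 z1)"
      "sym_weight (\<lambda>z0 z1. c * mono2 n i z0 z1) = (\<lambda>z0 z1. c * sym_weight (mono2 n i) z0 z1)" if "i \<le> n" for c i
      using sym_ops_linear(2,3)[OF Sym_zero mono2_in_Sym[OF that], of c] by (simp_all add: z)
    have k1: "k - 1 \<le> n" using step.hyps(2) by simp
    have "of_nat k * (of_nat (n - (k - 1)) * mono2 n (k - 1 + 1) z0 z1) = (of_nat (k * (n + 1 - k)) * mono2 n k z0 z1 :: complex)" for z0 z1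
    proof (cases "k = 0")
      case False
      then have "k * (n - (k - 1)) = k * (n + 1 - k)" "k - 1 + 1 = k" by auto
      then show ?thesis
        by (metis (no_types) mult.assoc of_nat_mult)
    qed simp
    moreover have "(of_nat (n - k) - of_nat k) * (of_nat (n - k) - of_nat k) + 2 * (of_nat (n - k) - of_nat k)
        + 4 * of_nat (k * (n + 1 - k)) = (of_nat (n * (n + 2)) :: complex)"
    proof -
      obtain d where d: "n = k + d"
        using step.hyps(2) le_Suc_ex by blast
      have "k + d + 1 - k = d + 1" by simp
      then show ?thesis unfolding d by (simp add: algebra_simps)
    qed
    ultimately show ?thesis
      unfolding casimir_def sym_ops_mono2[OF step.hyps(2)] lc[OF k1] lc[OF step.hyps(2)] sym_ops_mono2[OF k1]
      by (simp add: fun_eq_iff distrib_right[symmetric] mult.assoc[symmetric] del: of_nat_mult of_nat_diff of_nat_add of_nat_Suc)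
  qed
  moreover have "casimir (\<lambda>z0 z1. p z0 z1 + c * mono2 n k z0 z1) = (\<lambda>z0 z1. casimir p z0 z1 + c * casimir (mono2 n k) z0 z1)"
    unfolding casimir_def
    unfolding sym_ops_linear[OF step.hyps(1) m]
      sym_ops_linear[OF ops(3)[OF step.hyps(1)] ops(3)[OF m]] sym_ops_linear[OF ops(1)[OF step.hyps(1)] ops(1)[OF m]]
    by (simp add: algebra_simps)
  ultimately show ?case
    using step.IH by (simp add: algebra_simps)
qed

lemma l2_inner_sum_left:
  "finite I \<Longrightarrow> (\<And>i. i \<in> I \<Longrightarrow> f i \<in> L2 M) \<Longrightarrow> h \<in> L2 M \<Longrightarrow>
    (\<lambda>x. \<Sum>i\<in>I. f i x) \<in> L2 M \<and> l2_inner M (\<lambda>x. \<Sum>i\<in>I. f i x) h = (\<Sum>i\<in>I. l2_inner M (f i) h)"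
proof (induction I rule: finite_induct)
  case empty
  then show ?case by (simp add: L2_zero l2_inner_def)
next
  case (insert i I)
  then show ?case by (simp add: L2_add l2_inner_add_left)
qed

definition dX :: "complex^3 \<Rightarrow> bipoly \<Rightarrow> bipoly" where
  "dX x p = (\<lambda>z0 z1. \<Sum>j\<in>UNIV. x $ j * dE j p z0 z1)"

lemma dX_in_Sym: "p \<in> Sym n \<Longrightarrow> dX x p \<in> Sym n"
  unfolding dX_def by (intro Sym_sum Sym_cmul dE_in_Sym)

definition cnj_vec :: "complex^3 \<Rightarrow> complex^3" where
  "cnj_vec x = (\<chi> j. - cnj (x $ j))"

definition ae_space :: "(real^3^3) measure \<Rightarrow> (real^3^3 \<Rightarrow> complex) set \<Rightarrow> (real^3^3 \<Rightarrow> complex) set" where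
  "ae_space \<mu> X = {f \<in> L2 \<mu>. \<exists>F\<in>X. AE g in \<mu>. f g = F g}"

lemma fun_span_ae:
  assumes "s \<in> fun_span (\<Union>i\<in>I. ae_space \<mu> (X i))"
  shows "\<exists>F\<in>fun_span (\<Union>i\<in>I. X i). AE g in \<mu>. s g = F g"
  using assms
proof (induction rule: fun_span_induct)
  case zero
  show ?case by (rule bexI[OF _ fun_span_zero]) simp
next
  case (step F a c)
  then obtain G where G: "G \<in> fun_span (\<Union>i\<in>I. X i)" "AE g in \<mu>. F g = G g" by blast
  obtain i b where b: "i \<in> I" "b \<in> X i" "AE g in \<mu>. a g = b g"
    using step.hyps by (auto simp: ae_space_def)
  have "(\<lambda>g. G g + c * b g) \<in> fun_span (\<Union>i\<in>I. X i)"
    using G b by (intro fun_span_add_base) auto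
  moreover have "AE g in \<mu>. F g + c * a g = G g + c * b g"
    using G(2) b(3) by eventually_elim simp
  ultimately show ?case by (intro bexI[of _ "\<lambda>g. G g + c * b g"])
qed

context haar_SO3
begin

lemma blk_continuous: "F \<in> blk l \<Longrightarrow> continuous_on SO3 F"
proof -
  assume "F \<in> blk l"
  then show ?thesis
  proof (rule blk_bsum)
    fix q assume q: "\<And>i. q i \<in> Sym (2 * l)" "F = bsum (2 * l) q"
    show ?thesis
      unfolding q(2) by (rule rderivD(1)[OF rderiv_bsum[OF q(1)]])
  qed
qed

lemma blk_L2: "F \<in> blk l \<Longrightarrow> F \<in> L2 \<mu>"
  by (intro continuous_in_L2 blk_continuous)

lemma bsum_L2: "(\<And>i. q i \<in> Sym (2 * l)) \<Longrightarrow> bsum n q \<in> L2 \<mu>"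
  by (rule blk_L2[OF bsum_in_blk])

lemma inner_dE:
  assumes f: "rderiv j f f'" and q: "\<And>i. q i \<in> Sym (2 * l)"
  shows "l2_inner \<mu> f (bsum n (\<lambda>i. dE j (q i))) = - l2_inner \<mu> f' (bsum n q)"
  using rderiv_by_parts[OF f rderiv_bsum[OF q]] by simp

text \<open>Each R_X with X = E_j is skew, so the formal adjoint of R_x is R_y with y =
  \<open>cnj_vec x\<close>. Only one factor has to be a matrix coefficient; the other may be any
  function with continuous derivatives.\<close>

lemma inner_dX:
  assumes f: "\<And>j. rderiv j f (f' j)" and q: "\<And>i. q i \<in> Sym (2 * l)"
  shows "l2_inner \<mu> f (bsum n (\<lambda>i. dX (cnj_vec x) (q i))) = l2_inner \<mu> (\<lambda>g. \<Sum>j\<in>UNIV. x $ j * f' j g) (bsum n q)"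
proof -
  have f'L: "f' j \<in> L2 \<mu>" for j
    by (rule continuous_in_L2[OF rderivD(2)[OF f]])
  have dL: "bsum n (\<lambda>i. dE j (q i)) \<in> L2 \<mu>" for j
    by (rule bsum_L2[where l = l]) (rule dE_in_Sym[OF q])
  have fL: "f \<in> L2 \<mu>"
    by (rule continuous_in_L2[OF rderivD(1)[OF f]])
  have "l2_inner \<mu> f (bsum n (\<lambda>i. dX (cnj_vec x) (q i)))
      = cnj (l2_inner \<mu> (\<lambda>g. \<Sum>j\<in>UNIV. - cnj (x $ j) * bsum n (\<lambda>i. dE j (q i)) g) f)"
    by (subst l2_inner_cnj) (simp only: dX_def bsum_sum bsum_cmul cnj_vec_def vec_lambda_beta)
  also have "\<dots> = cnj (\<Sum>j\<in>UNIV. - cnj (x $ j) * l2_inner \<mu> (bsum n (\<lambda>i. dE j (q i))) f)"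
    using l2_inner_sum_left[of UNIV "\<lambda>j g. - cnj (x $ j) * bsum n (\<lambda>i. dE j (q i)) g" \<mu> f]
    by (simp only: finite L2_cmul[OF dL] fL l2_inner_cmul_left)
  also have "\<dots> = (\<Sum>j\<in>UNIV. x $ j * l2_inner \<mu> (f' j) (bsum n q))"
    using inner_dE[OF f q] l2_inner_cnj[of \<mu> "bsum n (\<lambda>i. dE _ (q i))" f]
    by (simp add: cnj_sum)
  also have "\<dots> = l2_inner \<mu> (\<lambda>g. \<Sum>j\<in>UNIV. x $ j * f' j g) (bsum n q)"
    using l2_inner_sum_left[of UNIV "\<lambda>j g. x $ j * f' j g" \<mu> "bsum n q"]
    by (simp only: finite L2_cmul[OF f'L] bsum_L2[OF q] l2_inner_cmul_left)
  finally show ?thesis .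
qed

lemma inner_ops:
  assumes p: "\<And>i. p i \<in> Sym (2 * l)" and q: "\<And>i. q i \<in> Sym (2 * m)"
  shows "l2_inner \<mu> (bsum n (\<lambda>i. sym_raise (p i))) (bsum k q) = l2_inner \<mu> (bsum n p) (bsum k (\<lambda>i. sym_lower (q i)))"
    "l2_inner \<mu> (bsum n (\<lambda>i. sym_lower (p i))) (bsum k q) = l2_inner \<mu> (bsum n p) (bsum k (\<lambda>i. sym_raise (q i)))"
    "l2_inner \<mu> (bsum n (\<lambda>i. sym_weight (p i))) (bsum k q) = l2_inner \<mu> (bsum n p) (bsum k (\<lambda>i. sym_weight (q i)))"
proof -
  have e: "sym_raise p = (\<lambda>z0 z1. dE 1 p z0 z1 + \<i> * dE 2 p z0 z1)"
    "sym_lower p = (\<lambda>z0 z1. -1 * dE 1 p z0 z1 + \<i> * dE 2 p z0 z1)"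
    "sym_weight p = (\<lambda>z0 z1. 2 * \<i> * dE 3 p z0 z1)" for p
    by (simp_all add: fun_eq_iff sym_raise_dE sym_lower_dE sym_weight_dE)
  have L: "bsum n (\<lambda>i. dE j (p i)) \<in> L2 \<mu>" "bsum k (\<lambda>i. dE j (q i)) \<in> L2 \<mu>" "bsum n p \<in> L2 \<mu>" "bsum k q \<in> L2 \<mu>" for j
    using bsum_L2 dE_in_Sym p q by meson+
  have parts: "l2_inner \<mu> (bsum n (\<lambda>i. dE j (p i))) (bsum k q) = - l2_inner \<mu> (bsum n p) (bsum k (\<lambda>i. dE j (q i)))" for j
    using inner_dE[OF rderiv_bsum[OF p] q] by simp
  show "l2_inner \<mu> (bsum n (\<lambda>i. sym_raise (p i))) (bsum k q) = l2_inner \<mu> (bsum n p) (bsum k (\<lambda>i. sym_lower (q i)))"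
    "l2_inner \<mu> (bsum n (\<lambda>i. sym_lower (p i))) (bsum k q) = l2_inner \<mu> (bsum n p) (bsum k (\<lambda>i. sym_raise (q i)))"
    "l2_inner \<mu> (bsum n (\<lambda>i. sym_weight (p i))) (bsum k q) = l2_inner \<mu> (bsum n p) (bsum k (\<lambda>i. sym_weight (q i)))"
    unfolding e bsum_add bsum_cmul
    by (simp_all only: l2_inner_add_left l2_inner_add_right L L2_cmul l2_inner_cmul_left l2_inner_cmul_right parts)
       simp_all
qed

text \<open>The Casimir operator is symmetric for the L2 inner product and acts on different blocks
  by different scalars.\<close>

lemma blk_orth:
  assumes "l \<noteq> m" "F \<in> blk l" "G \<in> blk m"
  shows "l2_inner \<mu> F G = 0"
proof -
  obtain p where p: "\<And>i. p i \<in> Sym (2 * l)" "F = bsum (2 * l) p"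
    using blk_bsum[OF assms(2)] by blast
  obtain q where q: "\<And>i. q i \<in> Sym (2 * m)" "G = bsum (2 * m) q"
    using blk_bsum[OF assms(3)] by blast
  note ops = sym_ops_in_Sym
  let ?I = "\<lambda>p q. l2_inner \<mu> (bsum (2 * l) p) (bsum (2 * m) q)"
  have Lp: "bsum (2 * l) r \<in> L2 \<mu>" if "\<And>i. r i \<in> Sym (2 * l)" for r using bsum_L2 that by blast
  have Lq: "bsum (2 * m) r \<in> L2 \<mu>" if "\<And>i. r i \<in> Sym (2 * m)" for r using bsum_L2 that by blast
  have "?I (\<lambda>i. casimir (p i)) q = (?I (\<lambda>i. sym_weight (sym_weight (p i))) q + 2 * ?I (\<lambda>i. sym_weight (p i)) q)
      + 4 * ?I (\<lambda>i. sym_lower (sym_raise (p i))) q"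
    unfolding casimir_def bsum_add bsum_cmul
    by (simp only: l2_inner_add_left l2_inner_cmul_left L2_add L2_cmul Lp Lq ops p(1) q(1))
  also have "\<dots> = (?I p (\<lambda>i. sym_weight (sym_weight (q i))) + 2 * ?I p (\<lambda>i. sym_weight (q i)))
      + 4 * ?I p (\<lambda>i. sym_lower (sym_raise (q i)))"
    by (simp only: inner_ops[OF p(1) q(1)] inner_ops[OF ops(3)[OF p(1)] q(1)] inner_ops[OF p(1) ops(3)[OF q(1)]]
        inner_ops[OF ops(1)[OF p(1)] q(1)] inner_ops[OF p(1) ops(1)[OF q(1)]])
  also have "\<dots> = ?I p (\<lambda>i. casimir (q i))"
    unfolding casimir_def bsum_add bsum_cmul
    by (simp only: l2_inner_add_right l2_inner_cmul_right L2_add L2_cmul Lp Lq ops p(1) q(1)) simp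
  finally have eq: "of_nat (2 * l * (2 * l + 2)) * ?I p q = of_nat (2 * m * (2 * m + 2)) * ?I p q"
    unfolding casimir_eq[OF p(1)] casimir_eq[OF q(1)] bsum_cmul
    by (simp only: l2_inner_cmul_left l2_inner_cmul_right complex_cnj_of_nat)
  have "2 * l * (2 * l + 2) \<noteq> 2 * m * (2 * m + 2)"
  proof (cases "l < m")
    case True
    have "2 * l * (2 * l + 2) < 2 * m * (2 * m + 2)" by (rule mult_strict_mono) (use True in auto)
    then show ?thesis by (rule less_imp_neq)
  next
    case False
    have "2 * m * (2 * m + 2) < 2 * l * (2 * l + 2)" by (rule mult_strict_mono) (use False assms(1) in auto)
    then show ?thesis by (rule less_imp_neq[symmetric])
  qed
  then have "of_nat (2 * l * (2 * l + 2)) \<noteq> (of_nat (2 * m * (2 * m + 2)) :: complex)"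
    by (simp only: of_nat_eq_iff not_False_eq_True)
  then show ?thesis
    using eq unfolding p(2) q(2) by (simp only: mult_cancel_right) blast
qed

text \<open>The bound N keeps the number of blocks finite, so that projections onto them
  exist.\<close>

definition matrix_coeff_sums :: "(real^3^3 \<Rightarrow> complex) set" where
  "matrix_coeff_sums = (\<Union>N. fun_span (\<Union>l<N. blk_basis l))"

lemma matrix_coeffs_sums:
  assumes "F \<in> fun_span matrix_coeffs"
  shows "F \<in> matrix_coeff_sums"
  using assms
proof (induction rule: fun_span_induct)
  case zero
  show ?case using fun_span_zero by (auto simp: matrix_coeff_sums_def)
next
  case (step F a c)
  then obtain N where N: "F \<in> fun_span (\<Union>l<N. blk_basis l)"
    by (auto simp: matrix_coeff_sums_def)
  obtain p z0 z1 l where a: "a = (\<lambda>g. act g p z0 z1)" "p \<in> Sym (2 * l)"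
    using step.hyps by (auto simp: matrix_coeffs_def)
  then have "a \<in> blk l"
    unfolding blk_def by (intro fun_span_base) (auto simp: blk_gen_def)
  then have "a \<in> fun_span (blk_basis l)" by (simp add: blk_eq)
  moreover have "fun_span (blk_basis l) \<subseteq> fun_span (\<Union>k<max N (Suc l). blk_basis k)"
    "fun_span (\<Union>k<N. blk_basis k) \<subseteq> fun_span (\<Union>k<max N (Suc l). blk_basis k)"
    by (intro fun_span_mono; force)+
  ultimately have "(\<lambda>g. F g + c * a g) \<in> fun_span (\<Union>k<max N (Suc l). blk_basis k)"
    using N by (intro fun_span_add[OF fun_span_cmul]) auto
  then show ?case by (auto simp: matrix_coeff_sums_def)
qed

lemma continuous_in_closure:
  assumes f: "continuous_on SO3 f"
  shows "f \<in> l2_closure \<mu> matrix_coeff_sums"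
  unfolding l2_closure_def
proof (intro CollectI conjI allI impI)
  show fL: "f \<in> L2 \<mu>" by (rule continuous_in_L2[OF f])
  fix e :: real assume e: "e > 0"
  obtain P where P: "polynomial_function P" "\<And>g. g \<in> SO3 \<Longrightarrow> norm (f g - P g) < e / 2"
    using Stone_Weierstrass_polynomial_function[OF compact_SO3 f, of "e / 2"] e by auto
  obtain F where F: "F \<in> fun_span matrix_coeffs" "\<And>g. g \<in> SO3 \<Longrightarrow> P g = F g"
    using polynomial_in_span[OF P(1)] by (auto simp: span_on_SO3_def)
  have "continuous_on SO3 P"
    by (rule continuous_on_polymonial_function[OF P(1)])
  then have "continuous_on SO3 F"
    using F(2) by (metis (no_types, lifting) continuous_on_cong)
  then have FL: "F \<in> L2 \<mu>" by (rule continuous_in_L2)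
  have "(l2_norm \<mu> (\<lambda>g. f g - F g))\<^sup>2 \<le> (\<integral>g. (e / 2)\<^sup>2 \<partial>\<mu>)"
    unfolding l2_norm_sq
  proof (rule integral_mono)
    show "integrable \<mu> (\<lambda>g. (cmod (f g - F g))\<^sup>2)" using L2D(2)[OF L2_diff[OF fL FL]] .
    show "integrable \<mu> (\<lambda>g. (e / 2)\<^sup>2)" by simp
    fix g assume "g \<in> space \<mu>"
    then have "cmod (f g - F g) < e / 2" using P(2) F(2) by simp
    then show "(cmod (f g - F g))\<^sup>2 \<le> (e / 2)\<^sup>2" by (intro power_mono) auto
  qed
  also have "\<dots> = (e / 2)\<^sup>2" using prob_space by simp
  finally have "l2_norm \<mu> (\<lambda>g. f g - F g) \<le> e / 2"
    by (rule power2_le_imp_le) (use e in simp)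
  then show "\<exists>g\<in>matrix_coeff_sums \<inter> L2 \<mu>. l2_norm \<mu> (\<lambda>x. f x - g x) < e"
    using FL matrix_coeffs_sums[OF F(1)] e by (intro bexI[of _ F]) auto
qed

end

(* x is the operator R_x defining the Hardy space, as an element of the complexified Lie algebra in
   the basis E1, E2, E3, and p0 l spans the kernel of x on Sym (2 * l). *)
locale hardy_data = haar_SO3 +
  fixes A :: "(real^3^3 \<Rightarrow> complex) set" and x :: "complex^3" and p0 :: "nat \<Rightarrow> bipoly"
  assumes A_killed: "f \<in> A \<Longrightarrow> \<exists>f'. (\<forall>j. rderiv j f (f' j)) \<and> (\<forall>g\<in>SO3. (\<Sum>j\<in>UNIV. x $ j * f' j g) = 0)"
    and line_in_A: "F \<in> fun_span (\<Union>l. line_blk (p0 l)) \<Longrightarrow> \<exists>a\<in>A. \<forall>g\<in>SO3. a g = F g"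
    and p0_in_Sym: "p0 l \<in> Sym (2 * l)"
    and kernel: "p \<in> Sym (2 * l) \<Longrightarrow> dX x p = (\<lambda>z0 z1. 0) \<Longrightarrow> \<exists>c. p = (\<lambda>z0 z1. c * p0 l z0 z1)"
begin

lemma A_continuous: "f \<in> A \<Longrightarrow> continuous_on SO3 f"
  using A_killed rderivD(1) by blast

lemma closure_orth:
  assumes h: "h \<in> l2_closure \<mu> A" and q: "\<And>i. q i \<in> Sym (2 * l)"
  shows "l2_inner \<mu> h (bsum n (\<lambda>i. dX (cnj_vec x) (q i))) = 0"
proof (rule l2_closure_orth[OF h])
  show "bsum n (\<lambda>i. dX (cnj_vec x) (q i)) \<in> L2 \<mu>"
    by (rule bsum_L2[where l = l]) (rule dX_in_Sym[OF q])
  fix a assume "a \<in> A"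
  then obtain a' where a': "\<And>j. rderiv j a (a' j)" "\<And>g. g \<in> SO3 \<Longrightarrow> (\<Sum>j\<in>UNIV. x $ j * a' j g) = 0"
    using A_killed by blast
  have "l2_inner \<mu> (\<lambda>g. \<Sum>j\<in>UNIV. x $ j * a' j g) (bsum n q) = (\<integral>g. 0 \<partial>\<mu>)"
    unfolding l2_inner_def by (rule Bochner_Integration.integral_cong) (simp_all add: a'(2))
  then show "l2_inner \<mu> a (bsum n (\<lambda>i. dX (cnj_vec x) (q i))) = 0"
    using inner_dX[OF a'(1) q] by simp
qed

text \<open>Orthogonality is tested against R_y R_x F, which gives that R_x F has norm 0. R_x F is
  continuous, so it vanishes pointwise; by injectivity x then kills each form in the tuple of
  F.\<close>

lemma orth_imp_line:
  assumes F: "F \<in> blk l"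
    and orth: "\<And>q. (\<And>i. q i \<in> Sym (2 * l)) \<Longrightarrow> l2_inner \<mu> F (bsum (2 * l) (\<lambda>i. dX (cnj_vec x) (q i))) = 0"
  shows "F \<in> line_blk (p0 l)"
proof -
  obtain q where q: "\<And>i. q i \<in> Sym (2 * l)" "F = bsum (2 * l) q"
    using blk_bsum[OF F] by blast
  let ?D = "bsum (2 * l) (\<lambda>i. dX x (q i))"
  have D: "(\<lambda>g. \<Sum>j\<in>UNIV. x $ j * bsum (2 * l) (\<lambda>i. dE j (q i)) g) = ?D"
    by (simp only: dX_def bsum_sum bsum_cmul)
  have DS: "dX x (q i) \<in> Sym (2 * l)" for i
    by (rule dX_in_Sym[OF q(1)])
  have DL: "?D \<in> L2 \<mu>" and DB: "?D \<in> blk l"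
    by (rule bsum_L2[where l = l], rule DS) (rule bsum_in_blk, rule DS)
  have "l2_inner \<mu> F (bsum (2 * l) (\<lambda>i. dX (cnj_vec x) (dX x (q i)))) = 0"
    by (rule orth) (rule DS)
  moreover have "l2_inner \<mu> (bsum (2 * l) q) (bsum (2 * l) (\<lambda>i. dX (cnj_vec x) (dX x (q i)))) =
      l2_inner \<mu> (\<lambda>g. \<Sum>j\<in>UNIV. x $ j * bsum (2 * l) (\<lambda>i. dE j (q i)) g) ?D"
    by (rule inner_dX[where l = l, OF rderiv_bsum[where l = l, OF q(1)] DS])
  ultimately have "l2_inner \<mu> ?D ?D = 0"
    by (simp only: D q(2))
  then have "l2_norm \<mu> ?D = 0"
    by (simp add: l2_inner_self)
  then have "AE g in \<mu>. ?D g = 0"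
    using l2_norm_zero_iff[OF DL] by blast
  then have "?D g = 0" if "g \<in> SO3" for g
    using continuous_AE_zero[OF blk_continuous[OF DB]] that by blast
  then have "dX x (q i) = (\<lambda>z0 z1. 0)" if "i \<le> 2 * l" for i
    using vanishing_imp_zero[where l = l and r = "\<lambda>i. dX x (q i)" and i = i] DS that by (simp add: bsum_def)
  then have "\<forall>i. \<exists>c. i \<le> 2 * l \<longrightarrow> q i = (\<lambda>z0 z1. c * p0 l z0 z1)"
    using kernel[OF q(1)] by blast
  then obtain c where c: "\<And>i. i \<le> 2 * l \<Longrightarrow> q i = (\<lambda>z0 z1. c i * p0 l z0 z1)"
    using choice[of "\<lambda>i c. i \<le> 2 * l \<longrightarrow> q i = (\<lambda>z0 z1. c * p0 l z0 z1)"] by blast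
  have "F = (\<lambda>g. \<Sum>i\<le>2*l. act g (\<lambda>z0 z1. c i * p0 l z0 z1) 1 (of_nat i))"
    unfolding q(2) by (rule ext) (simp add: bsum_def c)
  then show ?thesis
    using line_blk_reprI by simp
qed

lemma line_in_closure:
  assumes "s \<in> L2 \<mu>" "F \<in> fun_span (\<Union>l. line_blk (p0 l))" "AE g in \<mu>. s g = F g"
  shows "s \<in> l2_closure \<mu> A"
proof -
  obtain a where a: "a \<in> A" "\<And>g. g \<in> SO3 \<Longrightarrow> a g = F g"
    using line_in_A[OF assms(2)] by blast
  have "a \<in> l2_closure \<mu> A"
    by (rule l2_closure_base[OF a(1) continuous_in_L2[OF A_continuous[OF a(1)]]])
  moreover have "AE g in \<mu>. a g = s g"
    using assms(3) AE_space by eventually_elim (simp add: a(2))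
  ultimately show ?thesis
    by (rule l2_closure_AE[OF _ assms(1)])
qed

lemma line_blk_in_blk: "line_blk (p0 l) \<subseteq> blk l"
  by (rule line_blk_subset_blk[OF p0_in_Sym])

theorem hardy_block: "l2_closure \<mu> A \<inter> ae_space \<mu> (blk l) = ae_space \<mu> (line_blk (p0 l))"
proof (intro equalityI subsetI)
  fix h assume h: "h \<in> l2_closure \<mu> A \<inter> ae_space \<mu> (blk l)"
  then obtain F where F: "F \<in> blk l" "AE g in \<mu>. h g = F g" and hL: "h \<in> L2 \<mu>"
    by (auto simp: ae_space_def)
  have "F \<in> line_blk (p0 l)"
  proof (rule orth_imp_line[OF F(1)])
    fix q :: "nat \<Rightarrow> bipoly" assume q: "\<And>i. q i \<in> Sym (2 * l)"
    have bL: "bsum (2 * l) (\<lambda>i. dX (cnj_vec x) (q i)) \<in> L2 \<mu>"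
      by (rule bsum_L2[where l = l]) (rule dX_in_Sym[OF q])
    have "l2_inner \<mu> F (bsum (2 * l) (\<lambda>i. dX (cnj_vec x) (q i))) = l2_inner \<mu> h (bsum (2 * l) (\<lambda>i. dX (cnj_vec x) (q i)))"
      by (rule l2_inner_cong_AE) (use F(2) L2D(1)[OF blk_L2[OF F(1)]] L2D(1)[OF hL] L2D(1)[OF bL] in auto)
    then show "l2_inner \<mu> F (bsum (2 * l) (\<lambda>i. dX (cnj_vec x) (q i))) = 0"
      using closure_orth[OF _ q] h by simp
  qed
  then show "h \<in> ae_space \<mu> (line_blk (p0 l))"
    using F hL by (auto simp: ae_space_def)
next
  fix h assume "h \<in> ae_space \<mu> (line_blk (p0 l))"
  then obtain F where F: "F \<in> line_blk (p0 l)" "AE g in \<mu>. h g = F g" and hL: "h \<in> L2 \<mu>"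
    by (auto simp: ae_space_def)
  have "F \<in> fun_span (\<Union>l. line_blk (p0 l))"
    using F(1) by (intro fun_span_base) auto
  then have "h \<in> l2_closure \<mu> A"
    by (rule line_in_closure[OF hL _ F(2)])
  then show "h \<in> l2_closure \<mu> A \<inter> ae_space \<mu> (blk l)"
    using F hL line_blk_in_blk by (auto simp: ae_space_def)
qed

lemma line_closed: "l2_closed_subspace \<mu> (ae_space \<mu> (line_blk (p0 l)))"
  unfolding l2_closed_subspace_def
proof (intro equalityI subsetI)
  fix f assume "f \<in> ae_space \<mu> (line_blk (p0 l))"
  then show "f \<in> l2_closure \<mu> (fun_span (ae_space \<mu> (line_blk (p0 l))))"
    by (intro l2_closure_base fun_span_base) (auto simp: ae_space_def)
next
  fix f assume f: "f \<in> l2_closure \<mu> (fun_span (ae_space \<mu> (line_blk (p0 l))))"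
  note eq = line_blk_eq[OF p0_in_Sym]
  have sub: "line_basis (2 * l) (p0 l) \<subseteq> L2 \<mu>"
    using line_blk_in_blk blk_L2 fun_span_base unfolding eq by blast
  have "\<exists>F\<in>fun_span (line_basis (2 * l) (p0 l)). AE y in \<mu>. f y = F y"
  proof (rule l2_closure_finite_span[OF finite_line_basis sub f])
    fix s assume "s \<in> fun_span (ae_space \<mu> (line_blk (p0 l)))"
    then obtain F where "F \<in> fun_span (line_blk (p0 l))" "AE g in \<mu>. s g = F g"
      using fun_span_ae[of s \<mu> "\<lambda>_. line_blk (p0 l)" "{()}"] by auto
    moreover have "fun_span (line_blk (p0 l)) \<subseteq> fun_span (line_basis (2 * l) (p0 l))"
      by (rule fun_span_subset) (simp add: eq)
    ultimately show "\<exists>F\<in>fun_span (line_basis (2 * l) (p0 l)). AE y in \<mu>. s y = F y"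
      by blast
  qed
  then show "f \<in> ae_space \<mu> (line_blk (p0 l))"
    using f by (auto simp: ae_space_def eq l2_closure_def)
qed

text \<open>h is close to a finite sum G of matrix coefficients, which need not lie in the Hardy
  space. The projection s of h onto the same blocks is at least as close, and its components do lie
  in the lines: h and h - p l are both orthogonal to the range of R_y on block l, hence so is p
  l.\<close>

lemma closure_approx:
  assumes h: "h \<in> l2_closure \<mu> A" and e: "e > 0"
  shows "\<exists>s\<in>fun_span (\<Union>l. ae_space \<mu> (line_blk (p0 l))) \<inter> L2 \<mu>. l2_norm \<mu> (\<lambda>g. h g - s g) < e"
proof -
  have hL: "h \<in> L2 \<mu>" using h by (simp add: l2_closure_def)
  have "h \<in> l2_closure \<mu> matrix_coeff_sums"
    using l2_closure_mono_closure[of A \<mu> matrix_coeff_sums] continuous_in_closure A_continuous h by blast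
  then obtain G where G: "G \<in> matrix_coeff_sums" "l2_norm \<mu> (\<lambda>g. h g - G g) < e"
    using e unfolding l2_closure_def by blast
  then obtain N where N: "G \<in> fun_span (\<Union>l<N. blk_basis l)"
    by (auto simp: matrix_coeff_sums_def)
  have bL: "blk_basis l \<subseteq> L2 \<mu>" for l
    using blk_L2 fun_span_base unfolding blk_eq by blast
  have "\<forall>l. \<exists>p\<in>fun_span (blk_basis l). \<forall>b\<in>blk_basis l. l2_inner \<mu> (\<lambda>g. h g - p g) b = 0"
    using l2_projection[OF finite_blk_basis bL hL] by blast
  then obtain p where p: "\<And>l. p l \<in> fun_span (blk_basis l)"
      "\<And>l b. b \<in> blk_basis l \<Longrightarrow> l2_inner \<mu> (\<lambda>g. h g - p l g) b = 0"
    by metis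
  have pb: "p l \<in> blk l" for l using p(1) by (simp add: blk_eq)
  have pL: "p l \<in> L2 \<mu>" for l by (rule blk_L2[OF pb])
  have p_line: "p l \<in> line_blk (p0 l)" for l
  proof (rule orth_imp_line[OF pb])
    fix q :: "nat \<Rightarrow> bipoly" assume q: "\<And>i. q i \<in> Sym (2 * l)"
    let ?b = "bsum (2 * l) (\<lambda>i. dX (cnj_vec x) (q i))"
    have b: "?b \<in> blk l" by (rule bsum_in_blk) (rule dX_in_Sym[OF q])
    then have "l2_inner \<mu> (\<lambda>g. h g - p l g) ?b = 0"
      using l2_orth_span[of ?b "blk_basis l" \<mu> "\<lambda>g. h g - p l g"] bL L2_diff[OF hL pL] p(2) by (simp add: blk_eq)
    then show "l2_inner \<mu> (p l) ?b = 0"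
      using l2_inner_diff_left[OF hL pL blk_L2[OF b]] closure_orth[OF h q] by simp
  qed
  define s where "s = (\<lambda>g. \<Sum>l<N. p l g)"
  have s1: "s \<in> fun_span (\<Union>l. ae_space \<mu> (line_blk (p0 l)))"
    unfolding s_def
  proof (intro fun_span_sum fun_span_base)
    fix l show "p l \<in> (\<Union>l. ae_space \<mu> (line_blk (p0 l)))"
      using p_line[of l] pL[of l] by (auto simp: ae_space_def)
  qed
  have sL: "s \<in> L2 \<mu>"
    using fun_span_L2[of "\<Union>l. ae_space \<mu> (line_blk (p0 l))" \<mu>] s1 by (auto simp: ae_space_def)
  have s2: "s \<in> fun_span (\<Union>l<N. blk_basis l)"
    unfolding s_def
  proof (intro fun_span_sum)
    fix l assume "l \<in> {..<N}"
    then have "fun_span (blk_basis l) \<subseteq> fun_span (\<Union>l<N. blk_basis l)" by (intro fun_span_mono) auto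
    then show "p l \<in> fun_span (\<Union>l<N. blk_basis l)" using p(1) by blast
  qed
  \<comment> \<open>Different blocks are orthogonal, so the sum of the projections onto the blocks
    is the projection onto their joint span.\<close>
  have "\<forall>b\<in>(\<Union>l<N. blk_basis l). l2_inner \<mu> (\<lambda>g. h g - s g) b = 0"
  proof
    fix b assume "b \<in> (\<Union>l<N. blk_basis l)"
    then obtain l where l: "l < N" "b \<in> blk_basis l" by blast
    then have bb: "b \<in> blk l" by (simp add: blk_eq fun_span_base)
    note bL' = blk_L2[OF bb]
    have "l2_inner \<mu> s b = (\<Sum>k<N. l2_inner \<mu> (p k) b)"
      unfolding s_def using l2_inner_sum_left[of "{..<N}" p \<mu> b] pL bL' by simp
    also have "\<dots> = (\<Sum>k<N. if k = l then l2_inner \<mu> (p l) b else 0)"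
      by (intro sum.cong refl) (auto intro: blk_orth[OF _ pb bb])
    also have "\<dots> = l2_inner \<mu> (p l) b" using l(1) by simp
    finally show "l2_inner \<mu> (\<lambda>g. h g - s g) b = 0"
      using p(2)[OF l(2)] l2_inner_diff_left[OF hL sL bL'] l2_inner_diff_left[OF hL pL bL'] by simp
  qed
  then have "l2_norm \<mu> (\<lambda>g. h g - s g) \<le> l2_norm \<mu> (\<lambda>g. h g - G g)"
    using bL by (intro l2_norm_projection_le[of "\<Union>l<N. blk_basis l"] hL s2 N) auto
  then show ?thesis
    using G(2) s1 sL by (intro bexI[of _ s]) auto
qed

theorem hardy_direct_sum: "l2_direct_sum \<mu> (l2_closure \<mu> A) (\<lambda>l. ae_space \<mu> (line_blk (p0 l)))"
  unfolding l2_direct_sum_def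
proof (intro conjI allI impI ballI)
  show "l2_closed_subspace \<mu> (ae_space \<mu> (line_blk (p0 l)))" for l
    by (rule line_closed)
  fix l m f g assume lm: "l \<noteq> m" and f: "f \<in> ae_space \<mu> (line_blk (p0 l))" and g: "g \<in> ae_space \<mu> (line_blk (p0 m))"
  obtain F G where FG: "F \<in> line_blk (p0 l)" "AE x in \<mu>. f x = F x" "G \<in> line_blk (p0 m)" "AE x in \<mu>. g x = G x"
    and L: "f \<in> L2 \<mu>" "g \<in> L2 \<mu>"
    using f g by (auto simp: ae_space_def)
  have b: "F \<in> blk l" "G \<in> blk m" using FG line_blk_in_blk by auto
  have "l2_inner \<mu> f g = l2_inner \<mu> F G"
    by (rule l2_inner_cong_AE) (use FG L2D(1)[OF L(1)] L2D(1)[OF L(2)] L2D(1)[OF blk_L2[OF b(1)]] L2D(1)[OF blk_L2[OF b(2)]] in auto)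
  then show "l2_inner \<mu> f g = 0"
    using blk_orth[OF lm b] by simp
next
  show "l2_closure \<mu> A = l2_closure \<mu> (fun_span (\<Union>l. ae_space \<mu> (line_blk (p0 l))))"
  proof
    show "l2_closure \<mu> A \<subseteq> l2_closure \<mu> (fun_span (\<Union>l. ae_space \<mu> (line_blk (p0 l))))"
      using closure_approx by (auto simp: l2_closure_def[of \<mu> "fun_span _"]) (simp add: l2_closure_def)
    show "l2_closure \<mu> (fun_span (\<Union>l. ae_space \<mu> (line_blk (p0 l)))) \<subseteq> l2_closure \<mu> A"
    proof (rule l2_closure_mono_closure, rule subsetI)
      fix s assume s: "s \<in> fun_span (\<Union>l. ae_space \<mu> (line_blk (p0 l))) \<inter> L2 \<mu>"
      then obtain F where "F \<in> fun_span (\<Union>l. line_blk (p0 l))" "AE g in \<mu>. s g = F g"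
        using fun_span_ae[of s \<mu> "\<lambda>l. line_blk (p0 l)" UNIV] by auto
      then show "s \<in> l2_closure \<mu> A"
        using s by (intro line_in_closure) auto
    qed
  qed
qed

end

section \<open>Matrix representations\<close>

lemma tendsto_det:
  fixes X :: "real \<Rightarrow> complex Matrix.mat"
  assumes X: "\<And>a. X a \<in> carrier_mat n n" and L: "L \<in> carrier_mat n n"
    and lim: "\<And>i k. i < n \<Longrightarrow> k < n \<Longrightarrow> ((\<lambda>a. X a $$ (i, k)) \<longlongrightarrow> L $$ (i, k)) F"
  shows "((\<lambda>a. Determinant.det (X a)) \<longlongrightarrow> Determinant.det L) F"
  unfolding det_def'[OF X] det_def'[OF L]
proof (intro tendsto_sum tendsto_mult tendsto_const tendsto_prod)
  fix p i assume "p \<in> {p. p permutes {0..<n}}" "i \<in> {0..<n}"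
  then have "i < n" "p i < n"
    using permutes_in_image[of p "{0..<n}" i] by auto
  then show "((\<lambda>a. X a $$ (i, p i)) \<longlongrightarrow> L $$ (i, p i)) F"
    by (rule lim)
qed

lemma mat_mult_entry:
  assumes "A \<in> carrier_mat n n" "B \<in> carrier_mat n n" "i < n" "j < n"
  shows "(A * B) $$ (i, j) = (\<Sum>k\<in>{0..<n}. A $$ (i, k) * B $$ (k, j))"
  using assms by (simp add: scalar_prod_def)

(* The averages of a continuous one-parameter group of matrices over [t, t + a] are differentiable
   in t; for small a the average over [0, a] is invertible, so the group itself is differentiable. *)
lemma one_parameter_group_differentiable:
  fixes M :: "real \<Rightarrow> complex Matrix.mat"
  assumes M: "\<And>t. M t \<in> carrier_mat n n" and M0: "M 0 = 1\<^sub>m n"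
    and mult: "\<And>s t. M (s + t) = M s * M t"
    and cont: "\<And>i k. i < n \<Longrightarrow> k < n \<Longrightarrow> continuous_on UNIV (\<lambda>t. M t $$ (i, k))"
    and ij: "i < n" "j < n"
  shows "\<exists>D. ((\<lambda>t. M t $$ (i, j)) has_vector_derivative D) (at 0)"
proof -
  \<comment> \<open>The interval leaves room for t + a with |t| < 1 and 0 < a < 1.\<close>
  have "\<exists>F. \<forall>t\<in>{-2..2}. (F has_vector_derivative M t $$ (i, k)) (at t within {-2..2})"
    if "i < n" "k < n" for i k
    using antiderivative_continuous[OF continuous_on_subset[OF cont[OF that] subset_UNIV], of "-2" 2] by metis
  then have "\<forall>i k. \<exists>F. i < n \<and> k < n \<longrightarrow>
      (\<forall>t\<in>{-2..2}. (F has_vector_derivative M t $$ (i, k)) (at t within {-2..2}))"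
    by blast
  then obtain F where F: "\<And>i k t. i < n \<Longrightarrow> k < n \<Longrightarrow> t \<in> {-2..2} \<Longrightarrow>
      (F i k has_vector_derivative M t $$ (i, k)) (at t within {-2..2})"
    by metis
  have Fat: "(F i k has_vector_derivative M t $$ (i, k)) (at t)" if "i < n" "k < n" "t \<in> {-2<..<2}" for i k t
    using F[OF that(1,2), of t] that(3) at_within_interior[of t "{-2..2}"] by simp
  define X where "X a = Matrix.mat n n (\<lambda>(i, k). (F i k (0 + a) - F i k 0) /\<^sub>R a)" for a
  have X: "X a \<in> carrier_mat n n" for a by (simp add: X_def)
  have lim: "((\<lambda>a. X a $$ (i, k)) \<longlongrightarrow> 1\<^sub>m n $$ (i, k)) (at_right 0)" if "i < n" "k < n" for i k
  proof -
    have "((\<lambda>a. (F i k (0 + a) - F i k 0) /\<^sub>R a) \<longlongrightarrow> M 0 $$ (i, k)) (at 0)"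
      by (rule has_vector_derivative_quotient) (simp add: Fat that)
    then show ?thesis
      using that by (simp add: X_def M0 filterlim_at_split)
  qed
  have "((\<lambda>a. Determinant.det (X a)) \<longlongrightarrow> Determinant.det (1\<^sub>m n :: complex Matrix.mat)) (at_right 0)"
    by (rule tendsto_det[OF X one_carrier_mat lim])
  then have "((\<lambda>a. Determinant.det (X a)) \<longlongrightarrow> 1) (at_right 0)"
    by simp
  then have "\<forall>\<^sub>F a in at_right 0. Determinant.det (X a) \<noteq> 0"
    by (rule tendsto_imp_eventually_ne) simp
  moreover have "\<forall>\<^sub>F a in at_right 0. a < (1::real)" "\<forall>\<^sub>F a in at_right 0. (0::real) < a"
    by (auto simp: eventually_at_right_less eventually_at_right[of 0 1] intro: exI[of _ 1])
  ultimately have "\<forall>\<^sub>F a in at_right 0. Determinant.det (X a) \<noteq> 0 \<and> a < 1 \<and> 0 < a"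
    by (intro eventually_conj)
  then obtain a where a: "Determinant.det (X a) \<noteq> 0" "a < 1" "0 < a"
    using eventually_happens'[OF trivial_limit_at_right_real] by blast
  obtain C where C: "C \<in> carrier_mat n n" "X a * C = 1\<^sub>m n"
    using det_non_zero_imp_unit[OF X a(1)] by (auto simp: Units_def ring_mat_def)
  have avg: "(M t * X a) $$ (i, k) = (F i k (t + a) - F i k t) /\<^sub>R a"
    if t: "\<bar>t\<bar> < 1" and ik: "i < n" "k < n" for t i k
  proof -
    \<comment> \<open>As functions of s, both terms have derivative M(t + s) by the group law, so
      their difference is constant.\<close>
    define \<phi> where "\<phi> s = F i k (t + s) - (\<Sum>m\<in>{0..<n}. M t $$ (i, m) * F m k s)" for s
    have "(\<phi> has_vector_derivative 0) (at s within {0..a})" if s: "s \<in> {0..a}" for s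
    proof -
      have "t + s \<in> {-2<..<2}" "s \<in> {-2<..<2}" using s t a by auto
      then have 1: "(F i k has_vector_derivative M (t + s) $$ (i, k)) (at (t + s))"
        and 2: "\<And>m. m < n \<Longrightarrow> (F m k has_vector_derivative M s $$ (m, k)) (at s)"
        using Fat ik by auto
      have "((\<lambda>s. t + s) has_vector_derivative 1) (at s)"
        by (auto intro!: derivative_eq_intros)
      from vector_diff_chain_at[OF this 1]
      have "((\<lambda>s. F i k (t + s)) has_vector_derivative M (t + s) $$ (i, k)) (at s)"
        by (simp add: o_def)
      moreover have "((\<lambda>s. \<Sum>m\<in>{0..<n}. M t $$ (i, m) * F m k s) has_vector_derivative
          (\<Sum>m\<in>{0..<n}. M t $$ (i, m) * M s $$ (m, k))) (at s)"
        by (intro has_vector_derivative_sum has_vector_derivative_mult_right 2) simp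
      moreover have "M (t + s) $$ (i, k) = (\<Sum>m\<in>{0..<n}. M t $$ (i, m) * M s $$ (m, k))"
        using M[of t] M[of s] ik by (simp add: mult scalar_prod_def)
      ultimately have "(\<phi> has_vector_derivative M (t + s) $$ (i, k) - M (t + s) $$ (i, k)) (at s)"
        unfolding \<phi>_def by (simp only:) (rule has_vector_derivative_diff)
      then have "(\<phi> has_vector_derivative 0) (at s)"
        by simp
      then show ?thesis by (rule has_vector_derivative_at_within)
    qed
    then obtain c where c: "\<And>s. s \<in> {0..a} \<Longrightarrow> \<phi> s = c"
      using has_vector_derivative_zero_constant[of "{0..a}" \<phi>] by auto
    then have "\<phi> a = \<phi> 0" using a by simp
    then have "F i k (t + a) - F i k t = (\<Sum>m\<in>{0..<n}. M t $$ (i, m) * (F m k a - F m k 0))"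
      by (simp add: \<phi>_def right_diff_distrib sum_subtractf algebra_simps)
    then show ?thesis
      using M[of t] ik by (simp add: X_def scalar_prod_def scaleR_sum_right)
  qed
  have ent: "M t $$ (i, j) = (\<Sum>k\<in>{0..<n}. (F i k (t + a) - F i k t) /\<^sub>R a * C $$ (k, j))" if "\<bar>t\<bar> < 1" for t
  proof -
    \<comment> \<open>C inverts the average X a, so M t is recovered from M t X a, whose entries are
      differentiable in t.\<close>
    have "M t = (M t * X a) * C"
      using M[of t] X[of a] C by (simp add: assoc_mult_mat[of _ n n _ n _ n])
    then have "M t $$ (i, j) = ((M t * X a) * C) $$ (i, j)" by (rule arg_cong)
    also have "\<dots> = (\<Sum>k\<in>{0..<n}. (M t * X a) $$ (i, k) * C $$ (k, j))"
      by (rule mat_mult_entry[OF mult_carrier_mat[OF M X] C(1) ij])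
    finally show ?thesis using avg[OF that ij(1)] by simp
  qed
  have der: "((\<lambda>t. \<Sum>k\<in>{0..<n}. (F i k (t + a) - F i k t) /\<^sub>R a * C $$ (k, j)) has_vector_derivative
      (\<Sum>k\<in>{0..<n}. (M a $$ (i, k) - M 0 $$ (i, k)) /\<^sub>R a * C $$ (k, j))) (at 0)"
  proof (intro has_vector_derivative_sum has_vector_derivative_mult_left
      bounded_linear.has_vector_derivative[OF bounded_linear_scaleR_right] has_vector_derivative_diff)
    fix k assume "k \<in> {0..<n}"
    then have k: "k < n" by simp
    show "(F i k has_vector_derivative M 0 $$ (i, k)) (at 0)"
      using Fat[OF ij(1) k, of 0] by simp
    have 1: "((\<lambda>t. t + a) has_vector_derivative 1) (at 0)"
      by (auto intro!: derivative_eq_intros)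
    have 2: "(F i k has_vector_derivative M a $$ (i, k)) (at (0 + a))"
      using Fat[OF ij(1) k, of a] a by simp
    show "((\<lambda>t. F i k (t + a)) has_vector_derivative M a $$ (i, k)) (at 0)"
      using vector_diff_chain_at[OF 1 2] by (simp add: o_def)
  qed
  show ?thesis
    by (rule exI, rule has_vector_derivative_transform_within_open[OF der, where S = "{-1<..<1}"])
      (simp_all only: open_greaterThanLessThan greaterThanLessThan_iff, simp, rule ent[symmetric], simp add: abs_less_iff)
qed

lemma vec_linear_expand:
  fixes T :: "complex Matrix.vec \<Rightarrow> bipoly"
  assumes add: "\<And>v w. v \<in> carrier_vec n \<Longrightarrow> w \<in> carrier_vec n \<Longrightarrow> T (v + w) = bi_add (T v) (T w)"
    and smult: "\<And>c v. v \<in> carrier_vec n \<Longrightarrow> T (c \<cdot>\<^sub>v v) = bi_smult c (T v)"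
    and u: "u \<in> carrier_vec n"
  shows "T u z0 z1 = (\<Sum>i<n. vec_index u i * T (unit_vec n i) z0 z1)"
proof -
  have "T (Matrix.vec n (\<lambda>i. if i < m then vec_index u i else 0)) z0 z1 = (\<Sum>i<m. vec_index u i * T (unit_vec n i) z0 z1)"
    if "m \<le> n" for m
    using that
  proof (induction m)
    case 0
    have "Matrix.vec n (\<lambda>i. if i < 0 then vec_index u i else 0) = 0 \<cdot>\<^sub>v 0\<^sub>v n"
      by (intro eq_vecI) auto
    then show ?case using smult[of "0\<^sub>v n" 0] by (simp add: bi_smult_def)
  next
    case (Suc m)
    have "Matrix.vec n (\<lambda>i. if i < Suc m then vec_index u i else 0) =
        Matrix.vec n (\<lambda>i. if i < m then vec_index u i else 0) + vec_index u m \<cdot>\<^sub>v unit_vec n m"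
      by (intro eq_vecI) (auto simp: less_Suc_eq unit_vec_def)
    then show ?case
      using Suc add[of "Matrix.vec n (\<lambda>i. if i < m then vec_index u i else 0)" "vec_index u m \<cdot>\<^sub>v unit_vec n m"]
        smult[of "unit_vec n m" "vec_index u m"]
      by (simp add: bi_add_def bi_smult_def)
  qed
  moreover have "Matrix.vec n (\<lambda>i. if i < n then vec_index u i else 0) = u"
    using u by (intro eq_vecI) auto
  ultimately show ?thesis by (metis order_refl)
qed

section \<open>From the Lie algebra realization to the group action\<close>

locale sym_rep =
  fixes l n :: nat and \<pi> :: "real^3^3 \<Rightarrow> complex Matrix.mat" and B :: "bipoly \<Rightarrow> bipoly \<Rightarrow> complex"
    and S :: "complex Matrix.vec \<Rightarrow> bipoly"
  assumes n_eq: "n = 2 * l + 1" and rep: "unitary_rep n \<pi>"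
    and realization: "sym_realization l \<pi> B S"
begin

abbreviation "V \<equiv> carrier_vec n :: complex Matrix.vec set"

lemma
  shows S_bij: "bij_betw S V (Sym (2 * l))"
    and S_add: "v \<in> V \<Longrightarrow> w \<in> V \<Longrightarrow> S (v + w) = bi_add (S v) (S w)"
    and S_smult: "v \<in> V \<Longrightarrow> S (c \<cdot>\<^sub>v v) = bi_smult c (S v)"
    and S_inner: "v \<in> V \<Longrightarrow> w \<in> V \<Longrightarrow> B (S v) (S w) = v \<bullet>c w"
    and S_raise: "v \<in> V \<Longrightarrow> S (rep_deriv_c n \<pi> E1 E2 v) = sym_raise (S v)"
    and S_lower: "v \<in> V \<Longrightarrow> S (rep_deriv_c n \<pi> (- E1) E2 v) = sym_lower (S v)"
    and S_weight: "v \<in> V \<Longrightarrow> S (rep_deriv_c n \<pi> 0 (2 *\<^sub>R E3) v) = sym_weight (S v)"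
  using realization unfolding sym_realization_def Let_def n_eq[symmetric] by blast+

lemma
  shows rep_carrier: "g \<in> SO3 \<Longrightarrow> \<pi> g \<in> carrier_mat n n"
    and rep_one: "\<pi> (Finite_Cartesian_Product.mat 1) = 1\<^sub>m n"
    and rep_mult: "g \<in> SO3 \<Longrightarrow> h \<in> SO3 \<Longrightarrow> \<pi> (g ** h) = \<pi> g * \<pi> h"
    and rep_unitary: "g \<in> SO3 \<Longrightarrow> v \<in> V \<Longrightarrow> w \<in> V \<Longrightarrow> (\<pi> g *\<^sub>v v) \<bullet>c (\<pi> g *\<^sub>v w) = v \<bullet>c w"
    and rep_cont: "i < n \<Longrightarrow> j < n \<Longrightarrow> continuous_on SO3 (\<lambda>g. \<pi> g $$ (i, j))"
  using rep unfolding unitary_rep_def by blast+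

lemma rep_vec: "g \<in> SO3 \<Longrightarrow> v \<in> V \<Longrightarrow> \<pi> g *\<^sub>v v \<in> V"
  using rep_carrier mult_mat_vec_carrier by blast

lemma S_in_Sym: "v \<in> V \<Longrightarrow> S v \<in> Sym (2 * l)"
  using S_bij bij_betwE by blast

lemma S_expand: "u \<in> V \<Longrightarrow> S u z0 z1 = (\<Sum>i<n. vec_index u i * S (unit_vec n i) z0 z1)"
  by (rule vec_linear_expand[OF S_add S_smult])

lemma rep_rot_derivative:
  assumes "i < n" "k < n"
  shows "\<exists>D. ((\<lambda>t. \<pi> (rot j t) $$ (i, k)) has_vector_derivative D) (at 0)"
proof (rule one_parameter_group_differentiable[OF _ _ _ _ assms])
  show "\<pi> (rot j t) \<in> carrier_mat n n" for t
    by (intro rep_carrier rot_in_SO3)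
  show "\<pi> (rot j 0) = 1\<^sub>m n"
    by (simp add: rep_one)
  show "\<pi> (rot j (s + t)) = \<pi> (rot j s) * \<pi> (rot j t)" for s t
    by (simp only: rot_add rep_mult rot_in_SO3)
  show "continuous_on UNIV (\<lambda>t. \<pi> (rot j t) $$ (i, k))" if "i < n" "k < n" for i k
  proof (rule continuous_on_compose2[OF rep_cont[OF that]])
    show "continuous_on UNIV (rot j)"
      using continuous_on_translate_rot[of UNIV "Finite_Cartesian_Product.mat 1" j] by simp
  qed auto
qed

abbreviation "drep j v \<equiv> rep_deriv n \<pi> (Egen j) v"

lemma drep:
  assumes v: "v \<in> V" and i: "i < n"
  shows "((\<lambda>t. vec_index (\<pi> (rot j t) *\<^sub>v v) i) has_vector_derivative vec_index (drep j v) i) (at 0)"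
proof -
  have eq: "(\<lambda>t. vec_index (\<pi> (rot j t) *\<^sub>v v) i) = (\<lambda>t. \<Sum>k\<in>{0..<n}. \<pi> (rot j t) $$ (i, k) * vec_index v k)"
  proof
    fix t show "vec_index (\<pi> (rot j t) *\<^sub>v v) i = (\<Sum>k\<in>{0..<n}. \<pi> (rot j t) $$ (i, k) * vec_index v k)"
      using rep_carrier[OF rot_in_SO3, of j t] v i by (simp add: scalar_prod_def del: add_is_1)
  qed
  have "\<exists>D. k < n \<longrightarrow> ((\<lambda>t. \<pi> (rot j t) $$ (i, k)) has_vector_derivative D) (at 0)" for k
    using rep_rot_derivative[OF i, of k] by blast
  then obtain D where D: "\<And>k. k < n \<Longrightarrow> ((\<lambda>t. \<pi> (rot j t) $$ (i, k)) has_vector_derivative D k) (at 0)"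
    using choice[of "\<lambda>k D. k < n \<longrightarrow> ((\<lambda>t. \<pi> (rot j t) $$ (i, k)) has_vector_derivative D) (at 0)"] by blast
  have "((\<lambda>t. vec_index (\<pi> (rot j t) *\<^sub>v v) i) has_vector_derivative (\<Sum>k\<in>{0..<n}. D k * vec_index v k)) (at 0)"
    unfolding eq by (intro has_vector_derivative_sum has_vector_derivative_mult_left D) simp
  then show ?thesis
    using i by (simp add: rep_deriv_def rot_def vector_derivative_at)
qed

lemma drep_carrier [simp]: "rep_deriv n \<pi> X v \<in> V"
  by (simp add: rep_deriv_def)

text \<open>Covers the directions -E1, 0 and 2 E3 that occur in
  \<open>sym_realization\<close>.\<close>

lemma rep_deriv_scale:
  assumes v: "v \<in> V"
  shows "rep_deriv n \<pi> (c *\<^sub>R Egen j) v = of_real c \<cdot>\<^sub>v drep j v"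
proof (intro eq_vecI)
  fix i assume "i < dim_vec (of_real c \<cdot>\<^sub>v drep j v)"
  then have i: "i < n" using drep_carrier[of "Egen j" v] by simp
  have 1: "((\<lambda>t. vec_index (\<pi> (rot j t) *\<^sub>v v) i) has_vector_derivative vec_index (drep j v) i) (at (0 * c))"
    using drep[OF v i] by simp
  have 2: "((\<lambda>t. t * c) has_vector_derivative c) (at 0)"
    by (auto intro!: derivative_eq_intros)
  have "(((\<lambda>t. vec_index (\<pi> (rot j t) *\<^sub>v v) i) \<circ> (\<lambda>t. t * c)) has_vector_derivative (c *\<^sub>R vec_index (drep j v) i)) (at 0)"
    by (rule vector_diff_chain_at[OF 2 1])
  then have "((\<lambda>t. vec_index (\<pi> (matexp (t *\<^sub>R (c *\<^sub>R Egen j))) *\<^sub>v v) i) has_vector_derivative (c *\<^sub>R vec_index (drep j v) i)) (at 0)"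
    by (simp add: o_def rot_def)
  then have "vec_index (rep_deriv n \<pi> (c *\<^sub>R Egen j) v) i = c *\<^sub>R vec_index (drep j v) i"
    using i by (simp only: rep_deriv_def index_vec vector_derivative_at)
  then show "vec_index (rep_deriv n \<pi> (c *\<^sub>R Egen j) v) i = vec_index (of_real c \<cdot>\<^sub>v drep j v) i"
    using i \<open>i < dim_vec (of_real c \<cdot>\<^sub>v drep j v)\<close>
    by (simp only: index_smult_vec scaleR_conv_of_real[where 'a = complex])
qed (simp add: rep_deriv_def)

lemma S_drep:
  assumes v: "v \<in> V"
  shows "S (drep j v) = dE j (S v)"
proof -
  have E: "Egen 1 = E1" "Egen 2 = E2" "Egen 3 = E3"
    by (simp_all add: Egen_def)
  have m: "rep_deriv n \<pi> (- E1) v = -1 \<cdot>\<^sub>v drep 1 v" "rep_deriv n \<pi> 0 v = 0 \<cdot>\<^sub>v drep 1 v"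
    "rep_deriv n \<pi> (2 *\<^sub>R E3) v = 2 \<cdot>\<^sub>v drep 3 v"
    using rep_deriv_scale[OF v, of "-1" 1] rep_deriv_scale[OF v, of 0 1] rep_deriv_scale[OF v, of 2 3]
    by (simp_all add: E)
  have c: "\<And>c j. c \<cdot>\<^sub>v drep j v \<in> V" by simp
  have r: "S (drep 1 v) z0 z1 + \<i> * S (drep 2 v) z0 z1 = sym_raise (S v) z0 z1" for z0 z1
    using S_raise[OF v] unfolding rep_deriv_c_def E[symmetric] S_add[OF drep_carrier c] S_smult[OF drep_carrier]
    by (simp add: bi_add_def bi_smult_def fun_eq_iff)
  have lo: "- S (drep 1 v) z0 z1 + \<i> * S (drep 2 v) z0 z1 = sym_lower (S v) z0 z1" for z0 z1
    using S_lower[OF v] unfolding rep_deriv_c_def m E(2)[symmetric] S_add[OF c c] S_smult[OF drep_carrier]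
    by (simp add: bi_add_def bi_smult_def fun_eq_iff)
  have w: "2 * \<i> * S (drep 3 v) z0 z1 = sym_weight (S v) z0 z1" for z0 z1
    using S_weight[OF v] S_smult[OF c[of 2 3], of \<i>] unfolding rep_deriv_c_def m
    by (simp add: S_add S_smult bi_add_def bi_smult_def fun_eq_iff mult.assoc mult.left_commute)
  have "S (drep 1 v) = dE 1 (S v)" "S (drep 2 v) = dE 2 (S v)" "S (drep 3 v) = dE 3 (S v)"
    unfolding dE_def fun_eq_iff r[symmetric] lo[symmetric] w[symmetric] by (simp_all add: field_simps)
  then show ?thesis
    using exhaust_3[of j] by auto
qed

text \<open>By the product rule the derivative is S(E_j w) - E_j(S w), which is 0 because S
  intertwines the Lie algebra actions.\<close>

lemma S_rot_infinitesimal: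
  assumes w: "w \<in> V"
  shows "((\<lambda>h. sub (su_rot j (- h)) (S (\<pi> (rot j h) *\<^sub>v w)) z0 z1) has_vector_derivative 0) (at 0)"
proof -
  have neg: "((\<lambda>h. sub (su_rot j (- h)) p z0 z1) has_vector_derivative - dE j p z0 z1) (at 0)"
    if "p \<in> Sym (2 * l)" for p
  proof -
    have 1: "((\<lambda>h. - h) has_vector_derivative -1) (at (0::real))"
      by (auto intro!: derivative_eq_intros)
    have 2: "((\<lambda>t. sub (su_rot j t) p z0 z1) has_vector_derivative dE j p z0 z1) (at (- 0))"
      using su_rot_has_vector_derivative[OF that] by simp
    show ?thesis
      using vector_diff_chain_at[OF 1 2] by (simp add: o_def)
  qed
  have uS: "S (unit_vec n i) \<in> Sym (2 * l)" for i
    by (intro S_in_Sym) simp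
  have ex: "sub U (S u) z0 z1 = (\<Sum>i<n. vec_index u i * sub U (S (unit_vec n i)) z0 z1)" if "u \<in> V" for U u
    unfolding sub_def by (rule S_expand[OF that])
  let ?u = "\<lambda>h. \<pi> (rot j h) *\<^sub>v w"
  have u0: "?u 0 = w" using w by (simp add: rep_one)
  have "((\<lambda>h. \<Sum>i<n. vec_index (?u h) i * sub (su_rot j (- h)) (S (unit_vec n i)) z0 z1) has_vector_derivative
      (\<Sum>i<n. vec_index (?u 0) i * - dE j (S (unit_vec n i)) z0 z1 +
        vec_index (drep j w) i * sub (su_rot j (- 0)) (S (unit_vec n i)) z0 z1)) (at 0)"
    by (intro has_vector_derivative_sum has_vector_derivative_mult drep[OF w] neg[OF uS]) simp
  moreover have "(\<Sum>i<n. vec_index w i * - dE j (S (unit_vec n i)) z0 z1) = - dE j (S w) z0 z1"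
  proof (rule vector_derivative_unique_at)
    show "((\<lambda>h. sub (su_rot j (- h)) (S w) z0 z1) has_vector_derivative
        (\<Sum>i<n. vec_index w i * - dE j (S (unit_vec n i)) z0 z1)) (at 0)"
      unfolding ex[OF w] by (intro has_vector_derivative_sum has_vector_derivative_mult_right neg[OF uS])
    show "((\<lambda>h. sub (su_rot j (- h)) (S w) z0 z1) has_vector_derivative - dE j (S w) z0 z1) (at 0)"
      by (rule neg[OF S_in_Sym[OF w]])
  qed
  moreover have "(\<Sum>i<n. vec_index (drep j w) i * S (unit_vec n i) z0 z1) = dE j (S w) z0 z1"
    using S_expand[OF drep_carrier, of "Egen j" w z0 z1] S_drep[OF w] by simp
  ultimately show ?thesis
    unfolding ex[OF rep_vec[OF rot_in_SO3 w]] by (simp only: u0 sum.distrib minus_zero su_rot_0 sub_one) simp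
qed

text \<open>Two solutions of the same linear differential equation: undoing the rotation after S
  gives a function of t whose derivative vanishes at every t, by translating the infinitesimal
  statement from 0 to t.\<close>

lemma S_rot:
  assumes v: "v \<in> V"
  shows "S (\<pi> (rot j t) *\<^sub>v v) = sub (su_rot j t) (S v)"
proof -
  have key: "sub (su_rot j (- t)) (S (\<pi> (rot j t) *\<^sub>v v)) z0 z1 = S v z0 z1" for z0 z1 t
  proof -
    define y where "y t = sub (su_rot j (- t)) (S (\<pi> (rot j t) *\<^sub>v v)) z0 z1" for t
    have "(y has_vector_derivative 0) (at t)" for t
    proof -
      \<comment> \<open>The part of the substitution at time t is absorbed into a new evaluation
        point (a, b), and the part of the rotation into the vector \<open>?w\<close>.\<close>
      define a b where "a = z0 * su_rot j (- t) $ 1 $ 1 + z1 * su_rot j (- t) $ 2 $ 1"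
        and "b = z0 * su_rot j (- t) $ 1 $ 2 + z1 * su_rot j (- t) $ 2 $ 2"
      let ?w = "\<pi> (rot j t) *\<^sub>v v"
      have w: "?w \<in> V" by (rule rep_vec[OF rot_in_SO3 v])
      have y: "y s = sub (su_rot j (- (s - t))) (S (\<pi> (rot j (s - t)) *\<^sub>v ?w)) a b" for s
      proof -
        have 1: "\<pi> (rot j s) *\<^sub>v v = \<pi> (rot j (s - t)) *\<^sub>v ?w"
          using rot_add[of j "s - t" t] v rep_carrier[OF rot_in_SO3] rep_mult[OF rot_in_SO3 rot_in_SO3]
          by (simp add: assoc_mult_mat_vec[of _ n n _ n])
        have 2: "su_rot j (- s) = su_rot j (- t) ** su_rot j (- (s - t))"
          by (simp flip: su_rot_add)
        show ?thesis
          unfolding y_def 1 2 sub_sub[symmetric] by (simp add: sub_def[of "su_rot j (- t)"] a_def b_def)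
      qed
      have 1: "((\<lambda>s. s - t) has_vector_derivative 1) (at t)"
        by (auto intro!: derivative_eq_intros)
      have 2: "((\<lambda>h. sub (su_rot j (- h)) (S (\<pi> (rot j h) *\<^sub>v ?w)) a b) has_vector_derivative 0) (at (t - t))"
        using S_rot_infinitesimal[OF w] by simp
      from vector_diff_chain_at[OF 1 2] show ?thesis
        by (simp add: o_def y[abs_def])
    qed
    then obtain c where "\<And>t. y t = c"
      using has_vector_derivative_zero_constant[of UNIV y] by auto
    then have "y t = y 0" by simp
    then show ?thesis
      using v by (simp add: y_def rep_one)
  qed
  have "sub (su_rot j (- t)) (S (\<pi> (rot j t) *\<^sub>v v)) = S v"
    by (intro ext key)
  then have "sub (su_rot j t) (sub (su_rot j (- t)) (S (\<pi> (rot j t) *\<^sub>v v))) = sub (su_rot j t) (S v)"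
    by simp
  then show ?thesis
    by (simp add: sub_sub flip: su_rot_add)
qed

text \<open>By Euler angles the rotations about the coordinate axes generate the group.\<close>

lemma S_act:
  assumes g: "g \<in> SO3" and v: "v \<in> V"
  shows "S (\<pi> g *\<^sub>v v) = act g (S v)"
proof -
  have r: "S (\<pi> (rot j t) *\<^sub>v w) = act (rot j t) (S w)" if "w \<in> V" for j t w
    using S_rot[OF that] act_eq_sub[OF lift_rot S_in_Sym[OF that]] by simp
  have m: "S (\<pi> (a ** b) *\<^sub>v w) = act (a ** b) (S w)"
    if "a \<in> SO3" "b \<in> SO3" "w \<in> V" "\<And>w. w \<in> V \<Longrightarrow> S (\<pi> a *\<^sub>v w) = act a (S w)" "\<And>w. w \<in> V \<Longrightarrow> S (\<pi> b *\<^sub>v w) = act b (S w)"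
    for a b w
  proof -
    have "\<pi> (a ** b) *\<^sub>v w = \<pi> a *\<^sub>v (\<pi> b *\<^sub>v w)"
      unfolding rep_mult[OF that(1,2)]
      by (rule assoc_mult_mat_vec[OF rep_carrier[OF that(1)] rep_carrier[OF that(2)] that(3)])
    then show ?thesis
      using that rep_vec act_mult[OF that(1,2) S_in_Sym[OF that(3)]] by simp
  qed
  obtain a b c where "g = rot 3 a ** (rot 2 b ** rot 3 c)"
    using euler_angles[OF g] .
  then show ?thesis
    using m[OF rot_in_SO3 SO3_mult[OF rot_in_SO3 rot_in_SO3] v r m[OF rot_in_SO3 rot_in_SO3 _ r r]] by simp
qed

text \<open>S carries the standard inner product to B, so invariance of B under the group follows
  from unitarity of \<pi>.\<close>

lemma inner_act:
  assumes g: "g \<in> SO3" and p: "p \<in> Sym (2 * l)" and q: "q \<in> Sym (2 * l)"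
  shows "B (act g p) (act g q) = B p q"
proof -
  obtain v w where "v \<in> V" "w \<in> V" "p = S v" "q = S w"
    using p q bij_betw_imp_surj_on[OF S_bij] by blast
  then show ?thesis
    by (simp add: S_act[OF g, symmetric] S_inner rep_vec[OF g] rep_unitary[OF g])
qed

end

section \<open>Tensors with the dual representation as functions on the group\<close>

locale dual_sym_rep = sym_rep +
  fixes K :: "complex Matrix.vec \<Rightarrow> complex Matrix.vec"
  assumes selfdual: "unitary_intertwiner n (contragredient \<pi>) \<pi> K"
begin

definition "T = S \<circ> K"

lemma
  shows K_bij: "bij_betw K V V"
    and K_add: "v \<in> V \<Longrightarrow> w \<in> V \<Longrightarrow> K (v + w) = K v + K w"
    and K_smult: "v \<in> V \<Longrightarrow> K (c \<cdot>\<^sub>v v) = c \<cdot>\<^sub>v K v"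
    and K_equiv: "g \<in> SO3 \<Longrightarrow> v \<in> V \<Longrightarrow> K (contragredient \<pi> g *\<^sub>v v) = \<pi> g *\<^sub>v K v"
  using selfdual unfolding unitary_intertwiner_def by blast+

lemma K_in: "v \<in> V \<Longrightarrow> K v \<in> V"
  using K_bij bij_betwE by blast

lemma T_bij: "bij_betw T V (Sym (2 * l))"
  unfolding T_def by (rule bij_betw_trans[OF K_bij S_bij])

lemma T_surj: "p \<in> Sym (2 * l) \<Longrightarrow> \<exists>v\<in>V. T v = p"
  by (subst (asm) bij_betw_imp_surj_on[OF T_bij, symmetric]) blast

lemma T_inj: "T v = T w \<Longrightarrow> v \<in> V \<Longrightarrow> w \<in> V \<Longrightarrow> v = w"
  by (rule inj_onD[OF bij_betw_imp_inj_on[OF T_bij]])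

lemma T_in_Sym: "v \<in> V \<Longrightarrow> T v \<in> Sym (2 * l)"
  using T_bij bij_betwE by blast

lemma T_add: "v \<in> V \<Longrightarrow> w \<in> V \<Longrightarrow> T (v + w) = bi_add (T v) (T w)"
  by (simp add: T_def K_add K_in S_add)

lemma T_smult: "v \<in> V \<Longrightarrow> T (c \<cdot>\<^sub>v v) = bi_smult c (T v)"
  by (simp add: T_def K_smult K_in S_smult)

lemma contragredient_carrier: "g \<in> SO3 \<Longrightarrow> contragredient \<pi> g \<in> carrier_mat n n"
  using rep_carrier[OF SO3_inv] by (simp add: contragredient_def)

lemma tensor_fun_eq:
  assumes "g \<in> SO3" "v \<in> V" "\<phi> \<in> V"
  shows "tensor_fun \<pi> v \<phi> g = scalar_prod (contragredient \<pi> g *\<^sub>v \<phi>) v"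
  unfolding tensor_fun_def contragredient_def
  by (rule transpose_vec_mult_scalar[symmetric, OF rep_carrier[OF SO3_inv[OF assms(1)]] assms(2,3)])

lemma T_act:
  assumes "g \<in> SO3" "\<phi> \<in> V"
  shows "T (contragredient \<pi> g *\<^sub>v \<phi>) = act g (T \<phi>)"
  using assms by (simp add: T_def K_equiv S_act K_in)

text \<open>\<psi> i is the vector whose form is the i-th Lagrange form. Interpolation of T u,
  pulled back by T, expands u in these vectors, and pairing with v gives the formula.\<close>

lemma scalar_prod_interpolation:
  obtains \<psi> where "\<And>i. i \<le> 2 * l \<Longrightarrow> \<psi> i \<in> V"
    "\<And>u v. u \<in> V \<Longrightarrow> v \<in> V \<Longrightarrow> scalar_prod u v = (\<Sum>i\<le>2*l. scalar_prod (\<psi> i) v * T u 1 (of_nat i))"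
proof -
  have "\<exists>\<psi>. i \<le> 2 * l \<longrightarrow> \<psi> \<in> V \<and> T \<psi> = lagr (2 * l) i" for i
    using T_surj[OF lagr_in_Sym[of i "2 * l"]] by blast
  then obtain \<psi> where \<psi>: "\<And>i. i \<le> 2 * l \<Longrightarrow> \<psi> i \<in> V" "\<And>i. i \<le> 2 * l \<Longrightarrow> T (\<psi> i) = lagr (2 * l) i"
    using choice[of "\<lambda>i \<psi>. i \<le> 2 * l \<longrightarrow> \<psi> \<in> V \<and> T \<psi> = lagr (2 * l) i"] by blast
  have "scalar_prod u v = (\<Sum>i\<le>2*l. scalar_prod (\<psi> i) v * T u 1 (of_nat i))" if u: "u \<in> V" and v: "v \<in> V" for u v
  proof -
    have "\<exists>w\<in>V. T w = (\<lambda>z0 z1. \<Sum>i<m. T u 1 (of_nat i) * lagr (2 * l) i z0 z1) \<and>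
        scalar_prod w v = (\<Sum>i<m. scalar_prod (\<psi> i) v * T u 1 (of_nat i))" if "m \<le> Suc (2 * l)" for m
      using that
    proof (induction m)
      case 0
      have "T (0 \<cdot>\<^sub>v 0\<^sub>v n) = (\<lambda>z0 z1. 0)"
        using T_smult[of "0\<^sub>v n" 0] by (simp add: bi_smult_def)
      then show ?case
        using v by (intro bexI[of _ "0 \<cdot>\<^sub>v 0\<^sub>v n"]) auto
    next
      case (Suc m)
      then obtain w where w: "w \<in> V" "T w = (\<lambda>z0 z1. \<Sum>i<m. T u 1 (of_nat i) * lagr (2 * l) i z0 z1)"
        "scalar_prod w v = (\<Sum>i<m. scalar_prod (\<psi> i) v * T u 1 (of_nat i))"
        by auto
      have m: "\<psi> m \<in> V" "T (\<psi> m) = lagr (2 * l) m" using \<psi> Suc.prems by auto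
      have "T (w + T u 1 (of_nat m) \<cdot>\<^sub>v \<psi> m) = (\<lambda>z0 z1. \<Sum>i<Suc m. T u 1 (of_nat i) * lagr (2 * l) i z0 z1)"
        using m w by (subst T_add) (auto simp: T_smult bi_add_def bi_smult_def)
      moreover have "scalar_prod (w + T u 1 (of_nat m) \<cdot>\<^sub>v \<psi> m) v = (\<Sum>i<Suc m. scalar_prod (\<psi> i) v * T u 1 (of_nat i))"
        using m w v by (subst add_scalar_prod_distrib[of _ n]) auto
      ultimately show ?case
        using w(1) m(1) by (intro bexI[of _ "w + T u 1 (of_nat m) \<cdot>\<^sub>v \<psi> m"]) auto
    qed
    from this[of "Suc (2 * l)"] have "\<exists>w\<in>V. T w = (\<lambda>z0 z1. \<Sum>i<Suc (2 * l). T u 1 (of_nat i) * lagr (2 * l) i z0 z1) \<and>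
        scalar_prod w v = (\<Sum>i<Suc (2 * l). scalar_prod (\<psi> i) v * T u 1 (of_nat i))"
      by (simp only: order_refl)
    then obtain w where w1: "w \<in> V"
      and w2: "T w = (\<lambda>z0 z1. \<Sum>i<Suc (2 * l). T u 1 (of_nat i) * lagr (2 * l) i z0 z1) \<and>
        scalar_prod w v = (\<Sum>i<Suc (2 * l). scalar_prod (\<psi> i) v * T u 1 (of_nat i))"
      by (rule bexE)
    note w = w1 conjunct1[OF w2] conjunct2[OF w2]
    have "T w = T u"
      unfolding w(2) lessThan_Suc_atMost
      by (intro ext) (rule lagrange_interpolation[OF T_in_Sym[OF u], symmetric])
    then have "w = u"
      by (rule T_inj[OF _ w(1) u])
    then show ?thesis using w(3) by (simp only: lessThan_Suc_atMost)
  qed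
  with \<psi>(1) show ?thesis by (rule that)
qed

text \<open>\<open>tensor_fun\<close> pairs the moved functional with a vector,
  \<open>blk_gen\<close> evaluates its form at a point. Pairings are combinations of evaluations by
  interpolation, and evaluation at a point is the pairing with a suitable vector.\<close>

lemma tensor_space_eq:
  assumes L: "L \<subseteq> V" and space: "space \<mu> = SO3"
  shows "tensor_space \<mu> n \<pi> L = ae_space \<mu> (fun_span (blk_gen (T ` L)))"
proof -
  let ?G = "{tensor_fun \<pi> v \<phi> | v \<phi>. v \<in> V \<and> \<phi> \<in> L}"
  have 1: "\<exists>F'\<in>fun_span (blk_gen (T ` L)). \<forall>g\<in>SO3. F g = F' g" if "F \<in> fun_span ?G" for F
    using that
  proof (induction rule: fun_span_induct)
    case zero
    show ?case by (rule bexI[OF _ fun_span_zero]) simp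
  next
    case (step F f c)
    then obtain F' where F': "F' \<in> fun_span (blk_gen (T ` L))" "\<forall>g\<in>SO3. F g = F' g" by blast
    obtain v \<phi> where f: "f = tensor_fun \<pi> v \<phi>" "v \<in> V" "\<phi> \<in> L" using step.hyps by auto
    obtain \<psi> where \<psi>: "\<And>i. i \<le> 2 * l \<Longrightarrow> \<psi> i \<in> V"
      "\<And>u v. u \<in> V \<Longrightarrow> v \<in> V \<Longrightarrow> scalar_prod u v = (\<Sum>i\<le>2*l. scalar_prod (\<psi> i) v * T u 1 (of_nat i))"
      using scalar_prod_interpolation by blast
    let ?f = "\<lambda>g. \<Sum>i\<le>2*l. scalar_prod (\<psi> i) v * act g (T \<phi>) 1 (of_nat i)"
    have "?f \<in> fun_span (blk_gen (T ` L))"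
      using f(3) by (intro fun_span_sum fun_span_cmul fun_span_base) (auto simp: blk_gen_def)
    moreover have "f g = ?f g" if g: "g \<in> SO3" for g
    proof -
      have \<phi>: "\<phi> \<in> V" using f(3) L by blast
      have "contragredient \<pi> g *\<^sub>v \<phi> \<in> V"
        by (rule mult_mat_vec_carrier[OF contragredient_carrier[OF g] \<phi>])
      then show ?thesis
        unfolding f(1) tensor_fun_eq[OF g f(2) \<phi>] using \<psi>(2)[OF _ f(2)] by (simp add: T_act[OF g \<phi>])
    qed
    ultimately show ?case
      using F' by (intro bexI[of _ "\<lambda>g. F' g + c * ?f g"] fun_span_add[OF fun_span_cmul]) auto
  qed
  have 2: "\<exists>F'\<in>fun_span ?G. \<forall>g\<in>SO3. F g = F' g" if "F \<in> fun_span (blk_gen (T ` L))" for F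
    using that
  proof (induction rule: fun_span_induct)
    case zero
    show ?case by (rule bexI[OF _ fun_span_zero]) simp
  next
    case (step F f c)
    then obtain F' where F': "F' \<in> fun_span ?G" "\<forall>g\<in>SO3. F g = F' g" by blast
    obtain \<phi> z0 z1 where f: "f = (\<lambda>g. act g (T \<phi>) z0 z1)" "\<phi> \<in> L" using step.hyps by (auto simp: blk_gen_def)
    \<comment> \<open>The linear functional u -> T u (z0, z1), written as a vector by its values on
      the unit vectors.\<close>
    define v where "v = Matrix.vec n (\<lambda>i. T (unit_vec n i) z0 z1)"
    have v: "v \<in> V" by (simp add: v_def)
    have "f g = tensor_fun \<pi> v \<phi> g" if g: "g \<in> SO3" for g
    proof -
      have \<phi>: "\<phi> \<in> V" using f(2) L by blast
      have c: "contragredient \<pi> g *\<^sub>v \<phi> \<in> V"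
        by (rule mult_mat_vec_carrier[OF contragredient_carrier[OF g] \<phi>])
      have "f g = T (contragredient \<pi> g *\<^sub>v \<phi>) z0 z1"
        by (simp add: f T_act[OF g \<phi>])
      also have "\<dots> = (\<Sum>i<n. vec_index (contragredient \<pi> g *\<^sub>v \<phi>) i * T (unit_vec n i) z0 z1)"
        by (rule vec_linear_expand[OF T_add T_smult c])
      also have "\<dots> = scalar_prod (contragredient \<pi> g *\<^sub>v \<phi>) v"
        by (simp add: scalar_prod_def v_def atLeast0LessThan)
      finally show ?thesis
        by (simp add: tensor_fun_eq[OF g v \<phi>])
    qed
    moreover have "tensor_fun \<pi> v \<phi> \<in> fun_span ?G"
      using v f(2) by (intro fun_span_base) auto
    ultimately show ?case
      using F' by (intro bexI[of _ "\<lambda>g. F' g + c * tensor_fun \<pi> v \<phi> g"] fun_span_add[OF fun_span_cmul]) auto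
  qed
  have ae: "AE g in \<mu>. f g = F' g" if "AE g in \<mu>. f g = F g" "\<forall>g\<in>SO3. F g = F' g" for f F F' :: "real^3^3 \<Rightarrow> complex"
    using that(1) AE_space by eventually_elim (use that(2) space in auto)
  show ?thesis
    unfolding tensor_space_def ae_space_def using 1 2 ae by (intro Collect_cong conj_cong refl) meson
qed

lemma vec_line_T:
  assumes p: "p \<in> Sym (2 * l)" "p \<noteq> (\<lambda>z0 z1. 0)"
  defines "L \<equiv> {\<phi> \<in> V. T \<phi> \<in> bi_line p}"
  shows "vec_line n L" "T ` L = bi_line p" "L \<subseteq> V"
proof -
  obtain \<phi> where \<phi>: "\<phi> \<in> V" "T \<phi> = p"
    using T_surj[OF p(1)] by blast
  have T0: "T (0\<^sub>v n) = (\<lambda>z0 z1. 0)"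
  proof -
    have "0 \<cdot>\<^sub>v 0\<^sub>v n = (0\<^sub>v n :: complex Matrix.vec)" by (intro eq_vecI) auto
    then show ?thesis using T_smult[of "0\<^sub>v n" 0] by (simp add: bi_smult_def)
  qed
  have L: "L = {c \<cdot>\<^sub>v \<phi> | c. True}"
  proof (intro equalityI subsetI)
    fix \<psi> assume "\<psi> \<in> L"
    then obtain c where c: "\<psi> \<in> V" "T \<psi> = bi_smult c p" by (auto simp: L_def bi_line_def)
    then have "T \<psi> = T (c \<cdot>\<^sub>v \<phi>)" by (simp add: T_smult \<phi>)
    then have "\<psi> = c \<cdot>\<^sub>v \<phi>"
      by (rule T_inj[OF _ c(1) smult_carrier_vec[THEN iffD2, OF \<phi>(1)]])
    then show "\<psi> \<in> {c \<cdot>\<^sub>v \<phi> | c. True}" by blast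
  next
    fix \<psi> assume "\<psi> \<in> {c \<cdot>\<^sub>v \<phi> | c. True}"
    then show "\<psi> \<in> L" using \<phi> by (auto simp: L_def bi_line_def T_smult)
  qed
  have "\<phi> \<noteq> 0\<^sub>v n" using \<phi>(2) T0 p(2) by auto
  then show "vec_line n L"
    unfolding vec_line_def using L \<phi>(1) by blast
  show "T ` L = bi_line p"
  proof -
    have "T ` {c \<cdot>\<^sub>v \<phi> | c. True} = {T (c \<cdot>\<^sub>v \<phi>) | c. True}" by blast
    then show ?thesis
      by (simp only: L bi_line_def T_smult[OF \<phi>(1)] \<phi>(2))
  qed
  show "L \<subseteq> V" by (auto simp: L_def)
qed

lemma tensor_block: "space \<mu> = SO3 \<Longrightarrow> peter_weyl_block \<mu> n \<pi> = ae_space \<mu> (blk l)"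
  using tensor_space_eq[OF subset_refl, of \<mu>] bij_betw_imp_surj_on[OF T_bij] by (simp add: blk_def)

lemma tensor_line:
  assumes "L \<subseteq> V" "T ` L = bi_line p" "space \<mu> = SO3"
  shows "tensor_space \<mu> n \<pi> L = ae_space \<mu> (line_blk p)"
proof -
  have "fun_span (blk_gen (bi_line p)) = line_blk p"
    unfolding line_blk_def
  proof
    show "fun_span (blk_gen (bi_line p)) \<subseteq> fun_span (blk_gen {p})"
    proof (rule fun_span_subset, rule subsetI)
      fix f assume "f \<in> blk_gen (bi_line p)"
      then obtain c z0 z1 where "f = (\<lambda>g. c * act g p z0 z1)"
        by (auto simp: blk_gen_def bi_line_def bi_smult_def act_cmul)
      then show "f \<in> fun_span (blk_gen {p})"
        by (simp only:) (intro fun_span_cmul fun_span_base, auto simp: blk_gen_def)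
    qed
    have "p = bi_smult 1 p" by (simp add: bi_smult_def)
    then have "p \<in> bi_line p" unfolding bi_line_def by blast
    then show "fun_span (blk_gen {p}) \<subseteq> fun_span (blk_gen (bi_line p))"
      by (intro fun_span_mono) (auto simp: blk_gen_def)
  qed
  then show ?thesis
    using tensor_space_eq[OF assms(1,3)] assms(2) by simp
qed

end

section \<open>The two Hardy spaces\<close>

lemma bform_shift_down:
  "(\<Sum>k\<le>n. a k * of_nat k * mono2 n (k - 1) z0 z1) =
    bform n (\<lambda>k. if k < n then of_nat (Suc k) * a (Suc k) else 0) z0 z1"
proof (cases n)
  case (Suc m)
  have "(\<Sum>k\<le>Suc m. a k * of_nat k * mono2 n (k - 1) z0 z1) =
      (\<Sum>k\<le>m. a (Suc k) * of_nat (Suc k) * mono2 n k z0 z1)"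
    by (subst sum.atMost_Suc_shift) simp
  also have "\<dots> = (\<Sum>k\<le>m. (if k < n then of_nat (Suc k) * a (Suc k) else 0) * mono2 n k z0 z1)"
    by (intro sum.cong refl) (simp add: Suc mult_ac)
  finally show ?thesis
    by (simp add: Suc bform_def)
qed (simp add: bform_def)

lemma bform_shift_up:
  "(\<Sum>k\<le>n. a k * of_nat (n - k) * mono2 n (k + 1) z0 z1) =
    bform n (\<lambda>k. if k = 0 then 0 else of_nat (n + 1 - k) * a (k - 1)) z0 z1"
proof (cases n)
  case (Suc m)
  have "(\<Sum>k\<le>Suc m. (if k = 0 then 0 else of_nat (n + 1 - k) * a (k - 1)) * mono2 n k z0 z1) =
      (\<Sum>k\<le>m. of_nat (n - k) * a k * mono2 n (k + 1) z0 z1)"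
    by (subst sum.atMost_Suc_shift) simp
  also have "\<dots> = (\<Sum>k\<le>m. a k * of_nat (n - k) * mono2 n (k + 1) z0 z1)"
    by (intro sum.cong refl) (simp only: mult_ac)
  finally show ?thesis
    by (simp add: Suc bform_def del: of_nat_diff)
qed (simp add: bform_def)

lemma dX_sym_ops:
  "dX x p z0 z1 = (x $ 1 / 2 + x $ 2 / (2 * \<i>)) * sym_raise p z0 z1
    + (- x $ 1 / 2 + x $ 2 / (2 * \<i>)) * sym_lower p z0 z1 + x $ 3 / (2 * \<i>) * sym_weight p z0 z1"
  by (simp add: dX_def sum_3 dE_def field_simps)

text \<open>Comparison of the coefficients of z0^(n - k) z1^k: raising brings in a(k + 1), lowering
  a(k - 1), and the weight operator a(k).\<close>

lemma dX_kernel_recursion: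
  assumes "dX x (bform n a) = (\<lambda>z0 z1. 0)" "k < n"
  shows "(x $ 1 / 2 + x $ 2 / (2 * \<i>)) * (of_nat (Suc k) * a (Suc k))
    = - ((- x $ 1 / 2 + x $ 2 / (2 * \<i>)) * (if k = 0 then 0 else of_nat (n + 1 - k) * a (k - 1))
      + x $ 3 / (2 * \<i>) * ((of_nat (n - k) - of_nat k) * a k))"
proof -
  let ?\<alpha> = "x $ 1 / 2 + x $ 2 / (2 * \<i>)" and ?\<beta> = "- x $ 1 / 2 + x $ 2 / (2 * \<i>)" and ?\<gamma> = "x $ 3 / (2 * \<i>)"
  let ?c = "\<lambda>k. ?\<alpha> * (if k < n then of_nat (Suc k) * a (Suc k) else 0)
      + ?\<beta> * (if k = 0 then 0 else of_nat (n + 1 - k) * a (k - 1))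
      + ?\<gamma> * (a k * (of_nat (n - k) - of_nat k))"
  have w: "(\<Sum>k\<le>n. a k * (of_nat (n - k) - of_nat k) * mono2 n k z0 z1) =
      bform n (\<lambda>k. a k * (of_nat (n - k) - of_nat k)) z0 z1" for z0 z1
    by (simp only: bform_def)
  have "dX x (bform n a) z0 z1 = bform n ?c z0 z1" for z0 z1
    unfolding dX_sym_ops sym_raise_bform sym_lower_bform sym_weight_bform
      bform_shift_down bform_shift_up w bform_cmul bform_add ..
  then have "bform n ?c = bform n (\<lambda>k. 0)"
    using assms(1) by (simp add: fun_eq_iff bform_def)
  then have "?c k = 0"
    using assms(2) unfolding bform_eq_iff by (meson less_imp_le)
  then show ?thesis
    using assms(2) by (simp only: if_True mult.commute[of "a k"] add.assoc eq_neg_iff_add_eq_0)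
qed

text \<open>The coefficient of the raising operator in x is non-zero, so the recursion determines a
  form from its coefficient at z0^n, which is its value at (1, 0).\<close>

lemma dX_kernel_unique:
  assumes p: "p \<in> Sym n" "dX x p = (\<lambda>z0 z1. 0)" and q: "q \<in> Sym n" "dX x q = (\<lambda>z0 z1. 0)"
    and "q 1 0 = 1" and \<alpha>: "x $ 1 / 2 + x $ 2 / (2 * \<i>) \<noteq> 0"
  shows "p = (\<lambda>z0 z1. p 1 0 * q z0 z1)"
proof -
  obtain a b where ab: "p = bform n a" "q = bform n b"
    using p(1) q(1) by (auto simp: Sym_eq)
  have c0: "bform n c 1 0 = c 0" for c
    by (simp add: bform_def mono2_def power_0_left if_distrib[of "\<lambda>z. _ * z"] cong: if_cong)
  have b0: "b 0 = 1"
    using assms(5) by (simp add: ab c0)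
  have "a k = a 0 * b k" if "k \<le> n" for k
    using that
  proof (induction k rule: less_induct)
    case (less k)
    show ?case
    proof (cases k)
      case 0
      then show ?thesis using assms(5) by (simp add: ab c0)
    next
      case (Suc m)
      then have m: "m < n" using less.prems by simp
      have IH: "a m = a 0 * b m" "m \<noteq> 0 \<Longrightarrow> a (m - 1) = a 0 * b (m - 1)"
        using less.IH[of m] less.IH[of "m - 1"] less.prems Suc by auto
      let ?\<alpha> = "x $ 1 / 2 + x $ 2 / (2 * \<i>)"
      have "?\<alpha> * (of_nat (Suc m) * a (Suc m)) = a 0 * (?\<alpha> * (of_nat (Suc m) * b (Suc m)))"
        unfolding dX_kernel_recursion[OF p(2)[unfolded ab] m] dX_kernel_recursion[OF q(2)[unfolded ab] m]
        using IH b0 by (cases "m = 0") (simp_all add: algebra_simps)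
      then have "(?\<alpha> * of_nat (Suc m)) * a (Suc m) = (?\<alpha> * of_nat (Suc m)) * (a 0 * b (Suc m))"
        by (simp only: mult_ac)
      then have "a (Suc m) = a 0 * b (Suc m)"
        using \<alpha> by (simp only: mult_cancel_left mult_eq_0_iff of_nat_eq_0_iff) auto
      then show ?thesis by (simp add: Suc)
    qed
  qed
  then have "bform n a = bform n (\<lambda>k. a 0 * b k)"
    unfolding bform_eq_iff by blast
  then show ?thesis
    unfolding ab c0 bform_cmul by simp
qed

lemma fun_span_line_blks: "fun_span (\<Union>l. line_blk (p0 l)) \<subseteq> fun_span (\<Union>l. blk_gen {p0 l})"
proof (rule fun_span_subset)
  have "line_blk (p0 l) \<subseteq> fun_span (\<Union>l. blk_gen {p0 l})" for l
    unfolding line_blk_def by (rule fun_span_mono) auto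
  then show "(\<Union>l. line_blk (p0 l)) \<subseteq> fun_span (\<Union>l. blk_gen {p0 l})" by blast
qed

section \<open>The circle bundle\<close>

definition hopf_x :: "complex^3" where
  "hopf_x = vector [1, \<i>, 0]"

lemma hopf_killed:
  assumes "(\<And>j. rderiv j f (f' j))" "g \<in> SO3"
  shows "lie_deriv_c E1 E2 f g = (\<Sum>j\<in>UNIV. hopf_x $ j * f' j g)"
  using lie_deriv_rderiv[OF assms(1)[of 1] assms(2), of 1] lie_deriv_rderiv[OF assms(1)[of 2] assms(2), of 1]
  by (simp add: lie_deriv_c_def hopf_x_def sum_3 Egen_def)

lemma dX_hopf: "dX hopf_x p = sym_raise p"
  by (rule ext)+ (simp add: dX_sym_ops hopf_x_def)

lemma u_hopf_eq: "u_hopf l = mono2 (2 * l) 0"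
  by (simp add: u_hopf_def mono2_def)

lemma dX_u_hopf: "dX hopf_x (u_hopf l) = (\<lambda>z0 z1. 0)"
  by (simp add: dX_hopf u_hopf_eq sym_ops_mono2)

definition hopf_fun :: "(real^3^3 \<Rightarrow> complex) set" where
  "hopf_fun = {f. smooth_on_mfd SO3 f \<and> (\<forall>g\<in>SO3. lie_deriv_c E1 E2 f g = 0)}"

text \<open>The induction carries a polynomial that agrees with F on SO(3), which yields smoothness,
  and explicit derivatives of F, which yield the equation.\<close>

lemma hopf_span:
  assumes "F \<in> fun_span (\<Union>l. line_blk (u_hopf l))"
  shows "F \<in> hopf_fun"
proof -
  have "F \<in> fun_span (\<Union>l. blk_gen {u_hopf l})"
    using assms fun_span_line_blks by blast
  then have "\<exists>P f'. polynomial_function P \<and> (\<forall>g\<in>SO3. F g = P g) \<and> (\<forall>j. rderiv j F (f' j)) \<and>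
      (\<forall>g\<in>SO3. (\<Sum>j\<in>UNIV. hopf_x $ j * f' j g) = 0)"
  proof (induction rule: fun_span_induct)
    case zero
    show ?case
      by (rule exI[of _ "\<lambda>g. 0"], rule exI[of _ "\<lambda>j g. 0"]) (simp add: rderiv_zero)
  next
    case (step F f c)
    then obtain P f' where F: "polynomial_function P" "\<forall>g\<in>SO3. F g = P g" "\<forall>j. rderiv j F (f' j)"
        "\<forall>g\<in>SO3. (\<Sum>j\<in>UNIV. hopf_x $ j * f' j g) = 0"
      by (elim exE conjE) (rule that, assumption+)
    obtain l z0 z1 where f: "f = (\<lambda>g. act g (u_hopf l) z0 z1)"
      using step.hyps by (auto simp: blk_gen_def)
    have u: "u_hopf l \<in> Sym (2 * l)"
      by (simp add: u_hopf_eq mono2_in_Sym)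
    obtain R where R: "polynomial_function R" "\<And>g. g \<in> SO3 \<Longrightarrow> act g (u_hopf l) z0 z1 = R g"
      using act_polynomial[OF u] by blast
    let ?d = "\<lambda>j g. act g (dE j (u_hopf l)) z0 z1"
    have "(\<Sum>j\<in>UNIV. hopf_x $ j * ?d j g) = act g (dX hopf_x (u_hopf l)) z0 z1" for g
      by (simp only: dX_def act_sum act_cmul)
    then have d: "(\<Sum>j\<in>UNIV. hopf_x $ j * ?d j g) = 0" for g
      by (simp add: dX_u_hopf act_def sub_def)
    have "(\<Sum>j\<in>UNIV. hopf_x $ j * (f' j g + c * ?d j g)) =
        (\<Sum>j\<in>UNIV. hopf_x $ j * f' j g) + c * (\<Sum>j\<in>UNIV. hopf_x $ j * ?d j g)" for g
      by (simp add: sum_3 algebra_simps)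
    then have "\<forall>g\<in>SO3. (\<Sum>j\<in>UNIV. hopf_x $ j * (f' j g + c * ?d j g)) = 0"
      using F(4) d by simp
    moreover have "\<forall>j. rderiv j (\<lambda>g. F g + c * f g) (\<lambda>g. f' j g + c * ?d j g)"
      unfolding f using F(3) rderiv_act[OF u] by (intro allI rderiv_add rderiv_cmul) auto
    moreover have "polynomial_function (\<lambda>g. P g + c * R g)"
      using F(1) R(1) by (intro polynomial_function_add polynomial_function_scale_left)
    moreover have "\<forall>g\<in>SO3. F g + c * f g = P g + c * R g"
      using F(2) R(2) by (simp add: f)
    ultimately show ?case
      by (intro exI[of _ "\<lambda>g. P g + c * R g"] exI[of _ "\<lambda>j g. f' j g + c * ?d j g"] conjI)
  qed
  then obtain P f' where F: "polynomial_function P" "\<forall>g\<in>SO3. F g = P g" "\<And>j. rderiv j F (f' j)"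
      "\<forall>g\<in>SO3. (\<Sum>j\<in>UNIV. hopf_x $ j * f' j g) = 0"
    by (elim exE conjE) (rule that, assumption+, erule spec, assumption)
  have "smooth_on_mfd SO3 F"
    by (rule smooth_on_mfd_polynomial[OF F(1)]) (use F(2) in blast)
  then show ?thesis
    using hopf_killed[OF F(3)] F(4) by (simp add: hopf_fun_def)
qed

lemma hopf_data:
  assumes "normalized_haar \<mu>"
  shows "hardy_data \<mu> hopf_fun hopf_x u_hopf"
proof
  show "normalized_haar \<mu>" by fact
  show "\<exists>f'. (\<forall>j. rderiv j f (f' j)) \<and> (\<forall>g\<in>SO3. (\<Sum>j\<in>UNIV. hopf_x $ j * f' j g) = 0)" if "f \<in> hopf_fun" for f
  proof -
    have r: "rderiv j f (lie_deriv (Egen j) f)" for j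
      using that rderiv_smooth by (auto simp: hopf_fun_def)
    have "\<forall>g\<in>SO3. (\<Sum>j\<in>UNIV. hopf_x $ j * lie_deriv (Egen j) f g) = 0"
      using hopf_killed[of f "\<lambda>j. lie_deriv (Egen j) f", OF r] that by (simp add: hopf_fun_def)
    then show ?thesis
      using r by (intro exI[of _ "\<lambda>j. lie_deriv (Egen j) f"]) blast
  qed
  show "\<exists>a\<in>hopf_fun. \<forall>g\<in>SO3. a g = F g" if "F \<in> fun_span (\<Union>l. line_blk (u_hopf l))" for F
    using hopf_span[OF that] by blast
  show u: "u_hopf l \<in> Sym (2 * l)" for l
    by (simp add: u_hopf_eq mono2_in_Sym)
  show "\<exists>c. p = (\<lambda>z0 z1. c * u_hopf l z0 z1)" if "p \<in> Sym (2 * l)" "dX hopf_x p = (\<lambda>z0 z1. 0)" for p l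
    by (rule exI, rule dX_kernel_unique[OF that u dX_u_hopf]) (simp_all add: u_hopf_def hopf_x_def)
qed

section \<open>The Grauert tube\<close>

lemma Phi_eq: "Phi \<tau> g = cmat g *v z_tau \<tau>"
  by (simp add: Phi_def cmat_def)

lemma bounded_linear_Phi: "bounded_linear (Phi \<tau>)"
  unfolding linear_conv_bounded_linear[symmetric]
  by (rule linearI) (simp_all add: Phi_def vec_eq_iff matrix_vector_mult_def sum.distrib algebra_simps
      sum_distrib_left scaleR_conv_of_real[where 'a = complex])

lemma Ck_on_cong:
  assumes "open U" "Ck_on k U f" "\<And>x. x \<in> U \<Longrightarrow> f x = g x"
  shows "Ck_on k U g"
  using assms(2,3)
proof (induction k arbitrary: f g)
  case 0
  then show ?case by (metis Ck_on.simps(1) continuous_on_cong)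
next
  case (Suc k)
  have hd: "(g has_derivative frechet_derivative f (at x)) (at x)" if "x \<in> U" for x
    by (rule has_derivative_transform_within_open[OF _ assms(1) that Suc.prems(2)])
       (use Suc.prems(1) that in \<open>auto simp: frechet_derivative_works\<close>)
  have "Ck_on k U (\<lambda>x. frechet_derivative g (at x) v)" for v
    by (rule Suc.IH[of "\<lambda>x. frechet_derivative f (at x) v"])
       (use Suc.prems(1) frechet_derivative_at[OF hd] in auto)
  then show ?case
    using hd by (auto simp: differentiable_def)
qed

text \<open>The derivative of G o L at x in direction v is that of G at L x in the fixed direction L
  v, so the induction hypothesis applies to a function of the same shape.\<close>

lemma Ck_on_compose_linear:
  fixes L :: "'a::euclidean_space \<Rightarrow> 'b::euclidean_space"
  assumes "bounded_linear L" "open U" "Ck_on k U G"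
  shows "Ck_on k (L -` U) (\<lambda>x. G (L x))"
  using assms(3)
proof (induction k arbitrary: G)
  case 0
  then show ?case
    using continuous_on_compose2[of U G "L -` U" L] linear_continuous_on[OF assms(1)] by auto
next
  case (Suc k)
  have op: "open (L -` U)"
    by (rule open_vimage[OF assms(2) linear_continuous_on[OF assms(1)]])
  have hd: "((\<lambda>x. G (L x)) has_derivative (\<lambda>v. frechet_derivative G (at (L x)) (L v))) (at x)"
    if "x \<in> L -` U" for x
    by (rule has_derivative_compose[OF bounded_linear_imp_has_derivative[OF assms(1)]])
       (use Suc.prems that in \<open>auto simp: frechet_derivative_works\<close>)
  have "Ck_on k (L -` U) (\<lambda>x. frechet_derivative (\<lambda>x. G (L x)) (at x) v)" for v
  proof (rule Ck_on_cong[OF op])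
    show "Ck_on k (L -` U) (\<lambda>x. frechet_derivative G (at (L x)) (L v))"
      using Suc.IH[of "\<lambda>y. frechet_derivative G (at y) (L v)"] Suc.prems by simp
  qed (simp add: frechet_derivative_at[OF hd, symmetric])
  then show ?case
    using hd by (auto simp: differentiable_def)
qed

text \<open>\<open>Phi \<tau>\<close> is linear in the matrix, so local extensions on the tube
  boundary pull back to open sets of matrices.\<close>

lemma smooth_on_mfd_compose_linear:
  fixes L :: "'a::euclidean_space \<Rightarrow> 'b::euclidean_space"
  assumes "bounded_linear L" "L ` N \<subseteq> M" "smooth_on_mfd M F"
  shows "smooth_on_mfd N (F \<circ> L)"
  unfolding smooth_on_mfd_def
proof
  fix p assume p: "p \<in> N"
  then have "L p \<in> M"
    using assms(2) by blast
  from bspec[OF assms(3)[unfolded smooth_on_mfd_def] this]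
  obtain U G where U: "open U" "L p \<in> U" "\<forall>k. Ck_on k U G" "\<forall>x\<in>M \<inter> U. G x = F x"
    by (elim exE conjE) (rule that, assumption+)
  have "open (L -` U)"
    by (rule open_vimage[OF U(1) linear_continuous_on[OF assms(1)]])
  moreover have "\<forall>k. Ck_on k (L -` U) (\<lambda>x. G (L x))"
    by (rule allI) (rule Ck_on_compose_linear[OF assms(1) U(1) spec[OF U(3)]])
  moreover have "\<forall>x\<in>N \<inter> L -` U. G (L x) = (F \<circ> L) x"
    using U(4) assms(2) by auto
  ultimately show "\<exists>U G. open U \<and> p \<in> U \<and> (\<forall>k. Ck_on k U G) \<and> (\<forall>x\<in>N \<inter> U. G x = (F \<circ> L) x)"
    by - (rule exI[of _ "L -` U"], rule exI[of _ "\<lambda>x. G (L x)"], simp add: U(2))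
qed

lemma tube_curve:
  assumes "g \<in> SO3"
  shows "curve_at (tube_boundary \<tau>) (Phi \<tau> g)
    (\<lambda>t. Phi \<tau> (g ** matexp (t *\<^sub>R (c *\<^sub>R Egen j)))) (Phi \<tau> (c *\<^sub>R (g ** Egen j)))"
proof -
  have r: "matexp (t *\<^sub>R (c *\<^sub>R Egen j)) = rot j (t * c)" for t
    by (simp add: rot_def)
  have 1: "((\<lambda>t. g ** rot j t) has_vector_derivative g ** Egen j) (at (0 * c))"
    using translate_rot_has_vector_derivative[of g j] by simp
  have 2: "((\<lambda>t. t * c) has_vector_derivative c) (at 0)"
    by (auto intro!: derivative_eq_intros)
  have "(((\<lambda>t. g ** rot j t) \<circ> (\<lambda>t. t * c)) has_vector_derivative c *\<^sub>R (g ** Egen j)) (at 0)"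
    by (rule vector_diff_chain_at[OF 2 1])
  then have "((\<lambda>t. Phi \<tau> (g ** rot j (t * c))) has_vector_derivative Phi \<tau> (c *\<^sub>R (g ** Egen j))) (at 0)"
    using bounded_linear.has_vector_derivative[OF bounded_linear_Phi] by (simp add: o_def)
  then show ?thesis
    using assms unfolding curve_at_def r by (auto simp: tube_boundary_def SO3_mult rot_in_SO3)
qed

text \<open>The same coordinates as \<open>z_tau\<close>. E_j acts on C^3 as the cross product with
  e_j, so this element annihilates \<open>z_tau\<close>, and R_x therefore kills F(g z_tau) for
  every holomorphic F.\<close>

definition grauert_x :: "real \<Rightarrow> complex^3" where
  "grauert_x \<tau> = vector [\<i> * of_real (sinh \<tau>), 0, of_real (cosh \<tau>)]"

definition grauert_fun :: "real \<Rightarrow> (real^3^3 \<Rightarrow> complex) set" where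
  "grauert_fun \<tau> = {F \<circ> Phi \<tau> | F. cr_function (tube_boundary \<tau>) F}"

(* E3 z_tau = i sinh(tau) e2 and E1 z_tau = - cosh(tau) e2. *)
lemma Phi_velocity:
  "\<i> *s Phi \<tau> (cosh \<tau> *\<^sub>R (g ** Egen 3)) = Phi \<tau> (sinh \<tau> *\<^sub>R (g ** Egen 1))"
proof -
  have "\<i> * (\<i> * z) = - z" for z by (simp flip: mult.assoc)
  then show ?thesis
    by (simp add: Phi_def z_tau_def vec_eq_iff matrix_vector_mult_def sum_3 Egen_def E1_def E3_def
        matrix_matrix_mult_def scaleR_conv_of_real[where 'a = complex] mult_ac)
qed

text \<open>The Cauchy-Riemann equation is applied to the velocity v of the curve through exp(t cosh
  \<tau> E3), for which i v is the velocity of the curve through exp(t sinh \<tau> E1).\<close>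

lemma grauert_killed:
  assumes "f \<in> grauert_fun \<tau>"
  shows "\<exists>f'. (\<forall>j. rderiv j f (f' j)) \<and> (\<forall>g\<in>SO3. (\<Sum>j\<in>UNIV. grauert_x \<tau> $ j * f' j g) = 0)"
proof -
  obtain F where F: "f = F \<circ> Phi \<tau>" "cr_function (tube_boundary \<tau>) F"
    using assms by (auto simp: grauert_fun_def)
  have "smooth_on_mfd SO3 f"
    unfolding F(1) by (rule smooth_on_mfd_compose_linear[OF bounded_linear_Phi, of _ _ "tube_boundary \<tau>"])
      (use F(2) in \<open>auto simp: cr_function_def tube_boundary_def\<close>)
  note r = rderiv_smooth[OF this]
  have "(\<Sum>j\<in>UNIV. grauert_x \<tau> $ j * lie_deriv (Egen j) f g) = 0" if g: "g \<in> SO3" for g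
  proof -
    have "Phi \<tau> g \<in> tube_boundary \<tau>"
      using g by (simp add: tube_boundary_def)
    moreover have "vector_derivative (F \<circ> (\<lambda>t. Phi \<tau> (g ** matexp (t *\<^sub>R (c *\<^sub>R Egen j))))) (at 0)
        = of_real c * lie_deriv (Egen j) f g" for c j
      unfolding lie_deriv_rderiv[OF r g, symmetric] by (simp add: lie_deriv_def F(1) o_def)
    ultimately have "of_real (cosh \<tau>) * lie_deriv (Egen 3) f g + \<i> * (of_real (sinh \<tau>) * lie_deriv (Egen 1) f g) = 0"
      using F(2) tube_curve[OF g, of \<tau> "cosh \<tau>" 3]
        tube_curve[OF g, of \<tau> "sinh \<tau>" 1, unfolded Phi_velocity[symmetric]]
      unfolding cr_function_def by metis
    then show ?thesis
      by (simp add: grauert_x_def sum_3 algebra_simps)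
  qed
  then show ?thesis
    using r by (intro exI[of _ "\<lambda>j. lie_deriv (Egen j) f"]) blast
qed

lemma quadr_cmul: "quadr (c *s x) z0 z1 = c * quadr x z0 z1"
  by (simp add: quadr_def algebra_simps)

lemma bounded_linear_quadr: "bounded_linear (\<lambda>x. quadr x z0 z1)"
  unfolding linear_conv_bounded_linear[symmetric]
  by (rule linearI) (simp_all add: quadr_def algebra_simps scaleR_conv_of_real[where 'a = complex])

lemma w_grauert_quadr:
  assumes "\<tau> > 0"
  shows "w_grauert \<tau> l = (\<lambda>z0 z1. (quadr (z_tau \<tau>) z0 z1 / of_real (sinh \<tau>)) ^ l)"
proof -
  have "quadr (z_tau \<tau>) z0 z1 = of_real (sinh \<tau>) * (z0\<^sup>2 + z1\<^sup>2) + 2 * of_real (cosh \<tau>) * (z0 * z1)" for z0 z1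
    by (simp add: quadr_def z_tau_def flip: mult.assoc)
  then have "quadr (z_tau \<tau>) z0 z1 / of_real (sinh \<tau>) = z0\<^sup>2 + z1\<^sup>2 + 2 * of_real (cosh \<tau> / sinh \<tau>) * z0 * z1" for z0 z1
    using assms by (simp add: add_divide_distrib)
  then show ?thesis
    by (simp only: w_grauert_def)
qed

lemma w_grauert_in_Sym: "w_grauert \<tau> l \<in> Sym (2 * l)"
proof -
  let ?q = "\<lambda>z0 z1. (mono2 2 0 z0 z1 + mono2 2 2 z0 z1) + (2 * of_real (cosh \<tau> / sinh \<tau>)) * mono2 2 1 z0 z1"
  have "?q \<in> Sym 2"
    by (intro Sym_add Sym_cmul mono2_in_Sym) auto
  moreover have "w_grauert \<tau> l = (\<lambda>z0 z1. ?q z0 z1 ^ l)"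
    by (simp add: w_grauert_def mono2_def mult_ac)
  ultimately show ?thesis
    by (simp only: Sym_power)
qed

text \<open>Since w_l is a power of the quadratic form of \<open>z_tau\<close> up to scale, g.w_l
  depends on g only through the point g z_tau, and it is a holomorphic polynomial in that
  point.\<close>

lemma act_w_grauert:
  assumes "\<tau> > 0" "g \<in> SO3"
  shows "act g (w_grauert \<tau> l) z0 z1 = (quadr (Phi \<tau> g) z0 z1 / of_real (sinh \<tau>)) ^ l"
proof -
  obtain U where U: "lift g U"
    using ex_lift[OF assms(2)] by blast
  have "sub U (w_grauert \<tau> l) z0 z1 = (sub U (quadr (z_tau \<tau>)) z0 z1 / of_real (sinh \<tau>)) ^ l"
    unfolding w_grauert_quadr[OF assms(1)] sub_def ..
  then show ?thesis
    using U unfolding act_eq_sub[OF U w_grauert_in_Sym] by (simp add: lift_def Phi_eq)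
qed

text \<open>Holomorphy in the form that the Cauchy-Riemann equations use: a derivative along real
  curves that commutes with multiplication by i.\<close>

definition holo_deriv :: "(complex^3 \<Rightarrow> complex) \<Rightarrow> (complex^3 \<Rightarrow> complex^3 \<Rightarrow> complex) \<Rightarrow> bool" where
  "holo_deriv H D \<longleftrightarrow>
     (\<forall>\<gamma> v. (\<gamma> has_vector_derivative v) (at 0) \<longrightarrow> ((\<lambda>t. H (\<gamma> t)) has_vector_derivative D (\<gamma> 0) v) (at 0)) \<and>
     (\<forall>z v. D z (\<i> *s v) = \<i> * D z v)"

lemma cr_function_of_holomorphic:
  assumes "polynomial_function H" and D: "holo_deriv H D"
  shows "cr_function M H"
  unfolding cr_function_def
proof (intro conjI ballI allI impI)
  show "smooth_on_mfd M H"
    by (rule smooth_on_mfd_polynomial[OF assms(1)]) simp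
  fix p \<gamma> \<delta> v assume c: "curve_at M p \<gamma> v \<and> curve_at M p \<delta> (\<i> *s v)"
  have "((H \<circ> \<gamma>) has_vector_derivative D (\<gamma> 0) v) (at 0)"
    using D c unfolding holo_deriv_def curve_at_def o_def by blast
  moreover have "((H \<circ> \<delta>) has_vector_derivative D (\<delta> 0) (\<i> *s v)) (at 0)"
    using D c unfolding holo_deriv_def curve_at_def o_def by blast
  moreover have "D (\<delta> 0) (\<i> *s v) = \<i> * D (\<gamma> 0) v"
    using D c unfolding holo_deriv_def curve_at_def by simp
  ultimately show "vector_derivative (H \<circ> \<gamma>) (at 0) + \<i> * vector_derivative (H \<circ> \<delta>) (at 0) = 0"
    by (simp add: vector_derivative_at flip: mult.assoc)
qed

lemma holo_deriv_add:
  assumes "holo_deriv H D" "holo_deriv H' D'"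
  shows "holo_deriv (\<lambda>z. H z + c * H' z) (\<lambda>z v. D z v + c * D' z v)"
  using assms unfolding holo_deriv_def
  by (auto intro!: has_vector_derivative_add has_vector_derivative_mult_right simp: algebra_simps)

lemma holo_deriv_quadr_power:
  "holo_deriv (\<lambda>z. (quadr z z0 z1 / s) ^ l)
    (\<lambda>z v. quadr v z0 z1 / s * (of_nat l * (quadr z z0 z1 / s) ^ (l - 1)))"
  unfolding holo_deriv_def
proof (intro conjI allI impI)
  fix \<gamma> :: "real \<Rightarrow> complex^3" and v assume \<gamma>: "(\<gamma> has_vector_derivative v) (at 0)"
  let ?q = "\<lambda>x. quadr x z0 z1 / s"
  have "((\<lambda>t. ?q (\<gamma> t)) has_vector_derivative ?q v) (at 0)"
    by (rule has_vector_derivative_divide[OF bounded_linear.has_vector_derivative[OF bounded_linear_quadr \<gamma>]])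
  moreover have "((\<lambda>w. w ^ l) has_field_derivative of_nat l * ?q (\<gamma> 0) ^ (l - 1)) (at (?q (\<gamma> 0)))"
    by (auto intro!: derivative_eq_intros)
  ultimately have "(((\<lambda>w. w ^ l) \<circ> (\<lambda>t. ?q (\<gamma> t))) has_vector_derivative ?q v * (of_nat l * ?q (\<gamma> 0) ^ (l - 1))) (at 0)"
    by (rule field_vector_diff_chain_at)
  then show "((\<lambda>t. ?q (\<gamma> t) ^ l) has_vector_derivative ?q v * (of_nat l * ?q (\<gamma> 0) ^ (l - 1))) (at 0)"
    by (simp only: o_def)
qed (simp add: quadr_cmul)

lemma polynomial_function_quadr_power:
  "polynomial_function (\<lambda>z::complex^3. (quadr z z0 z1 / s) ^ l)"
proof -
  have "polynomial_function (\<lambda>x::complex^3. x $ i)" for i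
    by (rule polynomial_function_bounded_linear) (rule bounded_linear_vec_nth)
  then have "polynomial_function (\<lambda>z::complex^3. (1 / s * quadr z z0 z1) ^ l)"
    by (intro polynomial_function_scale_left polynomial_function_cpower polynomial_function_quadr)
  then show ?thesis by simp
qed

text \<open>The induction carries a holomorphic polynomial on C^3 whose pullback is F on SO(3); its
  restriction to the tube boundary is a CR function.\<close>

lemma grauert_span:
  assumes "\<tau> > 0" "F \<in> fun_span (\<Union>l. line_blk (w_grauert \<tau> l))"
  shows "\<exists>a\<in>grauert_fun \<tau>. \<forall>g\<in>SO3. a g = F g"
proof -
  have "F \<in> fun_span (\<Union>l. blk_gen {w_grauert \<tau> l})"
    using assms(2) fun_span_line_blks by blast
  then have "\<exists>H D. polynomial_function H \<and> holo_deriv H D \<and> (\<forall>g\<in>SO3. H (Phi \<tau> g) = F g)"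
  proof (induction rule: fun_span_induct)
    case zero
    show ?case
      by (rule exI[of _ "\<lambda>z. 0"], rule exI[of _ "\<lambda>z v. 0"]) (simp add: holo_deriv_def)
  next
    case (step F f c)
    then obtain H D where H: "polynomial_function H" "holo_deriv H D" "\<forall>g\<in>SO3. H (Phi \<tau> g) = F g"
      by blast
    obtain l z0 z1 where f: "f = (\<lambda>g. act g (w_grauert \<tau> l) z0 z1)"
      using step.hyps by (auto simp: blk_gen_def)
    let ?s = "complex_of_real (sinh \<tau>)"
    have "polynomial_function (\<lambda>z. H z + c * (quadr z z0 z1 / ?s) ^ l)"
      by (intro polynomial_function_add polynomial_function_scale_left polynomial_function_quadr_power H(1))
    moreover have "\<forall>g\<in>SO3. H (Phi \<tau> g) + c * (quadr (Phi \<tau> g) z0 z1 / ?s) ^ l = F g + c * f g"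
      unfolding f by (rule ballI) (simp only: act_w_grauert[OF assms(1)] bspec[OF H(3)])
    ultimately show ?case
      using holo_deriv_add[OF H(2) holo_deriv_quadr_power[of z0 z1 ?s l], of c] by blast
  qed
  then obtain H D where H: "polynomial_function H" "holo_deriv H D" "\<forall>g\<in>SO3. H (Phi \<tau> g) = F g"
    by blast
  have "H \<circ> Phi \<tau> \<in> grauert_fun \<tau>"
    unfolding grauert_fun_def using cr_function_of_holomorphic[OF H(1,2)] by blast
  then show ?thesis
    using H(3) by (intro bexI[of _ "H \<circ> Phi \<tau>"]) auto
qed

lemma dX_w_grauert:
  assumes "\<tau> > 0"
  shows "dX (grauert_x \<tau>) (w_grauert \<tau> l) = (\<lambda>z0 z1. 0)"
proof (intro ext)
  fix z0 z1
  define s c where "s = complex_of_real (sinh \<tau>)" and "c = complex_of_real (cosh \<tau> / sinh \<tau>)"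
  have ch: "complex_of_real (cosh \<tau>) = s * c"
    using assms by (simp add: s_def c_def)
  \<comment> \<open>The common factor l q^(l - 1) of both partial derivatives of q^l; the claim
    reduces to the quadratic form q.\<close>
  define Q where "Q = of_nat l * (z0\<^sup>2 + z1\<^sup>2 + 2 * c * z0 * z1) ^ (l - 1)"
  have "((\<lambda>z. (z\<^sup>2 + z1\<^sup>2 + 2 * c * z * z1) ^ l) has_field_derivative Q * (2 * z0 + 2 * c * z1)) (at z0)"
    unfolding Q_def by (auto intro!: derivative_eq_intros)
  then have d0: "d0 (w_grauert \<tau> l) z0 z1 = Q * (2 * z0 + 2 * c * z1)"
    by (simp add: d0_def w_grauert_def c_def DERIV_imp_deriv)
  have "((\<lambda>z. (z0\<^sup>2 + z\<^sup>2 + 2 * c * z0 * z) ^ l) has_field_derivative Q * (2 * z1 + 2 * c * z0)) (at z1)"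
    unfolding Q_def by (auto intro!: derivative_eq_intros)
  then have d1: "d1 (w_grauert \<tau> l) z0 z1 = Q * (2 * z1 + 2 * c * z0)"
    by (simp add: d1_def w_grauert_def c_def DERIV_imp_deriv)
  have x: "grauert_x \<tau> $ 1 = \<i> * s" "grauert_x \<tau> $ 2 = 0" "grauert_x \<tau> $ 3 = s * c"
    by (simp_all add: grauert_x_def s_def ch[unfolded s_def])
  have i: "s * c / (2 * \<i>) = - \<i> * (s * c) / 2"
    by (simp add: field_simps)
  show "dX (grauert_x \<tau>) (w_grauert \<tau> l) z0 z1 = 0"
    unfolding dX_sym_ops sym_raise_def sym_lower_def sym_weight_def d0 d1 x i
    by (simp add: field_simps)
qed

lemma grauert_data:
  assumes "\<tau> > 0" "normalized_haar \<mu>"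
  shows "hardy_data \<mu> (grauert_fun \<tau>) (grauert_x \<tau>) (w_grauert \<tau>)"
proof
  show "normalized_haar \<mu>" by fact
  show "\<exists>f'. (\<forall>j. rderiv j f (f' j)) \<and> (\<forall>g\<in>SO3. (\<Sum>j\<in>UNIV. grauert_x \<tau> $ j * f' j g) = 0)"
    if "f \<in> grauert_fun \<tau>" for f
    by (rule grauert_killed[OF that])
  show "\<exists>a\<in>grauert_fun \<tau>. \<forall>g\<in>SO3. a g = F g" if "F \<in> fun_span (\<Union>l. line_blk (w_grauert \<tau> l))" for F
    by (rule grauert_span[OF assms(1) that])
  show "w_grauert \<tau> l \<in> Sym (2 * l)" for l
    by (rule w_grauert_in_Sym)
  show "\<exists>c. p = (\<lambda>z0 z1. c * w_grauert \<tau> l z0 z1)"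
    if "p \<in> Sym (2 * l)" "dX (grauert_x \<tau>) p = (\<lambda>z0 z1. 0)" for p l
    by (rule exI, rule dX_kernel_unique[OF that w_grauert_in_Sym dX_w_grauert[OF assms(1)]])
       (use assms(1) in \<open>simp_all add: w_grauert_def grauert_x_def\<close>)
qed

(* The rotation about e1 with sin t = tanh(tau) takes z_tau / sinh(tau) to (i, -1, 1 / sinh(tau)),
   whose quadratic form is z0 * (2 z0 + (2 / sinh(tau)) z1); after it only l + 1 monomials occur. *)
lemma act_rot_w_grauert:
  assumes "\<tau> > 0"
  obtains g where "g \<in> SO3"
    "act g (w_grauert \<tau> l) = (\<lambda>z0 z1. \<Sum>k\<le>l. of_real (real (l choose k) * 2 ^ (l - k) * (2 / sinh \<tau>) ^ k) * mono2 (2 * l) k z0 z1)"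
proof -
  have c0: "cosh \<tau> \<noteq> 0"
    using cosh_real_pos[of \<tau>] by simp
  have "(1 / cosh \<tau>)\<^sup>2 + (sinh \<tau> / cosh \<tau>)\<^sup>2 = (1 + (sinh \<tau>)\<^sup>2) / (cosh \<tau>)\<^sup>2"
    by (simp add: power_divide add_divide_distrib)
  also have "\<dots> = 1"
    unfolding add.commute[of 1] cosh_square_eq[symmetric] using c0 by simp
  finally obtain t where t': "1 / cosh \<tau> = cos t" "sinh \<tau> / cosh \<tau> = sin t"
    by (rule sincos_total_2pi)
  have t: "cos t * cosh \<tau> = 1" "sin t * cosh \<tau> = sinh \<tau>"
    unfolding t'[symmetric] using c0 by simp_all
  have ct: "complex_of_real (cos t) * of_real (cosh \<tau>) = 1" "complex_of_real (sin t) * of_real (cosh \<tau>) = of_real (sinh \<tau>)"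
    using t by (metis of_real_mult of_real_1)+
  let ?s = "complex_of_real (sinh \<tau>)"
  have s: "?s \<noteq> 0" using assms by simp
  have P: "Phi \<tau> (rot 1 t) $ 1 = \<i> * ?s" "Phi \<tau> (rot 1 t) $ 2 = - ?s" "Phi \<tau> (rot 1 t) $ 3 = 1"
    using ct by (simp_all add: Phi_def rot_explicit matrix_vector_mult_def sum_3 z_tau_def)
  have q: "quadr (Phi \<tau> (rot 1 t)) z0 z1 / ?s = z0 * (2 / ?s * z1 + 2 * z0)" for z0 z1
    unfolding quadr_def P using s by (simp add: field_simps power2_eq_square)
  have "act (rot 1 t) (w_grauert \<tau> l) z0 z1 =
      (\<Sum>k\<le>l. of_real (real (l choose k) * 2 ^ (l - k) * (2 / sinh \<tau>) ^ k) * mono2 (2 * l) k z0 z1)" for z0 z1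
  proof -
    have "act (rot 1 t) (w_grauert \<tau> l) z0 z1 = z0 ^ l * (2 / ?s * z1 + 2 * z0) ^ l"
      unfolding act_w_grauert[OF assms rot_in_SO3] q by (rule power_mult_distrib)
    also have "\<dots> = (\<Sum>k\<le>l. z0 ^ l * (of_nat (l choose k) * (2 / ?s * z1) ^ k * (2 * z0) ^ (l - k)))"
      unfolding binomial_ring by (rule sum_distrib_left)
    also have "\<dots> = (\<Sum>k\<le>l. of_real (real (l choose k) * 2 ^ (l - k) * (2 / sinh \<tau>) ^ k) * mono2 (2 * l) k z0 z1)"
    proof (intro sum.cong refl)
      fix k assume "k \<in> {..l}"
      then have "2 * l - k = l + (l - k)" by simp
      then have m: "mono2 (2 * l) k z0 z1 = z0 ^ l * z0 ^ (l - k) * z1 ^ k"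
        by (simp only: mono2_def power_add)
      show "z0 ^ l * (of_nat (l choose k) * (2 / ?s * z1) ^ k * (2 * z0) ^ (l - k)) =
          of_real (real (l choose k) * 2 ^ (l - k) * (2 / sinh \<tau>) ^ k) * mono2 (2 * l) k z0 z1"
        unfolding m power_mult_distrib by (simp add: mult_ac)
    qed
    finally show ?thesis .
  qed
  then show thesis
    by (intro that[OF rot_in_SO3[of 1 t]] ext)
qed

lemma inner_diag:
  assumes B: "invariant_inner_product n B" "B (mono2 n 0) (mono2 n 0) = 1" and "l \<le> n"
  shows "B (\<lambda>z0 z1. \<Sum>k\<le>l. of_real (c k) * mono2 n k z0 z1) (\<lambda>z0 z1. \<Sum>k\<le>l. of_real (c k) * mono2 n k z0 z1)
    = of_real (\<Sum>k\<le>l. (c k)\<^sup>2 / real (n choose k))"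
proof -
  let ?r = "\<lambda>z0 z1. \<Sum>k\<le>l. complex_of_real (c k) * mono2 n k z0 z1"
  have m: "mono2 n k \<in> Sym n" if "k \<le> l" for k
    using that assms(3) by (intro mono2_in_Sym) simp
  have r: "?r \<in> Sym n"
    using m by (intro Sym_sum Sym_cmul) simp
  have left: "B ?r q = (\<Sum>k\<le>l. of_real (c k) * B (mono2 n k) q)" if q: "q \<in> Sym n" for q
  proof -
    have "B ?r q = (\<Sum>k\<le>l. B (\<lambda>z0 z1. of_real (c k) * mono2 n k z0 z1) q)"
      by (rule inner_sum_left[OF B(1) _ q]) (use m in \<open>auto intro: Sym_cmul\<close>)
    also have "\<dots> = (\<Sum>k\<le>l. of_real (c k) * B (mono2 n k) q)"
      by (intro sum.cong refl inner_cmul_left[OF B(1)] m q) simp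
    finally show ?thesis .
  qed
  have "B (mono2 n k) ?r = of_real (c k / real (n choose k))" if k: "k \<le> l" for k
  proof -
    have "B (mono2 n k) ?r = cnj (B ?r (mono2 n k))"
      by (rule inner_cnj[OF B(1) r m[OF k]])
    also have "B ?r (mono2 n k) = (\<Sum>j\<le>l. of_real (c j) * (if j = k then 1 / of_nat (n choose k) else 0))"
      unfolding left[OF m[OF k]] using k assms(3)
      by (intro sum.cong refl) (subst invariant_inner_mono2[OF B], auto)
    also have "\<dots> = of_real (c k / real (n choose k))"
      using k by (simp add: if_distrib[of "\<lambda>z. _ * z"] cong: if_cong)
    finally show ?thesis by simp
  qed
  then show ?thesis
    unfolding left[OF r] by (simp add: power2_eq_square)
qed

text \<open>The monomials are orthogonal, so pairing with z0^(2l) reads off its coefficient, which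
  is the value at (1, 0).\<close>

lemma inner_u_hopf:
  assumes B: "invariant_inner_product (2 * l) B" "B (u_hopf l) (u_hopf l) = 1" and p: "p \<in> Sym (2 * l)"
  shows "B p (u_hopf l) = p 1 0"
proof -
  obtain a where a: "p = bform (2 * l) a"
    using p by (auto simp: Sym_eq)
  have B0: "B (mono2 (2 * l) 0) (mono2 (2 * l) 0) = 1"
    using B(2) by (simp add: u_hopf_eq)
  have "B p (u_hopf l) = (\<Sum>k\<le>2*l. B (\<lambda>z0 z1. a k * mono2 (2 * l) k z0 z1) (mono2 (2 * l) 0))"
    unfolding a bform_def[abs_def] u_hopf_eq
    by (rule inner_sum_left[OF B(1)]) (auto intro: Sym_cmul mono2_in_Sym)
  also have "\<dots> = (\<Sum>k\<le>2*l. a k * (if k = 0 then 1 else 0))"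
    by (intro sum.cong refl)
       (subst inner_cmul_left[OF B(1)], auto simp: mono2_in_Sym invariant_inner_mono2[OF B(1) B0])
  also have "\<dots> = p 1 0"
    by (simp add: a bform_def mono2_def power_0_left)
  finally show ?thesis .
qed

context sym_rep
begin

lemma inner_w_grauert:
  assumes B: "invariant_inner_product (2 * l) B" "B (u_hopf l) (u_hopf l) = 1" and "\<tau> > 0"
  shows "B (w_grauert \<tau> l) (w_grauert \<tau> l)
    = of_real (4 ^ l / sinh \<tau> ^ (2 * l) * poly (legendre l) (cosh (2 * \<tau>)) / real ((2 * l) choose l))"
proof -
  obtain g where g: "g \<in> SO3" "act g (w_grauert \<tau> l) = (\<lambda>z0 z1. \<Sum>k\<le>l.
      of_real (real (l choose k) * 2 ^ (l - k) * (2 / sinh \<tau>) ^ k) * mono2 (2 * l) k z0 z1)"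
    using act_rot_w_grauert[OF assms(3)] by blast
  have "B (w_grauert \<tau> l) (w_grauert \<tau> l) = B (act g (w_grauert \<tau> l)) (act g (w_grauert \<tau> l))"
    by (rule inner_act[OF g(1) w_grauert_in_Sym w_grauert_in_Sym, symmetric])
  also have "\<dots> = of_real (\<Sum>k\<le>l. (real (l choose k) * 2 ^ (l - k) * (2 / sinh \<tau>) ^ k)\<^sup>2 / real ((2 * l) choose k))"
    unfolding g(2) using B(2) by (intro inner_diag[OF B(1)]) (simp_all add: u_hopf_eq)
  \<comment> \<open>The argument of P_l in \<open>norm_sum_legendre\<close> with s = sinh
    \<tau>.\<close>
  also have "1 + 2 * (sinh \<tau>)\<^sup>2 = cosh (2 * \<tau>)"
    by (simp add: cosh_double cosh_square_eq)
  then have "(\<Sum>k\<le>l. (real (l choose k) * 2 ^ (l - k) * (2 / sinh \<tau>) ^ k)\<^sup>2 / real ((2 * l) choose k))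
      = 4 ^ l / sinh \<tau> ^ (2 * l) * poly (legendre l) (cosh (2 * \<tau>)) / real ((2 * l) choose l)"
    using norm_sum_legendre[of "sinh \<tau>" l] assms(3) by simp
  finally show ?thesis .
qed

text \<open>w_l has coefficient 1 at z0^(2l) and u_l is a unit vector, so the overlap is the
  reciprocal of the norm of w_l.\<close>

lemma overlap:
  assumes B: "invariant_inner_product (2 * l) B" "B (u_hopf l) (u_hopf l) = 1" and \<tau>: "\<tau> > 0"
  shows "cmod (B (bi_normalize B (w_grauert \<tau> l)) (bi_normalize B (u_hopf l)))
    = sqrt (real ((2 * l) choose l)) / 2 ^ l * (sinh \<tau> ^ l / sqrt (poly (legendre l) (cosh (2 * \<tau>))))"
proof -
  let ?w = "w_grauert \<tau> l" and ?u = "u_hopf l" and ?N = "Re (B (w_grauert \<tau> l) (w_grauert \<tau> l))"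
  let ?P = "poly (legendre l) (cosh (2 * \<tau>))" and ?C = "real ((2 * l) choose l)"
  have u: "?u \<in> Sym (2 * l)" and w: "?w \<in> Sym (2 * l)"
    by (simp_all add: u_hopf_eq mono2_in_Sym w_grauert_in_Sym)
  have w0: "?w \<noteq> (\<lambda>z0 z1. 0)"
  proof
    assume "?w = (\<lambda>z0 z1. 0)"
    then have "?w 1 0 = 0" by simp
    then show False by (simp add: w_grauert_def)
  qed
  have N: "?N > 0"
    using B(1) w w0 unfolding invariant_inner_product_def by blast
  have NP: "?N = 4 ^ l / sinh \<tau> ^ (2 * l) * ?P / ?C"
    unfolding inner_w_grauert[OF B \<tau>] by simp
  have nu: "bi_normalize B ?u = ?u"
    by (simp add: bi_normalize_def bi_smult_def B(2))
  have "B (bi_normalize B ?w) (bi_normalize B ?u) = of_real (1 / sqrt ?N) * B ?w ?u"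
    unfolding nu unfolding bi_normalize_def bi_smult_def by (rule inner_cmul_left[OF B(1) w u])
  also have "B ?w ?u = 1"
    unfolding inner_u_hopf[OF B w] by (simp add: w_grauert_def)
  finally have "cmod (B (bi_normalize B ?w) (bi_normalize B ?u)) = 1 / sqrt ?N"
    using N by (simp add: norm_divide)
  also have "sqrt ?N = 2 ^ l / sinh \<tau> ^ l * sqrt ?P / sqrt ?C"
  proof -
    have "sqrt (4 ^ l) = (2 ^ l :: real)"
      by (simp add: real_sqrt_power)
    moreover have "sqrt (sinh \<tau> ^ (2 * l)) = sinh \<tau> ^ l"
      using \<tau> by (simp add: real_sqrt_power power_mult)
    ultimately show ?thesis
      unfolding NP by (simp only: real_sqrt_divide real_sqrt_mult)
  qed
  finally show ?thesis by simp
qed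

end

theorem theorem1p1:
  fixes \<tau> :: real
    and \<mu> :: "(real^3^3) measure"
    and \<pi> :: "nat \<Rightarrow> real^3^3 \<Rightarrow> complex Matrix.mat"
    and K :: "nat \<Rightarrow> complex Matrix.vec \<Rightarrow> complex Matrix.vec"
    and B :: "nat \<Rightarrow> bipoly \<Rightarrow> bipoly \<Rightarrow> complex"
    and S :: "nat \<Rightarrow> complex Matrix.vec \<Rightarrow> bipoly"
  assumes tau: "\<tau> > 0"
    and haar: "normalized_haar \<mu>"
    and irreps: "\<And>l. irreducible_unitary_rep (2 * l + 1) (\<pi> l)"
    and selfdual: "\<And>l. unitary_intertwiner (2 * l + 1) (contragredient (\<pi> l)) (\<pi> l) (K l)"
    and inner: "\<And>l. invariant_inner_product (2 * l) (B l)"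
    and inner_normalized: "\<And>l. B l (u_hopf l) (u_hopf l) = 1"
    and realization: "\<And>l. sym_realization l (\<pi> l) (B l) (S l)"
  shows "\<exists>Lu Lw :: nat \<Rightarrow> complex Matrix.vec set.
      (\<forall>l. vec_line (2 * l + 1) (Lu l) \<and> vec_line (2 * l + 1) (Lw l) \<and>
           hopf_hardy \<mu> \<inter> peter_weyl_block \<mu> (2 * l + 1) (\<pi> l)
             = tensor_space \<mu> (2 * l + 1) (\<pi> l) (Lu l) \<and>
           grauert_hardy \<mu> \<tau> \<inter> peter_weyl_block \<mu> (2 * l + 1) (\<pi> l)
             = tensor_space \<mu> (2 * l + 1) (\<pi> l) (Lw l) \<and>
           (S l \<circ> K l) ` Lu l = bi_line (u_hopf l) \<and>
           (S l \<circ> K l) ` Lw l = bi_line (w_grauert \<tau> l)) \<and>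
      l2_direct_sum \<mu> (hopf_hardy \<mu>) (\<lambda>l. tensor_space \<mu> (2 * l + 1) (\<pi> l) (Lu l)) \<and>
      l2_direct_sum \<mu> (grauert_hardy \<mu> \<tau>) (\<lambda>l. tensor_space \<mu> (2 * l + 1) (\<pi> l) (Lw l)) \<and>
      (\<forall>l. cmod (B l (bi_normalize (B l) (w_grauert \<tau> l)) (bi_normalize (B l) (u_hopf l)))
             = sqrt (real ((2 * l) choose l)) / 2 ^ l
               * (sinh \<tau> ^ l / sqrt (poly (legendre l) (cosh (2 * \<tau>)))))"
proof -
  interpret hopf: hardy_data \<mu> hopf_fun hopf_x u_hopf
    by (rule hopf_data[OF haar])
  interpret grauert: hardy_data \<mu> "grauert_fun \<tau>" "grauert_x \<tau>" "w_grauert \<tau>"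
    by (rule grauert_data[OF tau haar])
  have rep: "dual_sym_rep l (2 * l + 1) (\<pi> l) (B l) (S l) (K l)" for l
    using irreps[of l] realization[of l] selfdual[of l]
    by unfold_locales (simp_all add: irreducible_unitary_rep_def)
  have u: "u_hopf l \<in> Sym (2 * l)" "u_hopf l \<noteq> (\<lambda>z0 z1. 0)"
    and w: "w_grauert \<tau> l \<in> Sym (2 * l)" "w_grauert \<tau> l \<noteq> (\<lambda>z0 z1. 0)" for l
  proof -
    have "u_hopf l 1 0 = 1" "w_grauert \<tau> l 1 0 = 1"
      by (simp_all add: u_hopf_def w_grauert_def)
    then show "u_hopf l \<noteq> (\<lambda>z0 z1. 0)" "w_grauert \<tau> l \<noteq> (\<lambda>z0 z1. 0)"
      by auto
  qed (simp_all add: u_hopf_eq mono2_in_Sym w_grauert_in_Sym)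
  \<comment> \<open>The lines in the dual are the preimages of the lines of forms under the
    identification of the dual with Sym.\<close>
  define L where "L p l = {\<phi> \<in> carrier_vec (2 * l + 1). (S l \<circ> K l) \<phi> \<in> bi_line p}" for p l
  have L: "vec_line (2 * l + 1) (L p l)" "(S l \<circ> K l) ` L p l = bi_line p" "L p l \<subseteq> carrier_vec (2 * l + 1)"
    if "p \<in> Sym (2 * l)" "p \<noteq> (\<lambda>z0 z1. 0)" for p l
    using dual_sym_rep.vec_line_T[OF rep that] unfolding dual_sym_rep.T_def[OF rep] L_def .
  \<comment> \<open>Blocks and lines become spaces of concrete matrix coefficients, the form in
    which the two interpretations describe them.\<close>
  have block: "peter_weyl_block \<mu> (2 * l + 1) (\<pi> l) = ae_space \<mu> (blk l)" for l
    by (rule dual_sym_rep.tensor_block[OF rep hopf.space_haar])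
  have line: "tensor_space \<mu> (2 * l + 1) (\<pi> l) (L p l) = ae_space \<mu> (line_blk p)"
    if "p \<in> Sym (2 * l)" "p \<noteq> (\<lambda>z0 z1. 0)" for p l
    by (rule dual_sym_rep.tensor_line[OF rep L(3)[OF that] _ hopf.space_haar])
       (simp only: dual_sym_rep.T_def[OF rep] L(2)[OF that])
  have H: "hopf_hardy \<mu> = l2_closure \<mu> hopf_fun" "grauert_hardy \<mu> \<tau> = l2_closure \<mu> (grauert_fun \<tau>)"
    by (simp_all only: hopf_hardy_def hopf_fun_def grauert_hardy_def grauert_fun_def)
  have overlap: "cmod (B l (bi_normalize (B l) (w_grauert \<tau> l)) (bi_normalize (B l) (u_hopf l)))
      = sqrt (real ((2 * l) choose l)) / 2 ^ l * (sinh \<tau> ^ l / sqrt (poly (legendre l) (cosh (2 * \<tau>))))" for l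
    by (rule sym_rep.overlap[OF dual_sym_rep.axioms(1)[OF rep] inner inner_normalized tau])
  show ?thesis
  proof (rule exI[of _ "\<lambda>l. L (u_hopf l) l"], rule exI[of _ "\<lambda>l. L (w_grauert \<tau> l) l"], intro conjI allI)
    fix l
    show "vec_line (2 * l + 1) (L (u_hopf l) l)" "vec_line (2 * l + 1) (L (w_grauert \<tau> l) l)"
      by (intro L(1) u w)+
    show "(S l \<circ> K l) ` L (u_hopf l) l = bi_line (u_hopf l)"
      "(S l \<circ> K l) ` L (w_grauert \<tau> l) l = bi_line (w_grauert \<tau> l)"
      by (intro L(2) u w)+
    show "hopf_hardy \<mu> \<inter> peter_weyl_block \<mu> (2 * l + 1) (\<pi> l)
        = tensor_space \<mu> (2 * l + 1) (\<pi> l) (L (u_hopf l) l)"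
      unfolding H block line[OF u] by (rule hopf.hardy_block)
    show "grauert_hardy \<mu> \<tau> \<inter> peter_weyl_block \<mu> (2 * l + 1) (\<pi> l)
        = tensor_space \<mu> (2 * l + 1) (\<pi> l) (L (w_grauert \<tau> l) l)"
      unfolding H block line[OF w] by (rule grauert.hardy_block)
  next
    show "l2_direct_sum \<mu> (hopf_hardy \<mu>) (\<lambda>l. tensor_space \<mu> (2 * l + 1) (\<pi> l) (L (u_hopf l) l))"
      unfolding H line[OF u] by (rule hopf.hardy_direct_sum)
    show "l2_direct_sum \<mu> (grauert_hardy \<mu> \<tau>) (\<lambda>l. tensor_space \<mu> (2 * l + 1) (\<pi> l) (L (w_grauert \<tau> l) l))"
      unfolding H line[OF w] by (rule grauert.hardy_direct_sum)
  qed (rule overlap)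
qed

end
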